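(* Let $\mu\ge1$ be an integer, $\theta>-1$, $\sigma\in\mathbb{R}$, $\beta>-1$ and $0<\gamma<1$. There is a constant $C>0$, independent of $M$ and $v$, such that for every integer $M\ge1$, with $\widehat\mu:=\min\{\mu,M+1\}$, and every $v\in C(\Lambda)\cap\mathcal{A}_{\theta,\sigma,\gamma,\beta}^{\mu}(\Lambda)$ with $\mathscr{D}_{\theta,\sigma,\gamma,\beta}v\in\mathcal{A}_{\theta,\sigma,\gamma,\beta}^{\mu-1}(\Lambda)$, $$\big\|\mathcal{I}_M^{\theta,\sigma,\gamma,\beta}v-v\big\|_{\varrho^{\theta,\sigma,\gamma,\beta}}\le C\left[\frac{(M+1-\widehat\mu)!}{M!}\right]^{1/2}\Big[\big\|\mathscr{D}_{\theta,\sigma,\gamma,\beta}^{\,\widehat\mu}v\big\|_{\varrho^{\theta+\widehat\mu-1,\sigma+\widehat\mu-1,\gamma,\beta}}+2\sqrt{\log M}\,\big\|\mathscr{D}_{\theta,\sigma,\gamma,\beta}^{\,\widehat\mu}v\big\|_{\varrho^{\theta+\widehat\mu,\sigma+\widehat\mu,\gamma,\beta}}\Big].$$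
   Context: $\Lambda=(0,\infty)$. For $\theta>-1$, $\sigma\in\mathbb{R}$, $\beta>-1$, $0<\gamma<1$ set $$\varrho^{\theta,\sigma,\gamma,\beta}(x):=\gamma(\beta+1)^{\theta+1}x^{\gamma(\sigma+1)-1}e^{-(\beta+1)x^\gamma},\qquad x\in\Lambda.$$ For a weight $\varrho$, $L^2_\varrho(\Lambda)$ is the weighted space with norm $\|v\|_\varrho=(\int_0^\infty|v|^2\varrho\,dx)^{1/2}$ (real-valued functions). The scaled mapped derivative is $$\mathscr{D}_{\theta,\sigma,\gamma,\beta}u:=x^{\frac{\gamma(\theta-\sigma)}{2}}\,\mathscr{D}_{\gamma,\beta}\Big(x^{-\frac{\gamma(\theta-\sigma)}{2}}u\Big),\qquad \mathscr{D}_{\gamma,\beta}u:=\frac{x^{1-\gamma}}{\gamma(\beta+1)}\,\partial_xu,$$ with $\partial_x$ understood in the weak sense; $\mathscr{D}_{\theta,\sigma,\gamma,\beta}^{\,r}$ is its $r$-fold iterate. For an integer $\mu\ge 0$, $$\mathcal{A}_{\theta,\sigma,\gamma,\beta}^{\mu}(\Lambda):=\big\{v\in L^2_{\varrho^{\theta,\sigma,\gamma,\beta}}(\Lambda):\ \mathscr{D}_{\theta,\sigma,\gamma,\beta}^{\,r}v\in L^2_{\varrho^{\theta+r,\sigma+r,\gamma,\beta}}(\Lambda),\ 1\le r\le\mu\big\}.$$ $L_m^{(\theta)}(y)=\sum_{r=0}^m\frac{(-1)^r}{r!}\binom{m+\theta}{m-r}y^r$ is the generalized Laguerre polynomial of degree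 $m$. Let $y_0^{(\theta)},\dots,y_M^{(\theta)}\in(0,\infty)$ be the zeros of $L_{M+1}^{(\theta)}$ and $x_i^{(\theta,\gamma,\beta)}:=\big(y_i^{(\theta)}/(\beta+1)\big)^{1/\gamma}$, $0\le i\le M$. With $\eta:=\gamma(\theta-\sigma)/2$, let $\mathbb{P}_M^{\eta,\gamma}:=\{x^{\eta}q(x):q\in\operatorname{span}\{1,x^\gamma,\dots,x^{M\gamma}\}\}$. The generalized interpolation operator $\mathcal{I}_M^{\theta,\sigma,\gamma,\beta}:C(\Lambda)\to\mathbb{P}_M^{\eta,\gamma}$ sends $v$ to the unique element of $\mathbb{P}_M^{\eta,\gamma}$ with $\mathcal{I}_M^{\theta,\sigma,\gamma,\beta}v(x_i^{(\theta,\gamma,\beta)})=v(x_i^{(\theta,\gamma,\beta)})$ for $0\le i\le M$; explicitly $$\mathcal{I}_M^{\theta,\sigma,\gamma,\beta}v(x)=\sum_{i=0}^Mv\big(x_i^{(\theta,\gamma,\beta)}\big)\,\frac{x^{\eta}}{(x_i^{(\theta,\gamma,\beta)})^{\eta}}\prod_{\substack{r=0\\ r\ne i}}^M\frac{x^\gamma-(x_r^{(\theta,\gamma,\beta)})^\gamma}{(x_i^{(\theta,\gamma,\beta)})^\gamma-(x_r^{(\theta,\gamma,\beta)})^\gamma}.$$ *)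

theory Defs
  imports "HOL-Analysis.Analysis"
begin

abbreviation halfline :: "real set" where
  "halfline \<equiv> {0<..}"

definition weight :: "real \<Rightarrow> real \<Rightarrow> real \<Rightarrow> real \<Rightarrow> real \<Rightarrow> real" where
  "weight \<theta> \<sigma> \<gamma> \<beta> x =
     \<gamma> * (\<beta> + 1) powr (\<theta> + 1) * x powr (\<gamma> * (\<sigma> + 1) - 1) * exp (- (\<beta> + 1) * x powr \<gamma>)"

text \<open>Elements of the weighted space are represented by functions on the reals; their values
  outside the half line are irrelevant.\<close>

definition weighted_L2 :: "(real \<Rightarrow> real) \<Rightarrow> (real \<Rightarrow> real) set" where
  "weighted_L2 w = {v. v \<in> borel_measurable (lebesgue_on halfline) \<and>
     integrable (lebesgue_on halfline) (\<lambda>x. (v x)\<^sup>2 * w x)}"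

definition weighted_norm :: "(real \<Rightarrow> real) \<Rightarrow> (real \<Rightarrow> real) \<Rightarrow> real" where
  "weighted_norm w v = sqrt (LINT x|lebesgue_on halfline. (v x)\<^sup>2 * w x)"

definition locally_integrable :: "(real \<Rightarrow> real) \<Rightarrow> bool" where
  "locally_integrable f \<longleftrightarrow>
     (\<forall>K. compact K \<and> K \<subseteq> halfline \<longrightarrow> f absolutely_integrable_on K)"

definition test_function :: "(real \<Rightarrow> real) \<Rightarrow> bool" where
  "test_function \<phi> \<longleftrightarrow>
     (\<forall>n. (deriv ^^ n) \<phi> differentiable_on UNIV) \<and>
     (\<exists>K. compact K \<and> K \<subseteq> halfline \<and> (\<forall>x. x \<notin> K \<longrightarrow> \<phi> x = 0))"

definition has_weak_deriv :: "(real \<Rightarrow> real) \<Rightarrow> (real \<Rightarrow> real) \<Rightarrow> bool" where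
  "has_weak_deriv f g \<longleftrightarrow> locally_integrable f \<and> locally_integrable g \<and>
     (\<forall>\<phi>. test_function \<phi> \<longrightarrow>
        (LINT x|lebesgue_on halfline. f x * deriv \<phi> x) =
        - (LINT x|lebesgue_on halfline. g x * \<phi> x))"

definition weakly_differentiable :: "(real \<Rightarrow> real) \<Rightarrow> bool" where
  "weakly_differentiable f \<longleftrightarrow> (\<exists>g. has_weak_deriv f g)"

text \<open>A weak derivative is determined only almost everywhere on the half line;
  the choice operator picks a representative. The value is meaningful only for weakly
  differentiable functions, so every use below that asserts membership in a space of weakly
  differentiable functions states weak differentiability separately.\<close>

definition weak_deriv :: "(real \<Rightarrow> real) \<Rightarrow> real \<Rightarrow> real" where
  "weak_deriv f = (SOME g. has_weak_deriv f g)"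

definition mapped_deriv :: "real \<Rightarrow> real \<Rightarrow> (real \<Rightarrow> real) \<Rightarrow> real \<Rightarrow> real" where
  "mapped_deriv \<gamma> \<beta> u = (\<lambda>x. x powr (1 - \<gamma>) / (\<gamma> * (\<beta> + 1)) * weak_deriv u x)"

definition scaled_deriv ::
    "real \<Rightarrow> real \<Rightarrow> real \<Rightarrow> real \<Rightarrow> (real \<Rightarrow> real) \<Rightarrow> real \<Rightarrow> real" where
  "scaled_deriv \<theta> \<sigma> \<gamma> \<beta> u = (\<lambda>x. x powr (\<gamma> * (\<theta> - \<sigma>) / 2) *
     mapped_deriv \<gamma> \<beta> (\<lambda>t. t powr (- (\<gamma> * (\<theta> - \<sigma>) / 2)) * u t) x)"

definition scaled_differentiable ::
    "real \<Rightarrow> real \<Rightarrow> real \<Rightarrow> (real \<Rightarrow> real) \<Rightarrow> bool" where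
  "scaled_differentiable \<theta> \<sigma> \<gamma> u \<longleftrightarrow>
     weakly_differentiable (\<lambda>t. t powr (- (\<gamma> * (\<theta> - \<sigma>) / 2)) * u t)"

definition space_A :: "real \<Rightarrow> real \<Rightarrow> real \<Rightarrow> real \<Rightarrow> nat \<Rightarrow> (real \<Rightarrow> real) set" where
  "space_A \<theta> \<sigma> \<gamma> \<beta> \<mu> = {v. v \<in> weighted_L2 (weight \<theta> \<sigma> \<gamma> \<beta>) \<and>
     (\<forall>r\<in>{1..\<mu>}.
        scaled_differentiable \<theta> \<sigma> \<gamma> ((scaled_deriv \<theta> \<sigma> \<gamma> \<beta> ^^ (r - 1)) v) \<and>
        (scaled_deriv \<theta> \<sigma> \<gamma> \<beta> ^^ r) v
          \<in> weighted_L2 (weight (\<theta> + real r) (\<sigma> + real r) \<gamma> \<beta>))}"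

definition laguerre :: "nat \<Rightarrow> real \<Rightarrow> real \<Rightarrow> real" where
  "laguerre m \<theta> y =
     (\<Sum>r\<le>m. (-1) ^ r / fact r * ((real m + \<theta>) gchoose (m - r)) * y ^ r)"

text \<open>For \<open>\<theta> > -1\<close> the polynomial \<open>laguerre (M + 1) \<theta>\<close> has exactly \<open>M + 1\<close> zeros, all simple
  and positive; they are enumerated in increasing order by the indices \<open>0, \<dots>, M\<close>.\<close>

definition laguerre_zero :: "real \<Rightarrow> nat \<Rightarrow> nat \<Rightarrow> real" where
  "laguerre_zero \<theta> M i = sorted_list_of_set {y. 0 < y \<and> laguerre (M + 1) \<theta> y = 0} ! i"

definition interp_node :: "real \<Rightarrow> real \<Rightarrow> real \<Rightarrow> nat \<Rightarrow> nat \<Rightarrow> real" where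
  "interp_node \<theta> \<gamma> \<beta> M i = (laguerre_zero \<theta> M i / (\<beta> + 1)) powr (1 / \<gamma>)"

definition interp ::
    "real \<Rightarrow> real \<Rightarrow> real \<Rightarrow> real \<Rightarrow> nat \<Rightarrow> (real \<Rightarrow> real) \<Rightarrow> real \<Rightarrow> real" where
  "interp \<theta> \<sigma> \<gamma> \<beta> M v x =
     (let \<eta> = \<gamma> * (\<theta> - \<sigma>) / 2; X = interp_node \<theta> \<gamma> \<beta> M in
      \<Sum>i\<le>M. v (X i) * (x powr \<eta> / X i powr \<eta>) *
        (\<Prod>r\<in>{..M} - {i}. (x powr \<gamma> - X r powr \<gamma>) / (X i powr \<gamma> - X r powr \<gamma>)))"

end

theory Submission
  imports Defs "HOL-Computational_Algebra.Polynomial"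
begin

text \<open>In the variable \<open>t = (\<beta> + 1) x\<^sup>\<gamma>\<close> and after division by \<open>x\<^sup>\<eta>\<close>, the scaled derivative is
  \<open>d/dt\<close>, the weights become \<open>w\<^sub>\<alpha> = t\<^sup>\<alpha> e\<^sup>-\<^sup>t\<close>, and the operator interpolates by polynomials of degree at
  most \<open>M\<close> at the zeros of \<open>L = L\<^sub>n\<close>, \<open>n = M + 1\<close>. No asymptotics of Gauss weights are needed.
  If \<open>G\<close> vanishes at the zeros of \<open>L\<close>, integrating
  \<open>w\<^sub>\<theta>\<^sub>+\<^sub>1 (G' - G L'/L)\<^sup>2 \<ge> 0\<close> gives \<open>n \<parallel>G\<parallel>\<^sup>2 \<le> \<parallel>G'\<parallel>\<^sup>2\<close>. Apply this to \<open>G = F - q\<close>, where \<open>F\<close> is the error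
  of the orthogonal projection and \<open>q\<close> interpolates \<open>F\<close>: the quadratic form splits by orthogonality,
  and \<open>\<parallel>q'\<parallel>\<^sup>2 \<le> (n - 1) \<parallel>q\<parallel>\<^sup>2\<close>, so that \<open>\<parallel>q\<parallel>\<^sup>2 + n \<parallel>F\<parallel>\<^sup>2 \<le> \<parallel>F'\<parallel>\<^sup>2\<close>. Hence the interpolation error is at
  most \<open>\<parallel>F'\<parallel>\<close>, and the same spectral gap applied to the derivatives of \<open>F\<close> bounds \<open>\<parallel>F'\<parallel>\<close> by the highest
  derivative. The logarithm only has to be bounded below for \<open>M \<ge> 2\<close>; for \<open>M = 1\<close>, where it
  vanishes, a Hardy inequality supplies the other norm.\<close>

subsection \<open>Integration by parts for absolutely continuous functions\<close>

text \<open>Nothing is known about \<open>v\<close> near 0 or at infinity, so boundary terms are the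
  main obstacle. Each derivative raises the weight exponent by one, and
  \<open>wt (\<alpha> + 1) t = t * wt \<alpha> t\<close>; dividing a boundary term
  \<open>B t\<close> by \<open>t\<close> therefore restores the lower weight and makes it
  integrable. Since dt/t has infinite mass at both ends, \<open>B\<close> is arbitrarily small along
  points tending to 0 and to infinity, which suffices. The spectral gap on the orthogonal complement
  is itself read off from the interpolation inequality, so completeness of the Laguerre polynomials
  never enters. Differentiating a function orthogonal to degrees below n leaves one orthogonal to
  degrees below n - 1 for the next weight, so the gaps multiply to a quotient of factorials; the gap
  n = M + 1 is spent on the interpolant, which leaves M! in the denominator. For M = 1 only the norm
  with exponent \<theta> + m - 1 is left, one unit of weight short of what the interpolation
  inequality uses; a bound without change of weight makes up for it, with a constant depending on
  \<theta> alone.\<close>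

text \<open>Fubini for \<open>f s * g t\<close>, split along the diagonal: the half s \<le> t is
  integrated first in s, the half t < s first in t. This is integration by parts for the two
  primitives, with no differentiability involved.\<close>

lemma integral_mult_triangle:
  fixes f g :: "real \<Rightarrow> real"
  assumes f: "integrable lborel f" and g: "integrable lborel g"
  shows "(\<integral>t. (\<integral>s. indicator {..t} s * f s \<partial>lborel) * g t \<partial>lborel)
       + (\<integral>s. f s * (\<integral>t. indicator {..<s} t * g t \<partial>lborel) \<partial>lborel)
       = (\<integral>s. f s \<partial>lborel) * (\<integral>t. g t \<partial>lborel)"
proof -
  have [measurable]: "f \<in> borel_measurable borel" "g \<in> borel_measurable borel"
    using f g by auto
  let ?P = "lborel \<Otimes>\<^sub>M (lborel :: real measure)"
  have k: "integrable ?P (\<lambda>(s,t). f s * g t)"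
    using f g by (intro lborel_pair.Fubini_integrable) (auto simp: abs_mult)
  have k1: "integrable ?P (\<lambda>(s,t). indicator {..t} s * f s * g t)"
    by (rule Bochner_Integration.integrable_bound[OF k]) (auto simp: indicator_def split: prod.splits)
  have k2: "integrable ?P (\<lambda>(s,t). indicator {..<s} t * f s * g t)"
    by (rule Bochner_Integration.integrable_bound[OF k]) (auto simp: indicator_def split: prod.splits)
  have "(\<integral>t. (\<integral>s. indicator {..t} s * f s \<partial>lborel) * g t \<partial>lborel)
      = (\<integral>t. (\<integral>s. indicator {..t} s * f s * g t \<partial>lborel) \<partial>lborel)"
    by simp
  also have "\<dots> = (\<integral>p. (case p of (s,t) \<Rightarrow> indicator {..t} s * f s * g t) \<partial>?P)"
    by (rule lborel_pair.integral_snd[OF k1])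
  finally have e1: "(\<integral>t. (\<integral>s. indicator {..t} s * f s \<partial>lborel) * g t \<partial>lborel) = \<dots>" .
  have "(\<integral>s. f s * (\<integral>t. indicator {..<s} t * g t \<partial>lborel) \<partial>lborel)
      = (\<integral>s. (\<integral>t. indicator {..<s} t * f s * g t \<partial>lborel) \<partial>lborel)"
    by (simp add: mult.commute mult.left_commute mult.assoc flip: integral_mult_right_zero)
  also have "\<dots> = (\<integral>p. (case p of (s,t) \<Rightarrow> indicator {..<s} t * f s * g t) \<partial>?P)"
    by (rule lborel_pair.integral_fst[OF k2])
  finally have e2: "(\<integral>s. f s * (\<integral>t. indicator {..<s} t * g t \<partial>lborel) \<partial>lborel) = \<dots>" .
  have "(\<integral>s. f s \<partial>lborel) * (\<integral>t. g t \<partial>lborel) = (\<integral>s. (\<integral>t. f s * g t \<partial>lborel) \<partial>lborel)"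
    by simp
  also have "\<dots> = (\<integral>p. (case p of (s,t) \<Rightarrow> f s * g t) \<partial>?P)"
    by (rule lborel_pair.integral_fst[OF k])
  also have "\<dots> = (\<integral>p. (case p of (s,t) \<Rightarrow> indicator {..t} s * f s * g t)
        + (case p of (s,t) \<Rightarrow> indicator {..<s} t * f s * g t) \<partial>?P)"
    by (rule Bochner_Integration.integral_cong) (auto simp: indicator_def)
  also have "\<dots> = (\<integral>p. (case p of (s,t) \<Rightarrow> indicator {..t} s * f s * g t) \<partial>?P)
     + (\<integral>p. (case p of (s,t) \<Rightarrow> indicator {..<s} t * f s * g t) \<partial>?P)"
    by (rule Bochner_Integration.integral_add[OF k1 k2])
  finally show ?thesis using e1 e2 by simp
qed

text \<open>Fubini over \<open>lborel\<close> asks for Borel functions, while an absolutely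
  integrable function is only Lebesgue measurable. The two differ on a negligible set, which gauge
  integrals ignore.\<close>

lemma absolutely_integrable_borel_representative:
  fixes f :: "real \<Rightarrow> real"
  assumes f: "f absolutely_integrable_on {a..b}"
  obtains f' N where "integrable lborel f'" "negligible N"
    "\<And>x. x \<notin> N \<Longrightarrow> f' x = indicator {a..b} x * f x"
proof -
  let ?f = "\<lambda>x. indicator {a..b} x * f x"
  have int: "integrable lebesgue ?f"
    using f by (simp add: set_integrable_def)
  then have "?f \<in> borel_measurable (completion lborel)" by auto
  from completion_ex_borel_measurable_real[OF this]
  obtain f' where f': "f' \<in> borel_measurable lborel" "AE x in lborel. ?f x = f' x" by auto
  have ae: "AE x in lebesgue. ?f x = f' x"
    using f'(2) by (rule AE_completion)
  have "integrable lebesgue f'"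
    by (rule Bochner_Integration.integrable_cong_AE_imp[OF int]) (use f'(1) ae in \<open>auto intro: measurable_completion\<close>)
  then have i': "integrable lborel f'"
    using f'(1) integrable_completion by blast
  obtain N where N: "N \<in> null_sets lebesgue" "{x \<in> space lebesgue. \<not> ?f x = f' x} \<subseteq> N"
    using ae unfolding eventually_ae_filter by blast
  show ?thesis
  proof (rule that[OF i'])
    show "negligible N" using N(1) by (simp add: negligible_iff_null_sets)
    show "f' x = indicator {a..b} x * f x" if "x \<notin> N" for x
    proof (rule ccontr)
      assume "f' x \<noteq> indicator {a..b} x * f x"
      then have "x \<in> {x \<in> space lebesgue. \<not> ?f x = f' x}" by simp
      with N(2) that show False by blast
    qed
  qed
qed

lemma integral_by_parts_absolutely_integrable:
  fixes f g :: "real \<Rightarrow> real"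
  assumes f: "f absolutely_integrable_on {a..b}" and g: "g absolutely_integrable_on {a..b}"
  shows "integral {a..b} (\<lambda>t. integral {a..t} f * g t) + integral {a..b} (\<lambda>s. f s * integral {a..s} g)
     = integral {a..b} f * integral {a..b} g"
proof -
  obtain f' Nf where f': "integrable lborel f'" "negligible Nf"
    "\<And>x. x \<notin> Nf \<Longrightarrow> f' x = indicator {a..b} x * f x"
    by (rule absolutely_integrable_borel_representative[OF f]) blast
  obtain g' Ng where g': "integrable lborel g'" "negligible Ng"
    "\<And>x. x \<notin> Ng \<Longrightarrow> g' x = indicator {a..b} x * g x"
    by (rule absolutely_integrable_borel_representative[OF g]) blast
  have I: "(\<integral>s. indicator S s * h' s \<partial>lborel) = integral (S \<inter> {a..b}) h"
    if h': "integrable lborel h'" "negligible N" "\<And>x. x \<notin> N \<Longrightarrow> h' x = indicator {a..b} x * h x"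
      and S: "S \<in> sets borel" for S N and h h' :: "real \<Rightarrow> real"
  proof -
    have "integrable lborel (\<lambda>s. indicator S s * h' s)"
      by (rule Bochner_Integration.integrable_bound[OF h'(1)])
        (use S h'(1) in \<open>auto simp: indicator_def borel_measurable_integrable\<close>)
    then have "(\<integral>s. indicator S s * h' s \<partial>lborel) = integral UNIV (\<lambda>s. indicator S s * h' s)"
      by (simp add: integral_lborel)
    also have "\<dots> = integral UNIV (\<lambda>s. if s \<in> S \<inter> {a..b} then h s else 0)"
      by (rule integral_spike[OF h'(2)]) (auto simp: h'(3) indicator_def)
    also have "\<dots> = integral (S \<inter> {a..b}) h" by (simp only: integral_restrict_UNIV)
    finally show ?thesis .
  qed
  have J1: "(\<integral>s. indicator {..t} s * f' s \<partial>lborel) = integral {a..t} f" if "t \<le> b" for t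
  proof -
    have "(\<integral>s. indicator {..t} s * f' s \<partial>lborel) = integral ({..t} \<inter> {a..b}) f"
      using I[OF f', where S="{..t}"] by (metis borel_closed closed_atMost)
    also have "{..t} \<inter> {a..b} = {a..t}" using that by auto
    finally show ?thesis .
  qed
  have J2: "(\<integral>s. indicator {..<t} s * g' s \<partial>lborel) = integral {a..t} g" if "t \<le> b" for t
  proof -
    have "(\<integral>s. indicator {..<t} s * g' s \<partial>lborel) = integral ({..<t} \<inter> {a..b}) g"
      using I[OF g', where S="{..<t}"] by (metis borel_open open_lessThan)
    also have "\<dots> = integral {a..t} g"
    proof (rule integral_subset_negligible)
      show "negligible ({a..t} - {..<t} \<inter> {a..b})"
        by (rule negligible_subset[of "{t}"]) (use that in auto)
    qed (use that in auto)
    finally show ?thesis .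
  qed
  have i1: "integral UNIV (\<lambda>t. (\<integral>s. indicator {..t} s * f' s \<partial>lborel) * g' t) = integral {a..b} (\<lambda>t. integral {a..t} f * g t)"
  proof -
    have "integral UNIV (\<lambda>t. (\<integral>s. indicator {..t} s * f' s \<partial>lborel) * g' t)
       = integral UNIV (\<lambda>t. if t \<in> {a..b} then integral {a..t} f * g t else 0)"
      by (rule integral_spike[OF g'(2)]) (auto simp: g'(3) J1)
    then show ?thesis by (simp only: integral_restrict_UNIV)
  qed
  have i2: "integral UNIV (\<lambda>s. f' s * (\<integral>t. indicator {..<s} t * g' t \<partial>lborel)) = integral {a..b} (\<lambda>s. f s * integral {a..s} g)"
  proof -
    have "integral UNIV (\<lambda>s. f' s * (\<integral>t. indicator {..<s} t * g' t \<partial>lborel))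
       = integral UNIV (\<lambda>t. if t \<in> {a..b} then f t * integral {a..t} g else 0)"
      by (rule integral_spike[OF f'(2)]) (auto simp: f'(3) J2)
    then show ?thesis by (simp only: integral_restrict_UNIV)
  qed
  have [measurable]: "f' \<in> borel_measurable borel" "g' \<in> borel_measurable borel"
    using f' g' by auto
  \<comment> \<open>Passing to the gauge integral needs integrability: the inner integral is at most
    the full integral of \<open>\<bar>f' s\<bar>\<close>, so the product is dominated by a multiple
    of \<open>g'\<close>.\<close>
  have b1: "integrable lborel (\<lambda>t. (\<integral>s. indicator {..t} s * f' s \<partial>lborel) * g' t)"
  proof (rule Bochner_Integration.integrable_bound)
    show "integrable lborel (\<lambda>t. (\<integral>s. \<bar>f' s\<bar> \<partial>lborel) * g' t)" using g' by simp
    show "AE t in lborel. norm ((\<integral>s. indicator {..t} s * f' s \<partial>lborel) * g' t) \<le> norm ((\<integral>s. \<bar>f' s\<bar> \<partial>lborel) * g' t)"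
    proof (rule AE_I2)
      fix t
      have "\<bar>\<integral>s. indicator {..t} s * f' s \<partial>lborel\<bar> \<le> (\<integral>s. \<bar>f' s\<bar> \<partial>lborel)"
        by (rule order_trans[OF integral_abs_bound], rule integral_mono')
          (use f' in \<open>auto simp: indicator_def\<close>)
      then show "norm ((\<integral>s. indicator {..t} s * f' s \<partial>lborel) * g' t) \<le> norm ((\<integral>s. \<bar>f' s\<bar> \<partial>lborel) * g' t)"
        by (simp add: abs_mult mult_right_mono)
    qed
    have "(\<lambda>p. indicator {..fst p} (snd p) * f' (snd p)) \<in> borel_measurable (lborel \<Otimes>\<^sub>M (lborel::real measure))"
      by (simp add: indicator_def)
    then show "(\<lambda>t. (\<integral>s. indicator {..t} s * f' s \<partial>lborel) * g' t) \<in> borel_measurable lborel"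
      by (auto intro!: borel_measurable_times lborel.borel_measurable_lebesgue_integral simp: split_beta')
  qed
  have b2: "integrable lborel (\<lambda>s. f' s * (\<integral>t. indicator {..<s} t * g' t \<partial>lborel))"
  proof (rule Bochner_Integration.integrable_bound)
    show "integrable lborel (\<lambda>t. f' t * (\<integral>s. \<bar>g' s\<bar> \<partial>lborel))" using f' by simp
    show "AE t in lborel. norm (f' t * (\<integral>s. indicator {..<t} s * g' s \<partial>lborel)) \<le> norm (f' t * (\<integral>s. \<bar>g' s\<bar> \<partial>lborel))"
    proof (rule AE_I2)
      fix t
      have "\<bar>\<integral>s. indicator {..<t} s * g' s \<partial>lborel\<bar> \<le> (\<integral>s. \<bar>g' s\<bar> \<partial>lborel)"
        by (rule order_trans[OF integral_abs_bound], rule integral_mono')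
          (use g' in \<open>auto simp: indicator_def\<close>)
      then show "norm (f' t * (\<integral>s. indicator {..<t} s * g' s \<partial>lborel)) \<le> norm (f' t * (\<integral>s. \<bar>g' s\<bar> \<partial>lborel))"
        by (simp add: abs_mult mult_left_mono)
    qed
    have "(\<lambda>p. indicator {..<fst p} (snd p) * g' (snd p)) \<in> borel_measurable (lborel \<Otimes>\<^sub>M (lborel::real measure))"
      by (simp add: indicator_def)
    then show "(\<lambda>s. f' s * (\<integral>t. indicator {..<s} t * g' t \<partial>lborel)) \<in> borel_measurable lborel"
      by (auto intro!: borel_measurable_times lborel.borel_measurable_lebesgue_integral simp: split_beta')
  qed
  have U: "(\<integral>s. h' s \<partial>lborel) = integral {a..b} h"
    if h': "integrable lborel h'" "negligible N" "\<And>x. x \<notin> N \<Longrightarrow> h' x = indicator {a..b} x * h x"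
      for N and h h' :: "real \<Rightarrow> real"
    using I[OF h', of UNIV] by simp
  have "integral\<^sup>L lborel f' = integral {a..b} f" "integral\<^sup>L lborel g' = integral {a..b} g"
    using U[OF f'] U[OF g'] by auto
  then show ?thesis
    using integral_mult_triangle[OF f'(1) g'(1)] i1 i2 integral_lborel[OF b1] integral_lborel[OF b2] by metis
qed

section \<open>Calculus of locally absolutely continuous functions\<close>

text \<open>Local absolute continuity on the open half line, encoded by the fundamental theorem of
  calculus. The density \<open>f\<close> may be changed on negligible sets and nothing is asked at
  0, which is what a weak derivative can supply.\<close>

definition ac_deriv :: "(real \<Rightarrow> real) \<Rightarrow> (real \<Rightarrow> real) \<Rightarrow> bool" where
  "ac_deriv F f \<longleftrightarrow> (\<forall>a b. 0 < a \<longrightarrow> a \<le> b \<longrightarrow>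
     f absolutely_integrable_on {a..b} \<and> F b - F a = integral {a..b} f)"

lemma ac_derivD:
  assumes "ac_deriv F f" "0 < a" "a \<le> b"
  shows "f absolutely_integrable_on {a..b}" "F b - F a = integral {a..b} f" "f integrable_on {a..b}"
  using assms unfolding ac_deriv_def absolutely_integrable_on_def by auto

lemma ac_deriv_add: "ac_deriv F f \<Longrightarrow> ac_deriv G g \<Longrightarrow> ac_deriv (\<lambda>t. F t + G t) (\<lambda>t. f t + g t)"
  unfolding ac_deriv_def
proof (intro allI impI conjI)
  fix a b :: real
  assume F: "\<forall>a b. 0 < a \<longrightarrow> a \<le> b \<longrightarrow> f absolutely_integrable_on {a..b} \<and> F b - F a = integral {a..b} f"
    and G: "\<forall>a b. 0 < a \<longrightarrow> a \<le> b \<longrightarrow> g absolutely_integrable_on {a..b} \<and> G b - G a = integral {a..b} g"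
    and ab: "0 < a" "a \<le> b"
  have f: "f absolutely_integrable_on {a..b}" "F b - F a = integral {a..b} f"
    and g: "g absolutely_integrable_on {a..b}" "G b - G a = integral {a..b} g"
    using F G ab by blast+
  show "(\<lambda>t. f t + g t) absolutely_integrable_on {a..b}"
    by (rule set_integral_add(1)[OF f(1) g(1)])
  have "integral {a..b} (\<lambda>t. f t + g t) = integral {a..b} f + integral {a..b} g"
    using f(1) g(1) by (intro Henstock_Kurzweil_Integration.integral_add) (auto simp: absolutely_integrable_on_def)
  with f g show "F b + G b - (F a + G a) = integral {a..b} (\<lambda>t. f t + g t)" by simp
qed

lemma ac_deriv_cmult: "ac_deriv F f \<Longrightarrow> ac_deriv (\<lambda>t. c * F t) (\<lambda>t. c * f t)"
  unfolding ac_deriv_def by (auto simp flip: right_diff_distrib)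

lemma ac_deriv_diff: "ac_deriv F f \<Longrightarrow> ac_deriv G g \<Longrightarrow> ac_deriv (\<lambda>t. F t - G t) (\<lambda>t. f t - g t)"
  using ac_deriv_add[OF _ ac_deriv_cmult[of G g "-1"]] by simp

lemma ac_deriv_of_has_derivative:
  assumes d: "\<And>t. 0 < t \<Longrightarrow> (F has_real_derivative f t) (at t)" and c: "continuous_on halfline f"
  shows "ac_deriv F f"
  unfolding ac_deriv_def
proof (intro allI impI conjI)
  fix a b :: real assume ab: "0 < a" "a \<le> b"
  show "f absolutely_integrable_on {a..b}"
    by (rule absolutely_integrable_continuous_real, rule continuous_on_subset[OF c]) (use ab in auto)
  have "(f has_integral F b - F a) {a..b}"
    by (rule fundamental_theorem_of_calculus)
      (use ab d in \<open>auto simp: has_real_derivative_iff_has_vector_derivative[symmetric] intro: has_field_derivative_at_within\<close>)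
  then show "F b - F a = integral {a..b} f" by (simp add: integral_unique)
qed

lemma ac_deriv_spike:
  assumes "ac_deriv F f" "negligible N" "\<And>x. 0 < x \<Longrightarrow> x \<notin> N \<Longrightarrow> g x = f x"
  shows "ac_deriv F g"
  unfolding ac_deriv_def
proof (intro allI impI conjI)
  fix a b :: real assume ab: "0 < a" "a \<le> b"
  note f = ac_derivD[OF assms(1) ab]
  show "g absolutely_integrable_on {a..b}"
    by (rule absolutely_integrable_spike[OF f(1) assms(2)]) (use assms(3) ab in auto)
  have "integral {a..b} f = integral {a..b} g"
    by (rule integral_spike[OF assms(2)]) (use assms(3) ab in auto)
  with f(2) show "F b - F a = integral {a..b} g" by simp
qed

lemma ac_deriv_continuous_on_Icc:
  assumes "ac_deriv F f" "0 < a"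
  shows "continuous_on {a..b} F"
proof (cases "a \<le> b")
  case True
  have "continuous_on {a..b} (\<lambda>t. F a + integral {a..t} f)"
    by (intro continuous_intros indefinite_integral_continuous_1 ac_derivD(3)[OF assms True])
  then show ?thesis
  proof (rule continuous_on_eq)
    show "F a + integral {a..t} f = F t" if "t \<in> {a..b}" for t
      using ac_derivD(2)[OF assms, of t] that by simp
  qed
qed auto

lemma ac_deriv_continuous:
  assumes "ac_deriv F f"
  shows "continuous_on halfline F"
  unfolding continuous_on_eq_continuous_at[OF open_greaterThan]
proof
  fix x :: real assume "x \<in> halfline"
  then have "continuous_on {x/2..2*x} F" "x \<in> interior {x/2..2*x}"
    using ac_deriv_continuous_on_Icc[OF assms, of "x/2" "2*x"] by auto
  then show "isCont F x" by (rule continuous_on_interior)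
qed

lemma ex_ac_deriv:
  fixes f :: "real \<Rightarrow> real"
  assumes f: "\<And>a b. 0 < a \<Longrightarrow> a \<le> b \<Longrightarrow> f absolutely_integrable_on {a..b}"
  obtains F where "ac_deriv F f"
proof
  show "ac_deriv (\<lambda>t. if 1 \<le> t then integral {1..t} f else - integral {t..1} f) f"
    unfolding ac_deriv_def
  proof (intro allI impI conjI)
    fix a b :: real assume ab: "0 < a" "a \<le> b"
    show "f absolutely_integrable_on {a..b}" by (rule f[OF ab])
    have c: "integral {p..q} f + integral {q..r} f = integral {p..r} f" if "0 < p" "p \<le> q" "q \<le> r" for p q r
      by (rule Henstock_Kurzweil_Integration.integral_combine)
        (use that f[of p r] in \<open>auto simp: absolutely_integrable_on_def\<close>)
    show "(if 1 \<le> b then integral {1..b} f else - integral {b..1} f)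
       - (if 1 \<le> a then integral {1..a} f else - integral {a..1} f) = integral {a..b} f"
      using c[of 1 a b] c[of a 1 b] c[of a b 1] ab by (cases "1 \<le> b"; cases "1 \<le> a") auto
  qed
qed

lemma borel_measurable_halflineI:
  fixes f :: "real \<Rightarrow> real"
  assumes "\<And>a b. 0 < a \<Longrightarrow> a \<le> b \<Longrightarrow> f absolutely_integrable_on {a..b}"
  shows "f \<in> borel_measurable (lebesgue_on halfline)"
proof -
  let ?h = "\<lambda>n x. if x \<in> {1 / Suc n..Suc n} then f x else 0"
  have "(\<lambda>x. if x \<in> halfline then f x else 0) \<in> borel_measurable lebesgue"
  proof (rule borel_measurable_LIMSEQ_real)
    show "(\<lambda>n. ?h n x) \<longlonglongrightarrow> (if x \<in> halfline then f x else 0)" for x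
    proof (cases "0 < x")
      case True
      have "eventually (\<lambda>n. 1 / Suc n \<le> x) sequentially"
      proof -
        have "(\<lambda>n. 1 / Suc n) \<longlonglongrightarrow> (0::real)"
          using LIMSEQ_inverse_real_of_nat by (simp add: inverse_eq_divide)
        from order_tendstoD(2)[OF this True] show ?thesis by eventually_elim auto
      qed
      moreover have "eventually (\<lambda>n. x \<le> Suc n) sequentially"
        by (rule eventually_sequentiallyI[of "nat \<lceil>x\<rceil>"]) linarith
      ultimately have "eventually (\<lambda>n. ?h n x = f x) sequentially"
        by eventually_elim auto
      then show ?thesis using True by (simp add: tendsto_eventually)
    next
      case False
      have "?h n x = 0" for n
      proof -
        have "0 < 1 / real (Suc n)" by simp
        then have "x \<notin> {1 / Suc n..Suc n}" using False unfolding atLeastAtMost_iff by linarith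
        then show ?thesis by (rule if_not_P)
      qed
      then show ?thesis using False by simp
    qed
    show "?h n \<in> borel_measurable lebesgue" for n
    proof -
      have "f absolutely_integrable_on {1 / Suc n..Suc n}"
      proof (rule assms)
        have "1 / real (Suc n) \<le> 1" by simp
        also have "1 \<le> real (Suc n)" by simp
        finally show "1 / real (Suc n) \<le> real (Suc n)" .
      qed simp
      then have "f \<in> borel_measurable (lebesgue_on {1 / Suc n..Suc n})"
        by (rule absolutely_integrable_imp_borel_measurable) auto
      then show ?thesis by (subst borel_measurable_if) auto
    qed
  qed
  then show ?thesis by (subst (asm) borel_measurable_if) auto
qed

lemma ac_deriv_measurable: "ac_deriv F f \<Longrightarrow> f \<in> borel_measurable (lebesgue_on halfline)"
  by (rule borel_measurable_halflineI) (rule ac_derivD(1))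

lemma ac_deriv_measurable_fun: "ac_deriv F f \<Longrightarrow> F \<in> borel_measurable (lebesgue_on halfline)"
  by (rule continuous_imp_measurable_on_sets_lebesgue[OF ac_deriv_continuous]) auto

lemma absolutely_integrable_mult_continuous:
  fixes f G :: "real \<Rightarrow> real"
  assumes "f absolutely_integrable_on {a..b}" "continuous_on {a..b} G"
  shows "(\<lambda>t. f t * G t) absolutely_integrable_on {a..b}" "(\<lambda>t. G t * f t) absolutely_integrable_on {a..b}"
proof -
  show *: "(\<lambda>t. G t * f t) absolutely_integrable_on {a..b}"
  proof (rule absolutely_integrable_bounded_measurable_product_real)
    show "G \<in> borel_measurable (lebesgue_on {a..b})"
      by (rule continuous_imp_measurable_on_sets_lebesgue[OF assms(2)]) simp
    show "bounded (G ` {a..b})"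
      by (rule compact_imp_bounded, rule compact_continuous_image[OF assms(2)]) simp
  qed (use assms in simp_all)
  then show "(\<lambda>t. f t * G t) absolutely_integrable_on {a..b}" by (simp add: mult.commute)
qed

text \<open>With F and G replaced by their values at \<open>a\<close> plus primitives, the two
  iterated integrals that appear are those of
  \<open>integral_by_parts_absolutely_integrable\<close>. The hypotheses concern one interval only,
  because the rule is later applied to a factor with poles at the zeros of a Laguerre polynomial,
  between two such poles.\<close>

lemma product_rule_absolutely_integrable:
  fixes f g F G :: "real \<Rightarrow> real"
  assumes f: "f absolutely_integrable_on {a..b}" and g: "g absolutely_integrable_on {a..b}"
    and F: "\<And>t. t \<in> {a..b} \<Longrightarrow> F t - F a = integral {a..t} f"
    and G: "\<And>t. t \<in> {a..b} \<Longrightarrow> G t - G a = integral {a..t} g" and ab: "a \<le> b"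
  shows "(\<lambda>t. f t * G t + F t * g t) absolutely_integrable_on {a..b}"
    "F b * G b - F a * G a = integral {a..b} (\<lambda>t. f t * G t + F t * g t)"
proof -
  have fi: "f integrable_on {a..b}" and gi: "g integrable_on {a..b}"
    using f g by (auto simp: absolutely_integrable_on_def)
  have c1: "continuous_on {a..b} (\<lambda>t. integral {a..t} f)" "continuous_on {a..b} (\<lambda>t. integral {a..t} g)"
    by (intro indefinite_integral_continuous_1 fi gi)+
  have Ft: "F t = F a + integral {a..t} f" "G t = G a + integral {a..t} g" if "t \<in> {a..b}" for t
    using F[OF that] G[OF that] by auto
  have cF: "continuous_on {a..b} F"
    by (rule continuous_on_eq[OF continuous_on_add[OF continuous_on_const c1(1)]]) (rule Ft(1)[symmetric])
  have cG: "continuous_on {a..b} G"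
    by (rule continuous_on_eq[OF continuous_on_add[OF continuous_on_const c1(2)]]) (rule Ft(2)[symmetric])
  have fG: "(\<lambda>t. f t * G t) absolutely_integrable_on {a..b}" and Fg: "(\<lambda>t. F t * g t) absolutely_integrable_on {a..b}"
    using absolutely_integrable_mult_continuous f g cF cG by blast+
  have I: "(\<lambda>t. f t * integral {a..t} g) integrable_on {a..b}" "(\<lambda>t. integral {a..t} f * g t) integrable_on {a..b}"
    using absolutely_integrable_mult_continuous[OF f c1(2)] absolutely_integrable_mult_continuous[OF g c1(1)]
    by (auto simp: absolutely_integrable_on_def)
  have 1: "integral {a..b} (\<lambda>t. f t * G t) = G a * integral {a..b} f + integral {a..b} (\<lambda>t. f t * integral {a..t} g)"
  proof -
    have "integral {a..b} (\<lambda>t. f t * G t) = integral {a..b} (\<lambda>t. G a * f t + f t * integral {a..t} g)"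
      by (rule integral_cong, subst Ft(2)) (simp_all add: algebra_simps)
    also have "\<dots> = integral {a..b} (\<lambda>t. G a * f t) + integral {a..b} (\<lambda>t. f t * integral {a..t} g)"
      by (intro Henstock_Kurzweil_Integration.integral_add integrable_on_mult_right I(1) fi)
    finally show ?thesis by simp
  qed
  have 2: "integral {a..b} (\<lambda>t. F t * g t) = F a * integral {a..b} g + integral {a..b} (\<lambda>t. integral {a..t} f * g t)"
  proof -
    have "integral {a..b} (\<lambda>t. F t * g t) = integral {a..b} (\<lambda>t. F a * g t + integral {a..t} f * g t)"
      by (rule integral_cong, subst Ft(1)) (simp_all add: algebra_simps)
    also have "\<dots> = integral {a..b} (\<lambda>t. F a * g t) + integral {a..b} (\<lambda>t. integral {a..t} f * g t)"
      by (intro Henstock_Kurzweil_Integration.integral_add integrable_on_mult_right I(2) gi)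
    finally show ?thesis by simp
  qed
  have Fb: "F b - F a = integral {a..b} f" "G b - G a = integral {a..b} g"
    using F[of b] G[of b] ab by auto
  have "integral {a..b} (\<lambda>t. f t * G t + F t * g t) = integral {a..b} (\<lambda>t. f t * G t) + integral {a..b} (\<lambda>t. F t * g t)"
    using fG Fg by (intro Henstock_Kurzweil_Integration.integral_add) (auto simp: absolutely_integrable_on_def)
  also have "\<dots> = G a * integral {a..b} f + F a * integral {a..b} g + integral {a..b} f * integral {a..b} g"
    using 1 2 integral_by_parts_absolutely_integrable[OF f g] by simp
  also have "\<dots> = F b * G b - F a * G a"
    unfolding Fb[symmetric] by (simp add: algebra_simps)
  finally show "F b * G b - F a * G a = integral {a..b} (\<lambda>t. f t * G t + F t * g t)" by simp
  show "(\<lambda>t. f t * G t + F t * g t) absolutely_integrable_on {a..b}"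
    by (rule set_integral_add(1)[OF fG Fg])
qed

lemma ac_deriv_mult:
  assumes F: "ac_deriv F f" and G: "ac_deriv G g"
  shows "ac_deriv (\<lambda>t. F t * G t) (\<lambda>t. f t * G t + F t * g t)"
  unfolding ac_deriv_def
proof (intro allI impI)
  fix a b :: real assume ab: "0 < a" "a \<le> b"
  have "F t - F a = integral {a..t} f" "G t - G a = integral {a..t} g" if "t \<in> {a..b}" for t
    using ac_derivD(2)[OF F ab(1), of t] ac_derivD(2)[OF G ab(1), of t] that by auto
  from product_rule_absolutely_integrable[OF ac_derivD(1)[OF F ab] ac_derivD(1)[OF G ab] this ab(2)]
  show "(\<lambda>t. f t * G t + F t * g t) absolutely_integrable_on {a..b} \<and>
     F b * G b - F a * G a = integral {a..b} (\<lambda>t. f t * G t + F t * g t)" by blast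
qed

section \<open>Boundary terms at 0 and at infinity\<close>

text \<open>Otherwise \<bar>B t / t\<bar> is at least e / t on an interval of logarithmic length (K
  + 1) / e, which contributes K + 1 to an integral bounded by K.\<close>

lemma ex_small_value:
  fixes B :: "real \<Rightarrow> real"
  assumes B: "(\<lambda>t. B t / t) absolutely_integrable_on halfline" and a: "0 < a" and e: "0 < e"
    and K: "integral halfline (\<lambda>t. \<bar>B t / t\<bar>) \<le> K"
  shows "\<exists>t\<in>{a..a * exp ((K + 1) / e)}. \<bar>B t\<bar> < e"
proof (rule ccontr)
  assume "\<not> ?thesis"
  then have ge: "\<And>t. t \<in> {a..a * exp ((K + 1) / e)} \<Longrightarrow> e \<le> \<bar>B t\<bar>" by force
  let ?b = "a * exp ((K + 1) / e)"
  have int: "(\<lambda>t. \<bar>B t / t\<bar>) integrable_on halfline" using B by (auto simp: absolutely_integrable_on_def)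
  have "0 \<le> integral halfline (\<lambda>t. \<bar>B t / t\<bar>)" by (rule integral_nonneg[OF int]) auto
  then have K0: "0 \<le> K" using K by simp
  have ab: "a \<le> ?b" using a e K0 by simp
  have "((\<lambda>t. e / t) has_integral e * ln ?b - e * ln a) {a..?b}"
    by (rule fundamental_theorem_of_calculus[OF ab])
      (use a in \<open>auto intro!: derivative_eq_intros simp: has_real_derivative_iff_has_vector_derivative[symmetric]\<close>)
  moreover have "e * ln ?b - e * ln a = K + 1" using a e by (simp add: ln_mult) (simp add: field_simps)
  ultimately have h: "((\<lambda>t. e / t) has_integral K + 1) {a..?b}" by simp
  have sub: "(\<lambda>t. \<bar>B t / t\<bar>) integrable_on {a..?b}"
    by (rule integrable_on_subinterval[OF int]) (use a in auto)
  have "K + 1 = integral {a..?b} (\<lambda>t. e / t)" using h by (simp add: integral_unique)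
  also have "\<dots> \<le> integral {a..?b} (\<lambda>t. \<bar>B t / t\<bar>)"
    by (rule integral_le) (use h sub a ge in \<open>auto simp: divide_right_mono abs_div\<close>)
  also have "\<dots> \<le> integral halfline (\<lambda>t. \<bar>B t / t\<bar>)"
    by (rule integral_subset_le) (use a sub int in auto)
  finally show False using K by simp
qed

lemma vanishing_sequences:
  fixes B :: "real \<Rightarrow> real"
  assumes B: "(\<lambda>t. B t / t) absolutely_integrable_on halfline"
  obtains p q :: "nat \<Rightarrow> real"
  where "\<And>n. 0 < p n" "\<And>n. p n \<le> 1 / Suc n" "\<And>n. Suc n \<le> q n"
    "(\<lambda>n. B (p n)) \<longlonglongrightarrow> 0" "(\<lambda>n. B (q n)) \<longlonglongrightarrow> 0"
proof -
  define K where "K = integral halfline (\<lambda>t. \<bar>B t / t\<bar>)"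
  have "\<exists>t. 0 < t \<and> t \<le> 1 / Suc n \<and> \<bar>B t\<bar> < 1 / Suc n" for n
  proof -
    \<comment> \<open>\<open>R\<close> is the ratio of the endpoints of the interval in
      \<open>ex_small_value\<close>; starting at 1 / (n + 1) / R makes that interval end at 1 / (n +
      1).\<close>
    define R where "R = exp ((K + 1) / (1 / real (Suc n)))"
    have R: "0 < R" by (simp add: R_def)
    obtain t where t: "t \<in> {1 / Suc n / R..1 / Suc n / R * R}" "\<bar>B t\<bar> < 1 / Suc n"
      using ex_small_value[OF B, of "1 / Suc n / R" "1 / Suc n" K] R unfolding R_def K_def by auto
    have "0 < 1 / real (Suc n) / R" using R by simp
    moreover have "1 / real (Suc n) / R * R = 1 / real (Suc n)" using R by simp
    ultimately have "0 < t" "t \<le> 1 / real (Suc n)"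
      using t(1) unfolding atLeastAtMost_iff by linarith+
    then show ?thesis using t(2) by blast
  qed
  then obtain p where p: "\<And>n. 0 < p n \<and> p n \<le> 1 / Suc n \<and> \<bar>B (p n)\<bar> < 1 / Suc n" by metis
  have "\<exists>t. real (Suc n) \<le> t \<and> \<bar>B t\<bar> < 1 / Suc n" for n
  proof -
    have "\<exists>t\<in>{real (Suc n)..real (Suc n) * exp ((K + 1) / (1 / real (Suc n)))}. \<bar>B t\<bar> < 1 / Suc n"
      by (rule ex_small_value[OF B]) (simp_all add: K_def)
    then show ?thesis by auto
  qed
  then obtain q where q: "\<And>n. real (Suc n) \<le> q n \<and> \<bar>B (q n)\<bar> < 1 / Suc n" by metis
  have l: "(\<lambda>n. 1 / Suc n) \<longlonglongrightarrow> (0::real)"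
    using LIMSEQ_inverse_real_of_nat by (simp add: inverse_eq_divide)
  show ?thesis
  proof (rule that[of p q])
    show "(\<lambda>n. B (p n)) \<longlonglongrightarrow> 0"
      by (rule Lim_null_comparison[OF always_eventually l]) (use p in \<open>simp add: less_imp_le\<close>)
    show "(\<lambda>n. B (q n)) \<longlonglongrightarrow> 0"
      by (rule Lim_null_comparison[OF always_eventually l]) (use q in \<open>simp add: less_imp_le\<close>)
  qed (use p q in auto)
qed

lemma integral_exhaust_halfline:
  fixes b :: "real \<Rightarrow> real" and p q :: "nat \<Rightarrow> real"
  assumes b: "b absolutely_integrable_on halfline"
    and p: "\<And>n. 0 < p n" "\<And>n. p n \<le> 1 / Suc n" and q: "\<And>n. Suc n \<le> q n"
  shows "(\<lambda>n. integral {p n..q n} b) \<longlonglongrightarrow> integral halfline b"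
proof -
  let ?h = "\<lambda>n x. if x \<in> {p n..q n} then b x else 0"
  have int: "?h n integrable_on halfline" for n
  proof -
    have "b integrable_on {p n..q n}"
    proof (rule integrable_on_subinterval)
      show "b integrable_on halfline" using b by (simp add: absolutely_integrable_on_def)
      show "{p n..q n} \<subseteq> halfline" using p(1)[of n] by auto
    qed
    moreover have "halfline \<inter> {p n..q n} = {p n..q n}" using p(1)[of n] by auto
    ultimately show ?thesis by (subst integrable_restrict_Int) (simp add: Int_commute)
  qed
  have "(\<lambda>n. integral halfline (?h n)) \<longlonglongrightarrow> integral halfline b"
  proof (rule dominated_convergence(2)[OF int])
    show "(\<lambda>x. \<bar>b x\<bar>) integrable_on halfline" using b by (auto simp: absolutely_integrable_on_def)
    fix x :: real assume x: "x \<in> halfline"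
    have "(\<lambda>n. 1 / Suc n) \<longlonglongrightarrow> (0::real)"
      using LIMSEQ_inverse_real_of_nat by (simp add: inverse_eq_divide)
    from order_tendstoD(2)[OF this, of x] have "eventually (\<lambda>n. 1 / Suc n < x) sequentially" using x by auto
    moreover have "eventually (\<lambda>n. x \<le> Suc n) sequentially"
      by (rule eventually_sequentiallyI[of "nat \<lceil>x\<rceil>"]) linarith
    ultimately have "eventually (\<lambda>n. ?h n x = b x) sequentially"
    proof eventually_elim
      case (elim n)
      then have "p n \<le> x" "x \<le> q n" using p(2)[of n] q[of n] by linarith+
      then show ?case by simp
    qed
    then show "(\<lambda>n. ?h n x) \<longlonglongrightarrow> b x" by (simp add: tendsto_eventually)
  qed auto
  moreover have "integral halfline (?h n) = integral {p n..q n} b" for n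
  proof -
    have "halfline \<inter> {p n..q n} = {p n..q n}" using p(1)[of n] by auto
    then show ?thesis by (subst integral_restrict_Int) (simp add: Int_commute)
  qed
  ultimately show ?thesis by simp
qed

text \<open>Exhausting the half line by intervals whose endpoints are the vanishing sequences makes
  the boundary terms disappear; a limit of \<open>B\<close> at 0 or infinity need not be known
  beforehand.\<close>

lemma integral_ac_deriv_eq_0:
  assumes B: "ac_deriv B b" and b: "b absolutely_integrable_on halfline"
    and Bt: "(\<lambda>t. B t / t) absolutely_integrable_on halfline"
  shows "integral halfline b = 0"
proof -
  obtain p q :: "nat \<Rightarrow> real" where pq: "\<And>n. 0 < p n" "\<And>n. p n \<le> 1 / Suc n" "\<And>n. Suc n \<le> q n"
    "(\<lambda>n. B (p n)) \<longlonglongrightarrow> 0" "(\<lambda>n. B (q n)) \<longlonglongrightarrow> 0"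
    by (rule vanishing_sequences[OF Bt]) blast
  have "p n \<le> q n" for n
  proof -
    have "1 / real (Suc n) \<le> 1" by (simp add: divide_simps)
    then show ?thesis using pq(2,3)[of n] by linarith
  qed
  then have "integral {p n..q n} b = B (q n) - B (p n)" for n
    using ac_derivD(2)[OF B pq(1)] by simp
  moreover have "(\<lambda>n. B (q n) - B (p n)) \<longlonglongrightarrow> 0 - 0" by (intro tendsto_intros pq)
  ultimately show ?thesis
    using LIMSEQ_unique[OF integral_exhaust_halfline[OF b pq(1-3)]] by simp
qed

subsection \<open>Weighted inner products and Laguerre polynomials\<close>

definition wt :: "real \<Rightarrow> real \<Rightarrow> real" where
  "wt \<alpha> t = t powr \<alpha> * exp (- t)"

definition L2 :: "real \<Rightarrow> (real \<Rightarrow> real) \<Rightarrow> bool" where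
  "L2 \<alpha> F \<longleftrightarrow> F \<in> borel_measurable (lebesgue_on halfline) \<and>
     (\<lambda>t. (F t)\<^sup>2 * wt \<alpha> t) absolutely_integrable_on halfline"

definition ip :: "real \<Rightarrow> (real \<Rightarrow> real) \<Rightarrow> (real \<Rightarrow> real) \<Rightarrow> real" where
  "ip \<alpha> F G = integral halfline (\<lambda>t. F t * G t * wt \<alpha> t)"

definition sq :: "real \<Rightarrow> (real \<Rightarrow> real) \<Rightarrow> real" where
  "sq \<alpha> F = integral halfline (\<lambda>t. (F t)\<^sup>2 * wt \<alpha> t)"

lemma wt_nonneg [simp]: "0 \<le> wt \<alpha> t" by (simp add: wt_def)
lemma wt_pos: "0 < t \<Longrightarrow> 0 < wt \<alpha> t" by (simp add: wt_def)

lemma wt_Suc: "0 < t \<Longrightarrow> wt (\<alpha> + 1) t = t * wt \<alpha> t"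
  by (simp add: wt_def powr_add)

lemma continuous_on_wt: "continuous_on halfline (wt \<alpha>)"
  unfolding wt_def[abs_def] by (intro continuous_intros) auto

lemma wt_measurable: "wt \<alpha> \<in> borel_measurable (lebesgue_on halfline)"
  by (rule continuous_imp_measurable_on_sets_lebesgue[OF continuous_on_wt]) simp

lemma sq_nonneg: "0 \<le> sq \<alpha> F"
  unfolding sq_def
  \<comment> \<open>A non-integrable integrand has the default integral 0.\<close>
  by (cases "(\<lambda>t. (F t)\<^sup>2 * wt \<alpha> t) integrable_on halfline")
    (auto intro: integral_nonneg simp: not_integrable_integral)

lemma L2_measurable: "L2 \<alpha> F \<Longrightarrow> F \<in> borel_measurable (lebesgue_on halfline)"
  by (simp add: L2_def)

lemma L2_integrable:
  assumes "L2 \<alpha> F" shows "(\<lambda>t. (F t)\<^sup>2 * wt \<alpha> t) absolutely_integrable_on halfline"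
    "(\<lambda>t. (F t)\<^sup>2 * wt \<alpha> t) integrable_on halfline"
  using assms by (auto simp: L2_def absolutely_integrable_on_def)

lemma L2_boundI:
  assumes F: "F \<in> borel_measurable (lebesgue_on halfline)" and g: "g integrable_on halfline"
    and le: "\<And>t. 0 < t \<Longrightarrow> (F t)\<^sup>2 * wt \<alpha> t \<le> g t"
  shows "L2 \<alpha> F"
  unfolding L2_def
proof
  note [measurable] = F wt_measurable
  show "(\<lambda>t. (F t)\<^sup>2 * wt \<alpha> t) absolutely_integrable_on halfline"
    by (rule measurable_bounded_by_integrable_imp_absolutely_integrable[OF _ _ g]) (use le in \<open>auto\<close>)
qed (rule F)

lemma L2_mult:
  assumes F: "L2 \<alpha> F" and G: "L2 \<alpha> G"
  shows "(\<lambda>t. F t * G t * wt \<alpha> t) absolutely_integrable_on halfline"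
proof (rule measurable_bounded_by_integrable_imp_absolutely_integrable)
  note [measurable] = L2_measurable[OF F] L2_measurable[OF G] wt_measurable
  show "(\<lambda>t. F t * G t * wt \<alpha> t) \<in> borel_measurable (lebesgue_on halfline)" by measurable
  show "(\<lambda>t. (F t)\<^sup>2 * wt \<alpha> t + (G t)\<^sup>2 * wt \<alpha> t) integrable_on halfline"
    by (intro integrable_add L2_integrable F G)
  fix t :: real
  have "\<bar>F t * G t\<bar> \<le> (F t)\<^sup>2 + (G t)\<^sup>2"
  proof -
    have "0 \<le> \<bar>F t\<bar> * \<bar>G t\<bar>" by simp
    then have "\<bar>F t\<bar> * \<bar>G t\<bar> \<le> \<bar>F t\<bar>\<^sup>2 + \<bar>G t\<bar>\<^sup>2"
      using sum_squares_bound[of "\<bar>F t\<bar>" "\<bar>G t\<bar>"] by linarith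
    then show ?thesis by (simp add: abs_mult)
  qed
  then show "norm (F t * G t * wt \<alpha> t) \<le> (F t)\<^sup>2 * wt \<alpha> t + (G t)\<^sup>2 * wt \<alpha> t"
    by (simp add: abs_mult mult_right_mono flip: distrib_right)
qed simp

lemma L2_mult_integrable: "L2 \<alpha> F \<Longrightarrow> L2 \<alpha> G \<Longrightarrow> (\<lambda>t. F t * G t * wt \<alpha> t) integrable_on halfline"
  using L2_mult by (auto simp: absolutely_integrable_on_def)

lemma L2_cmult: assumes "L2 \<alpha> F" shows "L2 \<alpha> (\<lambda>t. c * F t)"
proof (rule L2_boundI)
  note [measurable] = L2_measurable[OF assms]
  show "(\<lambda>t. c * F t) \<in> borel_measurable (lebesgue_on halfline)" by measurable
  show "(\<lambda>t. c\<^sup>2 * ((F t)\<^sup>2 * wt \<alpha> t)) integrable_on halfline"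
    by (intro integrable_on_mult_right L2_integrable assms)
qed (simp add: power_mult_distrib)

lemma L2_add: assumes "L2 \<alpha> F" "L2 \<alpha> G" shows "L2 \<alpha> (\<lambda>t. F t + G t)"
proof (rule L2_boundI)
  note [measurable] = assms[THEN L2_measurable]
  show "(\<lambda>t. F t + G t) \<in> borel_measurable (lebesgue_on halfline)" by measurable
  show "(\<lambda>t. 2 * ((F t)\<^sup>2 * wt \<alpha> t) + 2 * ((G t)\<^sup>2 * wt \<alpha> t)) integrable_on halfline"
    by (intro integrable_add integrable_on_mult_right L2_integrable assms)
  fix t :: real
  have "(F t + G t)\<^sup>2 \<le> 2 * (F t)\<^sup>2 + 2 * (G t)\<^sup>2"
    using sum_squares_bound[of "F t" "G t"] by (simp add: power2_sum)
  from mult_right_mono[OF this wt_nonneg]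
  show "(F t + G t)\<^sup>2 * wt \<alpha> t \<le> 2 * ((F t)\<^sup>2 * wt \<alpha> t) + 2 * ((G t)\<^sup>2 * wt \<alpha> t)"
    by (simp add: algebra_simps)
qed

lemma L2_diff: assumes "L2 \<alpha> F" "L2 \<alpha> G" shows "L2 \<alpha> (\<lambda>t. F t - G t)"
  using L2_add[OF assms(1) L2_cmult[OF assms(2), of "-1"]] by simp

lemma ip_commute: "ip \<alpha> F G = ip \<alpha> G F"
  unfolding ip_def by (simp add: mult.commute mult.left_commute)

lemma ip_self: "ip \<alpha> F F = sq \<alpha> F"
  unfolding ip_def sq_def by (simp add: power2_eq_square)

lemma ip_cmult_left: "ip \<alpha> (\<lambda>t. c * F t) G = c * ip \<alpha> F G"
  unfolding ip_def by (simp add: mult.assoc)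

lemma ip_cmult_right: "ip \<alpha> F (\<lambda>t. c * G t) = c * ip \<alpha> F G"
  using ip_cmult_left ip_commute by metis

lemma ip_add_left:
  assumes "L2 \<alpha> F" "L2 \<alpha> G" "L2 \<alpha> H"
  shows "ip \<alpha> (\<lambda>t. F t + G t) H = ip \<alpha> F H + ip \<alpha> G H"
  unfolding ip_def
  by (subst Henstock_Kurzweil_Integration.integral_add[symmetric])
    (use assms in \<open>auto intro!: L2_mult_integrable simp: distrib_right\<close>)

lemma ip_add_right:
  assumes "L2 \<alpha> F" "L2 \<alpha> G" "L2 \<alpha> H"
  shows "ip \<alpha> H (\<lambda>t. F t + G t) = ip \<alpha> H F + ip \<alpha> H G"
  using ip_add_left[OF assms] ip_commute by metis

lemma ip_diff_left:
  assumes "L2 \<alpha> F" "L2 \<alpha> G" "L2 \<alpha> H"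
  shows "ip \<alpha> (\<lambda>t. F t - G t) H = ip \<alpha> F H - ip \<alpha> G H"
  using ip_add_left[OF assms(1) L2_cmult[OF assms(2), of "-1"] assms(3)] ip_cmult_left[of \<alpha> "-1" G H] by simp

lemma sq_add:
  assumes "L2 \<alpha> F" "L2 \<alpha> G"
  shows "sq \<alpha> (\<lambda>t. F t + G t) = sq \<alpha> F + 2 * ip \<alpha> F G + sq \<alpha> G"
  using assms L2_add[OF assms]
  by (simp add: ip_self[symmetric] ip_add_left ip_add_right ip_commute[of \<alpha> G F])

lemma sq_cmult: "sq \<alpha> (\<lambda>t. c * F t) = c\<^sup>2 * sq \<alpha> F"
  unfolding sq_def by (simp add: power_mult_distrib mult.assoc)

lemma sq_diff:
  assumes "L2 \<alpha> F" "L2 \<alpha> G"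
  shows "sq \<alpha> (\<lambda>t. F t - G t) = sq \<alpha> F - 2 * ip \<alpha> F G + sq \<alpha> G"
  using sq_add[OF assms(1) L2_cmult[OF assms(2), of "-1"]] sq_cmult[of \<alpha> "-1" G] ip_cmult_right[of \<alpha> F "-1" G]
  by simp

lemma sq_add_le:
  assumes "L2 \<alpha> F" "L2 \<alpha> G"
  shows "sq \<alpha> (\<lambda>t. F t + G t) \<le> 2 * sq \<alpha> F + 2 * sq \<alpha> G"
  using sq_add[OF assms] sq_diff[OF assms] sq_nonneg[of \<alpha> "\<lambda>t. F t - G t"] by linarith

lemma power_wt_integrable:
  assumes "-1 < \<alpha>" shows "(\<lambda>t. t ^ k * wt \<alpha> t) integrable_on halfline"
proof -
  have "((\<lambda>t. t powr (real k + \<alpha> + 1 - 1) / exp t) has_integral Gamma (real k + \<alpha> + 1)) {0..}"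
    by (rule Gamma_integral_real) (use assms in simp)
  then have "(\<lambda>t. t powr (real k + \<alpha>) / exp t) integrable_on {0..}"
    by (auto simp: integrable_on_def)
  then have "(\<lambda>t. t powr (real k + \<alpha>) / exp t) integrable_on halfline"
    by (rule integrable_spike_set) (auto intro: negligible_subset[of "{0}"])
  then show ?thesis
    by (rule integrable_eq) (simp add: wt_def powr_add powr_realpow exp_minus divide_inverse)
qed

lemma poly_wt_integrable:
  assumes "-1 < \<alpha>" shows "(\<lambda>t. poly p t * wt \<alpha> t) integrable_on halfline"
proof -
  have "(\<lambda>t. \<Sum>k\<le>degree p. coeff p k * (t ^ k * wt \<alpha> t)) integrable_on halfline"
    by (intro integrable_sum integrable_on_mult_right power_wt_integrable assms) simp
  then show ?thesis by (simp add: poly_altdef sum_distrib_right mult.assoc)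
qed

lemma poly_measurable: "poly p \<in> borel_measurable (lebesgue_on halfline)" for p :: "real poly"
  by (rule continuous_imp_measurable_on_sets_lebesgue) (auto intro!: continuous_intros)

lemma L2_poly: "-1 < \<alpha> \<Longrightarrow> L2 \<alpha> (poly p)"
  by (rule L2_boundI[OF poly_measurable poly_wt_integrable[of \<alpha> "p * p"]]) (simp_all add: power2_eq_square)

lemma L2_poly_mult:
  "-1 < \<alpha> \<Longrightarrow> L2 \<alpha> F \<Longrightarrow> (\<lambda>t. F t * poly p t * wt \<alpha> t) absolutely_integrable_on halfline"
  by (intro L2_mult L2_poly)

lemma poly_add_fun: "poly (p + q) = (\<lambda>t. poly p t + poly q t)" by auto
lemma poly_smult_fun: "poly (smult c p) = (\<lambda>t. c * poly p t)" by auto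

lemma ac_deriv_poly: "ac_deriv (poly p) (poly (pderiv p))"
  by (rule ac_deriv_of_has_derivative) (auto intro!: poly_DERIV continuous_intros)

lemma has_derivative_wt:
  assumes "0 < t" shows "(wt (\<alpha> + 1) has_real_derivative (\<alpha> + 1 - t) * wt \<alpha> t) (at t)"
proof -
  have "((\<lambda>t. t powr (\<alpha> + 1) * exp (- t)) has_real_derivative
      (\<alpha> + 1) * t powr \<alpha> * exp (- t) + t powr (\<alpha> + 1) * - exp (- t)) (at t)"
    by (auto intro!: derivative_eq_intros simp: assms)
  then show ?thesis
    using assms unfolding wt_def[abs_def] by (simp add: powr_add algebra_simps)
qed

section \<open>The Laguerre operator and its eigenpolynomials\<close>

text \<open>The adjoint of d/dt, taken from the space with weight \<open>wt \<alpha>\<close> to the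
  one with weight \<open>wt (\<alpha> + 1)\<close>: the derivative of
  \<open>poly p t * wt (\<alpha> + 1) t\<close> is minus this polynomial times
  \<open>wt \<alpha> t\<close>.\<close>

definition adjoint_deriv :: "real \<Rightarrow> real poly \<Rightarrow> real poly" where
  "adjoint_deriv \<alpha> p = - ([:0, 1:] * pderiv p + [:\<alpha> + 1, -1:] * p)"

text \<open>Integration by parts with boundary term F p \<open>wt (\<alpha> + 1)\<close>. Divided by
  t it is F p \<open>wt \<alpha>\<close>, a product of two members of the same weighted space and
  hence integrable, so \<open>integral_ac_deriv_eq_0\<close> applies.\<close>

lemma ip_deriv:
  assumes \<alpha>: "-1 < \<alpha>" and F: "ac_deriv F f" "L2 \<alpha> F" and f: "L2 (\<alpha> + 1) f"
  shows "ip (\<alpha> + 1) f (poly p) = ip \<alpha> F (poly (adjoint_deriv \<alpha> p))"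
proof -
  let ?W = "\<lambda>t. poly p t * wt (\<alpha> + 1) t"
  let ?w = "\<lambda>t. - poly (adjoint_deriv \<alpha> p) t * wt \<alpha> t"
  have W: "ac_deriv ?W ?w"
  proof (rule ac_deriv_of_has_derivative)
    show "(?W has_real_derivative ?w t) (at t)" if "0 < t" for t
    proof -
      have "(?W has_real_derivative poly (pderiv p) t * wt (\<alpha> + 1) t
          + (\<alpha> + 1 - t) * wt \<alpha> t * poly p t) (at t)"
        by (rule DERIV_mult[OF poly_DERIV has_derivative_wt[OF that]])
      then show ?thesis
        unfolding wt_Suc[OF that] by (rule DERIV_cong) (simp add: adjoint_deriv_def algebra_simps)
    qed
    show "continuous_on halfline ?w" by (intro continuous_intros continuous_on_wt)
  qed
  have i1: "(\<lambda>t. f t * poly p t * wt (\<alpha> + 1) t) absolutely_integrable_on halfline"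
    using \<alpha> f by (intro L2_poly_mult) auto
  have i2: "(\<lambda>t. F t * poly (adjoint_deriv \<alpha> p) t * wt \<alpha> t) absolutely_integrable_on halfline"
    using \<alpha> F by (intro L2_poly_mult) auto
  let ?b = "\<lambda>t. f t * ?W t + F t * ?w t"
  have b: "?b = (\<lambda>t. f t * poly p t * wt (\<alpha> + 1) t - F t * poly (adjoint_deriv \<alpha> p) t * wt \<alpha> t)"
    by (simp add: fun_eq_iff)
  have "integral halfline ?b = 0"
  proof (rule integral_ac_deriv_eq_0[OF ac_deriv_mult[OF F(1) W]])
    show "?b absolutely_integrable_on halfline" unfolding b by (rule set_integral_diff(1)[OF i1 i2])
    have "(\<lambda>t. F t * poly p t * wt \<alpha> t) absolutely_integrable_on halfline"
      using \<alpha> F by (intro L2_poly_mult) auto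
    then show "(\<lambda>t. F t * ?W t / t) absolutely_integrable_on halfline"
      by (rule absolutely_integrable_spike[OF _ negligible_empty]) (simp add: wt_Suc)
  qed
  moreover have "integral halfline ?b = ip (\<alpha> + 1) f (poly p) - ip \<alpha> F (poly (adjoint_deriv \<alpha> p))"
    unfolding b ip_def
    by (rule Henstock_Kurzweil_Integration.integral_diff) (use i1 i2 in \<open>auto simp: absolutely_integrable_on_def\<close>)
  ultimately show ?thesis by simp
qed

text \<open>Unlike \<open>degree p < n\<close>, this describes a linear space of dimension n for
  every n: for n = 0 it contains exactly the zero polynomial, so inductions can start there.\<close>

definition deg_lt :: "nat \<Rightarrow> real poly \<Rightarrow> bool" where
  "deg_lt n p \<longleftrightarrow> (\<forall>k\<ge>n. coeff p k = 0)"

lemma deg_lt_add: "deg_lt n p \<Longrightarrow> deg_lt n q \<Longrightarrow> deg_lt n (p + q)"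
  and deg_lt_diff: "deg_lt n p \<Longrightarrow> deg_lt n q \<Longrightarrow> deg_lt n (p - q)"
  and deg_lt_smult: "deg_lt n p \<Longrightarrow> deg_lt n (smult c p)"
  and deg_lt_0 [simp]: "deg_lt n 0"
  by (auto simp: deg_lt_def)

lemma deg_lt_mono: "deg_lt n p \<Longrightarrow> n \<le> m \<Longrightarrow> deg_lt m p" by (auto simp: deg_lt_def)

lemma deg_lt_0_iff: "deg_lt 0 p \<longleftrightarrow> p = 0" by (auto simp: deg_lt_def poly_eq_iff)

lemma deg_lt_pderiv: "deg_lt (Suc n) p \<Longrightarrow> deg_lt n (pderiv p)"
  by (auto simp: deg_lt_def coeff_pderiv)

lemma deg_lt_degree: "deg_lt (Suc (degree p)) p"
  by (auto simp: deg_lt_def coeff_eq_0)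

lemma degree_less_of_deg_lt: "deg_lt n p \<Longrightarrow> 0 < n \<Longrightarrow> degree p < n"
  by (metis deg_lt_def leading_coeff_0_iff degree_0 not_le)

text \<open>The Laguerre differential operator - (t q'' + (\<alpha> + 1 - t) q'), as derivative
  followed by adjoint; this form makes it symmetric and nonnegative.\<close>

definition laguerre_op :: "real \<Rightarrow> real poly \<Rightarrow> real poly" where
  "laguerre_op \<alpha> q = adjoint_deriv \<alpha> (pderiv q)"

text \<open>In the monomial basis the operator is triangular with diagonal 0, 1, 2, ...; the degree
  does not grow, and the eigenvalues can be read off.\<close>

lemma coeff_laguerre_op:
  "coeff (laguerre_op \<alpha> q) r = real r * coeff q r - (real r + 1) * (real r + \<alpha> + 1) * coeff q (Suc r)"
  by (cases r) (simp_all add: laguerre_op_def adjoint_deriv_def coeff_pderiv coeff_pCons algebra_simps)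

lemma laguerre_op_add: "laguerre_op \<alpha> (p + q) = laguerre_op \<alpha> p + laguerre_op \<alpha> q"
  by (rule poly_eqI) (simp add: coeff_laguerre_op algebra_simps)

lemma laguerre_op_smult: "laguerre_op \<alpha> (smult c p) = smult c (laguerre_op \<alpha> p)"
  by (rule poly_eqI) (simp add: coeff_laguerre_op algebra_simps)

lemma deg_lt_laguerre_op: "deg_lt n q \<Longrightarrow> deg_lt n (laguerre_op \<alpha> q)"
  by (simp add: deg_lt_def coeff_laguerre_op)

lemma ip_laguerre_op:
  assumes "-1 < \<alpha>" "ac_deriv F f" "L2 \<alpha> F" "L2 (\<alpha> + 1) f"
  shows "ip \<alpha> F (poly (laguerre_op \<alpha> q)) = ip (\<alpha> + 1) f (poly (pderiv q))"
  unfolding laguerre_op_def using ip_deriv[OF assms] by simp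

lemma laguerre_op_symmetric:
  assumes "-1 < \<alpha>"
  shows "ip \<alpha> (poly p) (poly (laguerre_op \<alpha> q)) = ip \<alpha> (poly (laguerre_op \<alpha> p)) (poly q)"
proof -
  have *: "ip \<alpha> (poly p) (poly (laguerre_op \<alpha> q)) = ip (\<alpha> + 1) (poly (pderiv p)) (poly (pderiv q))" for p q
    using assms by (intro ip_laguerre_op ac_deriv_poly L2_poly) auto
  show ?thesis using *[of p q] *[of q p] ip_commute by metis
qed

definition Lag :: "nat \<Rightarrow> real \<Rightarrow> real poly" where
  "Lag n \<alpha> = (\<Sum>r\<le>n. monom ((-1) ^ r / fact r * ((real n + \<alpha>) gchoose (n - r))) r)"

lemma poly_Lag: "poly (Lag n \<alpha>) y = laguerre n \<alpha> y"
  by (simp add: Lag_def laguerre_def poly_sum poly_monom)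

lemma coeff_Lag: "coeff (Lag n \<alpha>) r = (if r \<le> n then (-1) ^ r / fact r * ((real n + \<alpha>) gchoose (n - r)) else 0)"
  by (simp add: Lag_def coeff_sum)

lemma coeff_Lag_n: "coeff (Lag n \<alpha>) n \<noteq> 0" by (simp add: coeff_Lag)

lemma Lag_nonzero: "Lag n \<alpha> \<noteq> 0" using coeff_Lag_n[of n \<alpha>] by auto

lemma deg_lt_Lag: "deg_lt (Suc n) (Lag n \<alpha>)" by (simp add: deg_lt_def coeff_Lag)

lemma degree_Lag: "degree (Lag n \<alpha>) = n"
  using degree_less_of_deg_lt[OF deg_lt_Lag] le_degree[OF coeff_Lag_n] by (simp add: le_antisym less_Suc_eq_le)

text \<open>Comparing coefficients at r < n, with a = n + \<alpha> and k = n - r - 1, reduces the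
  claim to (k + 1) (a gchoose (k + 1)) = (a - k) (a gchoose k), because a - k = r + \<alpha> +
  1.\<close>

lemma laguerre_op_Lag: "laguerre_op \<alpha> (Lag n \<alpha>) = smult (real n) (Lag n \<alpha>)"
proof (rule poly_eqI)
  fix r
  show "coeff (laguerre_op \<alpha> (Lag n \<alpha>)) r = coeff (smult (real n) (Lag n \<alpha>)) r"
  proof (cases "r < n")
    case True
    define k where "k = n - Suc r"
    have k: "n - r = Suc k" "n = Suc (r + k)" using True by (auto simp: k_def)
    define a where "a = real n + \<alpha>"
    have "real (Suc k) * (a gchoose Suc k) = (a - real k) * (a gchoose k)"
      using gbinomial_mult_1[of a k] by (simp add: algebra_simps)
    then have *: "(a gchoose Suc k) = (a - real k) * (a gchoose k) / real (Suc k)"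
      by (simp add: field_simps)
    have c: "coeff (Lag n \<alpha>) (Suc r) = - ((-1) ^ r / (fact r * (real r + 1)) * (a gchoose k))"
      using True k by (simp add: coeff_Lag a_def algebra_simps)
    have c0: "coeff (Lag n \<alpha>) r = (-1) ^ r / fact r * ((a - real k) * (a gchoose k) / real (Suc k))"
      using True k(1) by (simp add: coeff_Lag a_def[symmetric] * )
    have gen: "s * - (x / (f * s) * y) = - (x / f * y)" if "s \<noteq> 0" for s x f y :: real
      using that by (cases "f = 0") (simp_all add: field_simps)
    define P where "P = (-1) ^ r / fact r * (a gchoose k)"
    have D: "real r + \<alpha> + 1 = a - real k" "real n - real r = real (Suc k)"
      using k(2) by (simp_all add: a_def)
    have m2: "(real r + 1) * coeff (Lag n \<alpha>) (Suc r) = - P"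
      unfolding c P_def by (rule gen) simp
    have "coeff (Lag n \<alpha>) r = P * (a - real k) / real (Suc k)"
      unfolding c0 P_def by simp
    then have m1: "real (Suc k) * coeff (Lag n \<alpha>) r = P * (a - real k)" by simp
    have "(real n - real r) * coeff (Lag n \<alpha>) r = - ((a - real k) * ((real r + 1) * coeff (Lag n \<alpha>) (Suc r)))"
      unfolding m2 D m1 by simp
    then have "(real n - real r) * coeff (Lag n \<alpha>) r = - (real r + 1) * (real r + \<alpha> + 1) * coeff (Lag n \<alpha>) (Suc r)"
      unfolding D(1) by (simp add: algebra_simps)
    then show ?thesis by (simp add: coeff_laguerre_op algebra_simps)
  next
    case False
    then show ?thesis by (cases "r = n") (auto simp: coeff_laguerre_op coeff_Lag)
  qed
qed

text \<open>If q has degree at most k < n, then \<open>laguerre_op \<alpha> q\<close> minus k q has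
  smaller degree and is orthogonal by induction. Symmetry then gives n I(q) = k I(q) for the inner
  product I(q), so I(q) = 0.\<close>

lemma Lag_orthogonal:
  assumes \<alpha>: "-1 < \<alpha>" and q: "deg_lt n q"
  shows "ip \<alpha> (poly (Lag n \<alpha>)) (poly q) = 0"
proof -
  have "ip \<alpha> (poly (Lag n \<alpha>)) (poly q) = 0" if "k \<le> n" "deg_lt k q" for k q
    using that
  proof (induction k arbitrary: q)
    case 0
    then show ?case by (simp add: deg_lt_0_iff ip_def)
  next
    case (Suc k)
    let ?I = "\<lambda>q. ip \<alpha> (poly (Lag n \<alpha>)) (poly q)"
    let ?r = "laguerre_op \<alpha> q - smult (real k) q"
    have "deg_lt k ?r"
      unfolding deg_lt_def
    proof (intro allI impI)
      fix j assume "k \<le> j"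
      then show "coeff ?r j = 0"
        using Suc.prems(2) by (cases "j = k") (auto simp: deg_lt_def coeff_laguerre_op)
    qed
    then have "?I ?r = 0" using Suc by simp
    have "real n * ?I q = ip \<alpha> (poly (laguerre_op \<alpha> (Lag n \<alpha>))) (poly q)"
      by (simp add: laguerre_op_Lag poly_smult_fun ip_cmult_left)
    also have "\<dots> = ?I (laguerre_op \<alpha> q)" by (rule laguerre_op_symmetric[OF \<alpha>, symmetric])
    also have "laguerre_op \<alpha> q = ?r + smult (real k) q" by simp
    also have "?I (?r + smult (real k) q) = ?I ?r + real k * ?I q"
      unfolding poly_add_fun poly_smult_fun[of "real k"]
      by (subst ip_add_right) (auto intro!: L2_poly L2_cmult \<alpha> simp: ip_cmult_right)
    finally have "(real n - real k) * ?I q = 0" using \<open>?I ?r = 0\<close> by (simp add: algebra_simps)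
    then show ?case using Suc.prems by auto
  qed
  then show ?thesis using q by blast
qed

lemma deg_lt_Suc_decompose:
  assumes "deg_lt (Suc n) q"
  obtains c r where "q = smult c (Lag n \<alpha>) + r" "deg_lt n r"
proof
  let ?c = "coeff q n / coeff (Lag n \<alpha>) n"
  show "q = smult ?c (Lag n \<alpha>) + (q - smult ?c (Lag n \<alpha>))" by simp
  show "deg_lt n (q - smult ?c (Lag n \<alpha>))"
    unfolding deg_lt_def
  proof (intro allI impI)
    fix j assume "n \<le> j"
    then show "coeff (q - smult ?c (Lag n \<alpha>)) j = 0"
      using assms deg_lt_Lag[of n \<alpha>] coeff_Lag_n[of n \<alpha>] by (cases "j = n") (auto simp: deg_lt_def)
  qed
qed

text \<open>The squared norm of the derivative is the quadratic form of \<open>laguerre_op\<close>,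
  whose eigenvalues up to degree n are 0, ..., n. Each induction step splits off the top
  eigenvector; the cross terms vanish because the operator does not raise the degree of the
  rest.\<close>

lemma sq_pderiv_le:
  assumes \<alpha>: "-1 < \<alpha>" and q: "deg_lt (Suc n) q"
  shows "sq (\<alpha> + 1) (poly (pderiv q)) \<le> real n * sq \<alpha> (poly q)"
proof -
  have dir: "sq (\<alpha> + 1) (poly (pderiv q)) = ip \<alpha> (poly q) (poly (laguerre_op \<alpha> q))" for q
    unfolding ip_self[symmetric] using \<alpha> by (intro ip_laguerre_op[symmetric] ac_deriv_poly L2_poly) auto
  have "ip \<alpha> (poly q) (poly (laguerre_op \<alpha> q)) \<le> real n * sq \<alpha> (poly q)"
    using q
  proof (induction n arbitrary: q)
    case 0
    have "laguerre_op \<alpha> q = 0"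
    proof (rule poly_eqI)
      show "coeff (laguerre_op \<alpha> q) r = coeff 0 r" for r
        using 0 by (cases r) (auto simp: coeff_laguerre_op deg_lt_def)
    qed
    then show ?case by (simp add: ip_def)
  next
    case (Suc n)
    let ?L = "Lag (Suc n) \<alpha>"
    obtain c r where q: "q = smult c ?L + r" and r: "deg_lt (Suc n) r"
      by (rule deg_lt_Suc_decompose[OF Suc.prems])
    let ?A = "laguerre_op \<alpha>"
    note [simp] = L2_poly[OF \<alpha>] L2_cmult L2_add
    have o1: "ip \<alpha> (poly ?L) (poly r) = 0" "ip \<alpha> (poly ?L) (poly (?A r)) = 0"
      using Lag_orthogonal[OF \<alpha>] r deg_lt_laguerre_op by blast+
    then have o2: "ip \<alpha> (poly r) (poly ?L) = 0" by (simp add: ip_commute)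
    have "ip \<alpha> (poly q) (poly (?A q)) = real (Suc n) * c\<^sup>2 * sq \<alpha> (poly ?L) + ip \<alpha> (poly r) (poly (?A r))"
      unfolding q laguerre_op_add laguerre_op_smult laguerre_op_Lag poly_add_fun poly_smult_fun
      by (simp add: ip_add_left ip_add_right ip_cmult_left ip_cmult_right o1 o2 ip_self power2_eq_square)
    also have "\<dots> \<le> real (Suc n) * c\<^sup>2 * sq \<alpha> (poly ?L) + real (Suc n) * sq \<alpha> (poly r)"
      using Suc.IH[OF r] sq_nonneg[of \<alpha> "poly r"] by (simp add: algebra_simps)
    also have "\<dots> = real (Suc n) * sq \<alpha> (poly q)"
      unfolding q poly_add_fun poly_smult_fun
      by (simp add: sq_add sq_cmult ip_cmult_left ip_cmult_right o1 o2 algebra_simps)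
    finally show ?case .
  qed
  then show ?thesis by (simp add: dir)
qed

section \<open>Orthogonal projection onto polynomials\<close>

definition orth :: "real \<Rightarrow> nat \<Rightarrow> (real \<Rightarrow> real) \<Rightarrow> bool" where
  "orth \<alpha> n F \<longleftrightarrow> (\<forall>q. deg_lt n q \<longrightarrow> ip \<alpha> F (poly q) = 0)"

text \<open>To the right of the largest root the integrand is continuous and strictly positive; one
  unit interval there already gives a positive contribution.\<close>

lemma integral_poly_wt_pos:
  assumes \<alpha>: "-1 < \<alpha>" and p: "p \<noteq> 0" "\<And>t. 0 < t \<Longrightarrow> 0 \<le> poly p t"
  shows "0 < integral halfline (\<lambda>t. poly p t * wt \<alpha> t)"
proof -
  obtain a :: real where a: "0 < a" "\<And>x. poly p x = 0 \<Longrightarrow> x < a"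
  proof -
    have "finite (insert 0 {x. poly p x = 0})" using poly_roots_finite[OF p(1)] by simp
    then have "x \<le> Max (insert 0 {x. poly p x = 0})" if "x \<in> insert 0 {x. poly p x = 0}" for x
      using that by (rule Max_ge)
    then show ?thesis by (intro that[of "Max (insert 0 {x. poly p x = 0}) + 1"]) (force intro: le_less_trans)+
  qed
  let ?f = "\<lambda>t. poly p t * wt \<alpha> t"
  have int: "?f integrable_on halfline" using poly_wt_integrable \<alpha> .
  have sub: "?f integrable_on {a..a+1}"
    by (rule integrable_on_subinterval[OF int]) (use a in auto)
  have "integral {a..a+1} ?f \<le> integral halfline ?f"
    by (rule integral_subset_le) (use int sub a p in auto)
  moreover have "0 < integral {a..a+1} ?f"
  proof -
    have c: "continuous_on {a..a+1} ?f"
      by (intro continuous_intros continuous_on_subset[OF continuous_on_wt]) (use a in auto)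
    have ne: "0 < ?f t" if "t \<in> {a..a+1}" for t
    proof -
      have "0 < t" "poly p t \<noteq> 0" using that a(1) a(2)[of t] by auto
      then show ?thesis using wt_pos[of t \<alpha>] p(2)[of t] by auto
    qed
    have "integral {a..a+1} ?f \<ge> 0" by (rule integral_nonneg[OF sub]) (use ne in \<open>auto intro: less_imp_le\<close>)
    moreover have "integral {a..a+1} ?f \<noteq> 0"
    proof
      assume "integral {a..a+1} ?f = 0"
      then have "\<forall>t\<in>{a..a+1}. ?f t = 0"
        using integral_eq_0_iff[OF c] ne by (simp add: less_imp_le)
      then have "?f a = 0" by (rule bspec) simp
      moreover have "0 < ?f a" by (rule ne) simp
      ultimately show False by linarith
    qed
    ultimately show ?thesis by simp
  qed
  ultimately show ?thesis by simp
qed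

lemma sq_poly_pos:
  assumes "-1 < \<alpha>" "p \<noteq> 0" shows "0 < sq \<alpha> (poly p)"
  using integral_poly_wt_pos[OF assms(1), of "p * p"] assms(2) by (simp add: sq_def power2_eq_square)

text \<open>One Fourier coefficient is added per step: the new Laguerre polynomial is orthogonal to
  all lower degrees, so the orthogonality already achieved survives.\<close>

lemma ex_orthogonal_projection:
  assumes \<alpha>: "-1 < \<alpha>" and F: "L2 \<alpha> F"
  shows "\<exists>p. deg_lt n p \<and> orth \<alpha> n (\<lambda>t. F t - poly p t)"
proof (induction n)
  case 0
  show ?case by (intro exI[of _ 0]) (simp add: orth_def deg_lt_0_iff ip_def)
next
  case (Suc n)
  then obtain p where p: "deg_lt n p" "orth \<alpha> n (\<lambda>t. F t - poly p t)" by blast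
  note [simp] = L2_poly[OF \<alpha>] L2_cmult L2_add L2_diff F
  let ?L = "Lag n \<alpha>"
  define c where "c = ip \<alpha> (\<lambda>t. F t - poly p t) (poly ?L) / sq \<alpha> (poly ?L)"
  have fe: "(\<lambda>t. F t - poly (p + smult c ?L) t) = (\<lambda>t. (F t - poly p t) - c * poly ?L t)"
    by (auto simp: fun_eq_iff)
  have L: "ip \<alpha> (\<lambda>t. F t - poly (p + smult c ?L) t) (poly ?L) = 0"
  proof -
    have "c * sq \<alpha> (poly ?L) = ip \<alpha> (\<lambda>t. F t - poly p t) (poly ?L)"
      using sq_poly_pos[OF \<alpha> Lag_nonzero, of n \<alpha>] by (simp add: c_def)
    then show ?thesis
      unfolding fe by (subst ip_diff_left) (simp_all add: ip_cmult_left ip_self)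
  qed
  have r: "ip \<alpha> (\<lambda>t. F t - poly (p + smult c ?L) t) (poly r) = 0" if "deg_lt n r" for r
    using p(2) that Lag_orthogonal[OF \<alpha> that] unfolding fe
    by (subst ip_diff_left) (simp_all add: ip_cmult_left orth_def)
  show ?case
  proof (intro exI[of _ "p + smult c ?L"] conjI)
    show "deg_lt (Suc n) (p + smult c ?L)"
      by (intro deg_lt_add deg_lt_smult deg_lt_Lag deg_lt_mono[OF p(1)]) simp
    show "orth \<alpha> (Suc n) (\<lambda>t. F t - poly (p + smult c ?L) t)"
      unfolding orth_def
    proof (intro allI impI)
      fix q assume "deg_lt (Suc n) q"
      then obtain d r where q: "q = smult d ?L + r" "deg_lt n r"
        by (rule deg_lt_Suc_decompose[where \<alpha> = \<alpha>])
      have "ip \<alpha> (\<lambda>t. F t - poly (p + smult c ?L) t) (poly q) =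
        d * ip \<alpha> (\<lambda>t. F t - poly (p + smult c ?L) t) (poly ?L) + ip \<alpha> (\<lambda>t. F t - poly (p + smult c ?L) t) (poly r)"
        unfolding q(1) poly_add_fun[of "smult d ?L"] poly_smult_fun[of d]
        by (subst ip_add_right) (simp_all add: ip_cmult_right)
      then show "ip \<alpha> (\<lambda>t. F t - poly (p + smult c ?L) t) (poly q) = 0" using L r[OF q(2)] by simp
    qed
  qed
qed

lemma sq_best_approximation:
  assumes \<alpha>: "-1 < \<alpha>" and F: "L2 \<alpha> F" and p: "deg_lt n p" "orth \<alpha> n (\<lambda>t. F t - poly p t)" and q: "deg_lt n q"
  shows "sq \<alpha> (\<lambda>t. F t - poly p t) \<le> sq \<alpha> (\<lambda>t. F t - poly q t)"
proof -
  have "(\<lambda>t. F t - poly q t) = (\<lambda>t. (F t - poly p t) + poly (p - q) t)" by (simp add: fun_eq_iff)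
  moreover have "ip \<alpha> (\<lambda>t. F t - poly p t) (poly (p - q)) = 0"
    using p q by (simp add: orth_def deg_lt_diff)
  ultimately show ?thesis
    using sq_add[OF L2_diff[OF F L2_poly[OF \<alpha>]] L2_poly[OF \<alpha>], of p "p - q"] sq_nonneg[of \<alpha> "poly (p - q)"] by simp
qed

section \<open>Number and simplicity of the zeros\<close>

text \<open>At a multiple zero z, L and L' vanish to higher order than L''. The Laguerre equation
  expresses t L'' through L and L', so t L'' would vanish to that higher order too, although t does
  not vanish at z > 0. This is an algebraic form of uniqueness at a regular point of the
  equation.\<close>

lemma Lag_simple_zero:
  assumes z: "0 < z" "poly (Lag n \<alpha>) z = 0"
  shows "poly (pderiv (Lag n \<alpha>)) z \<noteq> 0"
proof
  let ?L = "Lag n \<alpha>"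
  assume d: "poly (pderiv ?L) z = 0"
  have L1: "pderiv ?L \<noteq> 0"
  proof
    assume "pderiv ?L = 0"
    then have "degree ?L = 0" by (simp add: pderiv_eq_0_iff)
    then obtain c where "?L = [:c:]" by (rule degree_eq_zeroE)
    then show False using z Lag_nonzero[of n \<alpha>] by simp
  qed
  have L2: "pderiv (pderiv ?L) \<noteq> 0"
  proof
    assume "pderiv (pderiv ?L) = 0"
    then have "degree (pderiv ?L) = 0" by (simp add: pderiv_eq_0_iff)
    then obtain c where "pderiv ?L = [:c:]" by (rule degree_eq_zeroE)
    then show False using d L1 by simp
  qed
  have o1: "order z ?L = Suc (order z (pderiv ?L))" by (rule order_pderiv[OF Lag_nonzero z(2)])
  have o2: "order z (pderiv ?L) = Suc (order z (pderiv (pderiv ?L)))" by (rule order_pderiv[OF L1 d])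
  let ?j = "order z (pderiv (pderiv ?L))"
  have d1: "[:- z, 1:] ^ Suc ?j dvd pderiv ?L" using order_1[of z "pderiv ?L"] unfolding o2 .
  have "[:- z, 1:] ^ Suc (Suc ?j) dvd ?L" using order_1[of z ?L] unfolding o1 o2 .
  then have d2: "[:- z, 1:] ^ Suc ?j dvd ?L" by (rule power_le_dvd) simp
  have "[:0, 1:] * pderiv (pderiv ?L) = - ([:\<alpha> + 1, -1:] * pderiv ?L + smult (real n) ?L)"
    unfolding laguerre_op_Lag[symmetric] laguerre_op_def adjoint_deriv_def by simp
  moreover have "[:- z, 1:] ^ Suc ?j dvd - ([:\<alpha> + 1, -1:] * pderiv ?L + smult (real n) ?L)"
    unfolding dvd_minus_iff by (intro dvd_add dvd_mult dvd_smult d1 d2)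
  ultimately have dv: "[:- z, 1:] ^ Suc ?j dvd [:0, 1:] * pderiv (pderiv ?L)" by (simp only:)
  have nz: "[:0, 1:] * pderiv (pderiv ?L) \<noteq> 0" using L2 by simp
  have "Suc ?j \<le> order z ([:0, 1:] * pderiv (pderiv ?L))"
    using dv nz order_divides by blast
  also have "\<dots> = order z [:0, 1:] + ?j" by (rule order_mult[OF nz])
  also have "order z [:0, 1 :: real:] = 0" using z by (intro order_0I) simp
  finally show False by simp
qed

lemma prod_roots_dvd:
  fixes p :: "real poly"
  assumes "finite Z" "\<And>z. z \<in> Z \<Longrightarrow> poly p z = 0"
  shows "(\<Prod>z\<in>Z. [:- z, 1:]) dvd p"
  using assms
proof (induction Z arbitrary: p rule: finite_induct)
  case (insert z Z)
  have "(\<Prod>z\<in>Z. [:- z, 1:]) dvd p" by (rule insert.IH) (simp add: insert.prems)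
  then obtain r where r: "p = (\<Prod>z\<in>Z. [:- z, 1:]) * r" by (rule dvdE)
  have "poly (\<Prod>z\<in>Z. [:- z, 1:]) z \<noteq> 0"
    using insert.hyps by (auto simp: poly_prod)
  then have "poly r z = 0" using insert.prems[of z] r by simp
  then have "[:- z, 1:] dvd r" by (simp add: poly_eq_0_iff_dvd)
  then have "[:- z, 1:] * (\<Prod>z\<in>Z. [:- z, 1:]) dvd r * (\<Prod>z\<in>Z. [:- z, 1:])"
    by (intro mult_dvd_mono) simp_all
  then show ?case using insert.hyps r by (simp add: mult.commute)
qed simp

definition lag_zeros :: "nat \<Rightarrow> real \<Rightarrow> real set" where
  "lag_zeros n \<alpha> = {y. 0 < y \<and> laguerre n \<alpha> y = 0}"

lemma finite_lag_zeros: "finite (lag_zeros n \<alpha>)"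
  by (rule finite_subset[OF _ poly_roots_finite[OF Lag_nonzero[of n \<alpha>]]]) (auto simp: lag_zeros_def poly_Lag)

lemma poly_no_positive_root_sign:
  fixes r :: "real poly"
  assumes "\<And>t. 0 < t \<Longrightarrow> poly r t \<noteq> 0"
  shows "(\<forall>t>0. 0 < poly r t) \<or> (\<forall>t>0. poly r t < 0)"
proof (rule ccontr)
  assume "\<not> ?thesis"
  then obtain a b where "0 < a" "0 < b" "\<not> 0 < poly r a" "\<not> poly r b < 0" by blast
  then have ab: "0 < a" "0 < b" "poly r a < 0" "0 < poly r b"
    using assms[of a] assms[of b] by linarith+
  then have "a \<noteq> b" by auto
  then show False
  proof (cases "a < b")
    case True
    from poly_IVT_pos[OF this ab(3,4)] obtain x where "a < x" "poly r x = 0" by blast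
    then show False using assms[of x] ab(1) by simp
  next
    case False
    with \<open>a \<noteq> b\<close> have "b < a" by simp
    from poly_IVT_neg[OF this ab(4,3)] obtain x where "b < x" "poly r x = 0" by blast
    then show False using assms[of x] ab(2) by simp
  qed
qed

text \<open>With Q the product over the positive zeros, L = Q R, and simplicity keeps R free of
  positive zeros and hence of one sign. Were there fewer than n zeros, L would be orthogonal to Q,
  whereas the integral of Q Q R against the weight cannot vanish.\<close>

lemma card_lag_zeros:
  assumes \<alpha>: "-1 < \<alpha>" shows "card (lag_zeros n \<alpha>) = n"
proof (rule antisym)
  let ?L = "Lag n \<alpha>"
  have "card (lag_zeros n \<alpha>) \<le> card {x. poly ?L x = 0}"
    by (rule card_mono[OF poly_roots_finite[OF Lag_nonzero]]) (auto simp: lag_zeros_def poly_Lag)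
  also have "\<dots> \<le> n" using card_poly_roots_bound[OF Lag_nonzero, of n \<alpha>] by (simp add: degree_Lag)
  finally show "card (lag_zeros n \<alpha>) \<le> n" .
  show "n \<le> card (lag_zeros n \<alpha>)"
  proof (rule ccontr)
    assume less: "\<not> n \<le> card (lag_zeros n \<alpha>)"
    define Q where "Q = (\<Prod>z\<in>lag_zeros n \<alpha>. [:- z, 1:])"
    have "Q dvd ?L" unfolding Q_def
      by (rule prod_roots_dvd[OF finite_lag_zeros]) (simp add: lag_zeros_def poly_Lag)
    then obtain R where R: "?L = Q * R" by (auto simp: dvd_def)
    have Q0: "poly Q z = 0 \<longleftrightarrow> z \<in> lag_zeros n \<alpha>" for z
      using finite_lag_zeros by (auto simp: Q_def poly_prod)
    have "poly R t \<noteq> 0" if t: "0 < t" for t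
    proof
      assume R0: "poly R t = 0"
      then have "poly ?L t = 0" by (simp add: R)
      then have "t \<in> lag_zeros n \<alpha>" using t by (simp add: lag_zeros_def poly_Lag)
      then have "poly (pderiv ?L) t = 0" using R0 Q0 by (simp add: R pderiv_mult)
      then show False using Lag_simple_zero[OF t \<open>poly ?L t = 0\<close>] by simp
    qed
    then have sgn: "(\<forall>t>0. 0 < poly R t) \<or> (\<forall>t>0. poly R t < 0)" by (rule poly_no_positive_root_sign)
    have "degree Q = card (lag_zeros n \<alpha>)"
      unfolding Q_def by (subst degree_prod_eq_sum_degree) auto
    then have "deg_lt n Q" using deg_lt_mono[OF deg_lt_degree, of Q n] less by simp
    from Lag_orthogonal[OF \<alpha> this]
    have 0: "integral halfline (\<lambda>t. poly (Q * Q * R) t * wt \<alpha> t) = 0"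
      by (simp add: ip_def R mult.assoc mult.left_commute mult.commute)
    have nz: "Q * Q * R \<noteq> 0" using R Lag_nonzero[of n \<alpha>] by auto
    show False using sgn
    proof
      assume "\<forall>t>0. 0 < poly R t"
      then have "0 < integral halfline (\<lambda>t. poly (Q * Q * R) t * wt \<alpha> t)"
        by (intro integral_poly_wt_pos \<alpha> nz) (simp add: less_imp_le)
      then show False using 0 by simp
    next
      assume neg: "\<forall>t>0. poly R t < 0"
      have "0 < integral halfline (\<lambda>t. poly (- (Q * Q * R)) t * wt \<alpha> t)"
        by (rule integral_poly_wt_pos[OF \<alpha>])
          (use nz neg in \<open>simp_all add: mult_nonneg_nonpos less_imp_le\<close>)
      then show False using 0 by simp
    qed
  qed
qed

subsection \<open>Spectral gap and interpolation\<close>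

lemma Lag_factorization:
  assumes \<alpha>: "-1 < \<alpha>"
  obtains c where "c \<noteq> 0" "Lag n \<alpha> = smult c (\<Prod>z\<in>lag_zeros n \<alpha>. [:- z, 1:])"
proof -
  let ?Q = "\<Prod>z\<in>lag_zeros n \<alpha>. [:- z, 1:]"
  have "?Q dvd Lag n \<alpha>"
    by (rule prod_roots_dvd[OF finite_lag_zeros]) (simp add: lag_zeros_def poly_Lag)
  then obtain R where R: "Lag n \<alpha> = ?Q * R" by (rule dvdE)
  have Q: "degree ?Q = n"
    by (subst degree_prod_eq_sum_degree) (auto simp: card_lag_zeros[OF \<alpha>])
  have nz: "R \<noteq> 0" "?Q \<noteq> 0" using Lag_nonzero[of n \<alpha>] R by auto
  have "n = n + degree R"
    using degree_mult_eq[OF nz(2,1)] Q degree_Lag[of n \<alpha>] R by simp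
  then have "degree R = 0" by simp
  then obtain c where "R = [:c:]" by (rule degree_eq_zeroE)
  then show ?thesis using R nz(1) by (intro that[of c]) simp_all
qed

lemma logarithmic_derivative_prod:
  fixes t :: real
  assumes "finite Z" "t \<notin> Z"
  shows "poly (pderiv (\<Prod>z\<in>Z. [:- z, 1:])) t = poly (\<Prod>z\<in>Z. [:- z, 1:]) t * (\<Sum>z\<in>Z. 1 / (t - z))"
  using assms
proof (induction Z rule: finite_induct)
  case (insert z Z)
  then have "t - z \<noteq> 0" by auto
  let ?P = "\<Prod>z\<in>Z. [:- z, 1:]" and ?S = "\<Sum>z\<in>Z. 1 / (t - z)"
  have "poly (pderiv ([:- z, 1:] * ?P)) t = poly ?P t + (t - z) * (poly ?P t * ?S)"
    using insert by (simp add: pderiv_mult pderiv_pCons del: mult_pCons_left)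
  also have "\<dots> = poly ([:- z, 1:] * ?P) t * (1 / (t - z) + ?S)"
    using \<open>t - z \<noteq> 0\<close> by (simp add: field_simps)
  finally show ?case using insert by (simp del: mult_pCons_left)
qed simp

text \<open>The partial fractions of L'/L have only simple poles, one at each zero. A function
  vanishing at the zeros can therefore absorb each term separately, as in
  \<open>continuous_on_square_divide\<close>.\<close>

lemma logarithmic_derivative_Lag:
  assumes \<alpha>: "-1 < \<alpha>" and t: "t \<notin> lag_zeros n \<alpha>"
  shows "poly (pderiv (Lag n \<alpha>)) t = poly (Lag n \<alpha>) t * (\<Sum>z\<in>lag_zeros n \<alpha>. 1 / (t - z))"
proof -
  obtain c where "Lag n \<alpha> = smult c (\<Prod>z\<in>lag_zeros n \<alpha>. [:- z, 1:])"
    by (rule Lag_factorization[OF \<alpha>])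
  then show ?thesis
    using logarithmic_derivative_prod[OF finite_lag_zeros t] by (simp add: pderiv_smult)
qed

text \<open>The eigenvalue equation \<open>laguerre_op_Lag\<close> in Sturm-Liouville form.\<close>

lemma Lag_weighted_derivative:
  assumes "0 < t"
  shows "((\<lambda>t. poly (pderiv (Lag n \<alpha>)) t * wt (\<alpha> + 1) t) has_real_derivative
    - real n * poly (Lag n \<alpha>) t * wt \<alpha> t) (at t)"
proof -
  let ?L = "Lag n \<alpha>"
  have e: "poly (laguerre_op \<alpha> ?L) t = real n * poly ?L t" by (simp add: laguerre_op_Lag)
  have "((\<lambda>t. poly (pderiv ?L) t * wt (\<alpha> + 1) t) has_real_derivative
     poly (pderiv (pderiv ?L)) t * wt (\<alpha> + 1) t + (\<alpha> + 1 - t) * wt \<alpha> t * poly (pderiv ?L) t) (at t)"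
    by (rule DERIV_mult[OF poly_DERIV has_derivative_wt[OF assms]])
  also have "poly (pderiv (pderiv ?L)) t * wt (\<alpha> + 1) t + (\<alpha> + 1 - t) * wt \<alpha> t * poly (pderiv ?L) t
     = - poly (laguerre_op \<alpha> ?L) t * wt \<alpha> t"
    unfolding wt_Suc[OF assms] laguerre_op_def adjoint_deriv_def by (simp add: algebra_simps)
  finally show ?thesis unfolding e by simp
qed

text \<open>The sum is \<open>L'/L\<close>, so this is the Riccati equation for \<open>\<rho> L'/L\<close> with \<open>\<rho> = w\<^sub>\<alpha>\<^sub>+\<^sub>1\<close>.\<close>

lemma Lag_riccati:
  assumes \<alpha>: "-1 < \<alpha>" and t: "0 < t" "t \<notin> lag_zeros n \<alpha>"
  shows "((\<lambda>t. wt (\<alpha> + 1) t * (\<Sum>z\<in>lag_zeros n \<alpha>. 1 / (t - z))) has_real_derivative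
    - real n * wt \<alpha> t - wt (\<alpha> + 1) t * (\<Sum>z\<in>lag_zeros n \<alpha>. 1 / (t - z))\<^sup>2) (at t)"
proof -
  let ?L = "Lag n \<alpha>" and ?g = "\<lambda>t. \<Sum>z\<in>lag_zeros n \<alpha>. 1 / (t - z)"
  have L: "poly ?L t \<noteq> 0" using t by (simp add: lag_zeros_def poly_Lag)
  have "((\<lambda>t. poly (pderiv ?L) t * wt (\<alpha> + 1) t / poly ?L t) has_real_derivative
      ((- real n * poly ?L t * wt \<alpha> t) * poly ?L t - (poly (pderiv ?L) t * wt (\<alpha> + 1) t) * poly (pderiv ?L) t) /
        (poly ?L t * poly ?L t)) (at t)"
    by (rule DERIV_divide[OF Lag_weighted_derivative[OF t(1)] poly_DERIV L])
  also have "((- real n * poly ?L t * wt \<alpha> t) * poly ?L t - (poly (pderiv ?L) t * wt (\<alpha> + 1) t) * poly (pderiv ?L) t) /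
        (poly ?L t * poly ?L t) = - real n * wt \<alpha> t - wt (\<alpha> + 1) t * (?g t)\<^sup>2"
    unfolding logarithmic_derivative_Lag[OF \<alpha> t(2)] using L by (simp add: field_simps power2_eq_square)
  finally show ?thesis
  proof (rule has_field_derivative_transform_within_open)
    show "open ({0<..} - lag_zeros n \<alpha>)" by (intro open_Diff finite_imp_closed finite_lag_zeros) simp
    show "t \<in> {0<..} - lag_zeros n \<alpha>" using t by simp
    fix s assume s: "s \<in> {0<..} - lag_zeros n \<alpha>"
    then have "poly ?L s \<noteq> 0" by (simp add: lag_zeros_def poly_Lag)
    then show "poly (pderiv ?L) s * wt (\<alpha> + 1) s / poly ?L s = wt (\<alpha> + 1) s * ?g s"
      using s logarithmic_derivative_Lag[OF \<alpha>, of s n] by simp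
  qed
qed

section \<open>The inequality for functions vanishing at the zeros\<close>

text \<open>This glues estimates that are proved only between consecutive poles. The exceptional
  points are removed one at a time: the inequality on each side of such a point extends to it by
  continuity.\<close>

lemma mono_off_finite_set:
  fixes D :: "real \<Rightarrow> real"
  assumes "finite Z" and D: "continuous_on halfline D"
    and "\<And>a b. 0 < a \<Longrightarrow> a \<le> b \<Longrightarrow> Z \<inter> {a..b} = {} \<Longrightarrow> D a \<le> D b"
    and "0 < a" "a \<le> b"
  shows "D a \<le> D b"
  using assms(1,3-)
proof (induction Z arbitrary: a b rule: finite_induct)
  case empty
  then show ?case by simp
next
  case (insert z Z)
  show ?case
  proof (rule insert.IH[OF _ insert.prems(2,3)])
    fix a b :: real assume ab: "0 < a" "a \<le> b" "Z \<inter> {a..b} = {}"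
    show "D a \<le> D b"
    proof (cases "z \<in> {a..b}")
      case False
      then show ?thesis using insert.prems(1)[OF ab(1,2)] ab(3) by simp
    next
      case True
      have "D a \<le> D z"
      proof (cases "a = z")
        case False
        then have az: "a < z" using True by simp
        have "closure {a..<z} = {a..z}" using az by simp
        moreover have "continuous_on {a..z} D" by (rule continuous_on_subset[OF D]) (use ab in auto)
        moreover have "D a \<le> D s" if "s \<in> {a..<z}" for s
          by (rule insert.prems(1)) (use that ab True in auto)
        ultimately show ?thesis
          using continuous_ge_on_closure[of "{a..<z}" D z "D a"] az by simp
      qed simp
      moreover have "D z \<le> D b"
      proof (cases "b = z")
        case False
        then have zb: "z < b" using True by simp
        have "closure {z<..b} = {z..b}" using zb by simp
        moreover have "continuous_on {z..b} D" by (rule continuous_on_subset[OF D]) (use ab True in auto)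
        moreover have "D s \<le> D b" if "s \<in> {z<..b}" for s
          by (rule insert.prems(1)) (use that ab True in auto)
        ultimately show ?thesis
          using continuous_le_on_closure[of "{z<..b}" D z "D b"] zb by simp
      qed simp
      ultimately show ?thesis by simp
    qed
  qed
qed

text \<open>Cauchy-Schwarz against the constant 1, from nonnegativity of the integral of (f - m)
  squared, where m is the mean of f.\<close>

lemma square_integral_le:
  fixes f :: "real \<Rightarrow> real"
  assumes f: "f integrable_on {a..b}" and f2: "(\<lambda>t. (f t)\<^sup>2) integrable_on {a..b}" and ab: "a \<le> b"
  shows "(integral {a..b} f)\<^sup>2 \<le> (b - a) * integral {a..b} (\<lambda>t. (f t)\<^sup>2)"
proof (cases "a = b")
  case False
  define d m where "d = b - a" and "m = integral {a..b} f / d"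
  have d: "0 < d" using False ab by (simp add: d_def)
  have i: "(\<lambda>t. (f t)\<^sup>2 - (2 * m * f t - m\<^sup>2)) integrable_on {a..b}"
    by (intro integrable_diff f2 integrable_on_mult_right f) auto
  have "0 \<le> integral {a..b} (\<lambda>t. (f t)\<^sup>2 - (2 * m * f t - m\<^sup>2))"
  proof (rule integral_nonneg[OF i])
    fix t
    have "(f t)\<^sup>2 - (2 * m * f t - m\<^sup>2) = (f t - m)\<^sup>2" by (simp add: power2_diff)
    then show "0 \<le> (f t)\<^sup>2 - (2 * m * f t - m\<^sup>2)" by simp
  qed
  also have "\<dots> = integral {a..b} (\<lambda>t. (f t)\<^sup>2) - integral {a..b} (\<lambda>t. 2 * m * f t - m\<^sup>2)"
    by (rule Henstock_Kurzweil_Integration.integral_diff) (auto intro!: integrable_diff f2 integrable_on_mult_right f)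
  also have "integral {a..b} (\<lambda>t. 2 * m * f t - m\<^sup>2) = integral {a..b} (\<lambda>t. 2 * m * f t) - integral {a..b} (\<lambda>t. m\<^sup>2)"
    by (rule Henstock_Kurzweil_Integration.integral_diff) (auto intro!: integrable_on_mult_right f)
  also have "integral {a..b} (\<lambda>t. m\<^sup>2) = d * m\<^sup>2" using ab by (simp add: d_def)
  also have "integral {a..b} (\<lambda>t. 2 * m * f t) = 2 * m * (m * d)" using d by (simp add: m_def)
  finally have "m\<^sup>2 * d \<le> integral {a..b} (\<lambda>t. (f t)\<^sup>2)" by (simp add: power2_eq_square mult.commute)
  then have "d * (m\<^sup>2 * d) \<le> d * integral {a..b} (\<lambda>t. (f t)\<^sup>2)" using d by (intro mult_left_mono) auto
  moreover have "d * (m\<^sup>2 * d) = (integral {a..b} f)\<^sup>2" using d by (simp add: m_def power2_eq_square)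
  ultimately show ?thesis by (simp add: d_def)
qed simp

lemma L2_square_integrable_on_Icc:
  assumes "L2 \<alpha> f" "0 < a" shows "(\<lambda>t. (f t)\<^sup>2) integrable_on {a..b}"
proof -
  have "(\<lambda>t. (f t)\<^sup>2 * wt \<alpha> t) absolutely_integrable_on {a..b}"
    by (rule absolutely_integrable_on_subinterval[OF L2_integrable(1)[OF assms(1)]]) (use assms(2) in auto)
  moreover have "continuous_on {a..b} (\<lambda>t. 1 / wt \<alpha> t)"
  proof (intro continuous_intros continuous_on_subset[OF continuous_on_wt] ballI)
    show "wt \<alpha> t \<noteq> 0" if "t \<in> {a..b}" for t
      using wt_pos[of t \<alpha>] that assms(2) by auto
  qed (use assms(2) in auto)
  ultimately have "(\<lambda>t. (f t)\<^sup>2 * wt \<alpha> t * (1 / wt \<alpha> t)) absolutely_integrable_on {a..b}"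
    by (rule absolutely_integrable_mult_continuous(1))
  then have "(\<lambda>t. (f t)\<^sup>2 * wt \<alpha> t * (1 / wt \<alpha> t)) integrable_on {a..b}"
    by (simp add: absolutely_integrable_on_def)
  then show ?thesis
  proof (rule integrable_eq)
    fix t assume "t \<in> {a..b}"
    then have "wt \<alpha> t \<noteq> 0" using wt_pos[of t \<alpha>] assms(2) by auto
    then show "(f t)\<^sup>2 * wt \<alpha> t * (1 / wt \<alpha> t) = (f t)\<^sup>2" by simp
  qed
qed

text \<open>Near \<open>z\<close> the quotient is at most \<open>\<integral> f\<^sup>2\<close> between \<open>z\<close> and \<open>t\<close>; at \<open>z\<close> itself it is
  \<open>0 / 0 = 0\<close>.\<close>

lemma continuous_on_square_divide:
  assumes F: "ac_deriv F f" and f: "L2 \<alpha> f" and z: "0 < z" "F z = 0"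
  shows "continuous_on halfline (\<lambda>t. (F t)\<^sup>2 / (t - z))"
  unfolding continuous_on_eq_continuous_at[OF open_greaterThan]
proof
  fix t :: real assume t: "t \<in> halfline"
  show "isCont (\<lambda>t. (F t)\<^sup>2 / (t - z)) t"
  proof (cases "t = z")
    case False
    have "isCont F t"
      using ac_deriv_continuous[OF F] t continuous_on_eq_continuous_at[OF open_greaterThan] by blast
    then show ?thesis using False by (intro continuous_intros) auto
  next
    case True
    let ?a = "z / 2" and ?b = "2 * z"
    let ?J = "\<lambda>t. integral {?a..t} (\<lambda>t. (f t)\<^sup>2)"
    have f2: "(\<lambda>t. (f t)\<^sup>2) integrable_on {?a..?b}" by (rule L2_square_integrable_on_Icc[OF f]) (use z in simp)
    have cJ: "continuous_on {?a..?b} ?J" by (rule indefinite_integral_continuous_1[OF f2])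
    have bound: "\<bar>(F t)\<^sup>2 / (t - z)\<bar> \<le> \<bar>?J t - ?J z\<bar>" if t: "t \<in> {?a..?b}" for t
    proof -
      have Q: "(F u - F s)\<^sup>2 \<le> (u - s) * (?J u - ?J s)" if su: "?a \<le> s" "s \<le> u" "u \<le> ?b" for s u
      proof -
        have s0: "0 < s" using su z by simp
        have J: "?J s + integral {s..u} (\<lambda>t. (f t)\<^sup>2) = ?J u"
          by (rule Henstock_Kurzweil_Integration.integral_combine)
            (use su integrable_subinterval_real[OF f2] in auto)
        show ?thesis
          unfolding ac_derivD(2)[OF F s0 su(2)] J[symmetric]
          using square_integral_le[OF ac_derivD(3)[OF F s0 su(2)] L2_square_integrable_on_Icc[OF f s0] su(2)]
          by simp
      qed
      consider "t < z" | "t = z" | "z < t" by linarith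
      then show ?thesis
      proof cases
        case 1
        then have "(F t)\<^sup>2 \<le> (z - t) * (?J z - ?J t)" using Q[of t z] t z by simp
        then have "(F t)\<^sup>2 / (z - t) \<le> ?J z - ?J t" using 1 by (simp add: divide_le_eq mult.commute)
        then show ?thesis using 1 by (simp add: abs_div)
      next
        case 2
        then show ?thesis by simp
      next
        case 3
        then have "(F t)\<^sup>2 \<le> (t - z) * (?J t - ?J z)" using Q[of z t] t z by simp
        then have "(F t)\<^sup>2 / (t - z) \<le> ?J t - ?J z" using 3 by (simp add: divide_le_eq mult.commute)
        then show ?thesis using 3 by (simp add: abs_div)
      qed
    qed
    have "isCont ?J z" by (rule continuous_on_interior[OF cJ]) (use z in simp)
    then have "isCont (\<lambda>t. \<bar>?J t - ?J z\<bar>) z" by (intro continuous_intros)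
    then have l: "((\<lambda>t. \<bar>?J t - ?J z\<bar>) \<longlongrightarrow> 0) (at z)" by (simp add: isCont_def)
    have "eventually (\<lambda>t. t \<in> {?a<..<?b}) (at z)"
      by (rule eventually_at_in_open') (use z in auto)
    then have "eventually (\<lambda>t. norm ((F t)\<^sup>2 / (t - z)) \<le> \<bar>?J t - ?J z\<bar>) (at z)"
      by eventually_elim (use bound in auto)
    from Lim_null_comparison[OF this l] show ?thesis using True by (simp add: isCont_def)
  qed
qed

text \<open>By the Riccati equation the nonnegative square equals s - B' between the zeros, with B =
  \<open>F\<^sup>2\<close> \<rho> L'/L and \<rho> = \<open>wt (\<alpha> + 1)\<close>. The zeros of F
  make B continuous across the poles, so its increments are bounded by the integral of s on every
  compact interval. At both ends B is dominated by a function E with E / t integrable, so B tends to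
  0 along suitable endpoints.\<close>

lemma sq_le_of_vanishing_at_zeros:
  assumes \<alpha>: "-1 < \<alpha>" and F: "ac_deriv F f" "L2 \<alpha> F" and f: "L2 (\<alpha> + 1) f"
    and Fz: "\<And>z. z \<in> lag_zeros n \<alpha> \<Longrightarrow> F z = 0"
  shows "real n * sq \<alpha> F \<le> sq (\<alpha> + 1) f"
proof -
  define Z where "Z = lag_zeros n \<alpha>"
  have Z: "finite Z" and Zpos: "\<And>z. z \<in> Z \<Longrightarrow> 0 < z"
    using finite_lag_zeros by (auto simp: Z_def lag_zeros_def)
  define g where "g t = (\<Sum>z\<in>Z. 1 / (t - z))" for t
  define B where "B t = (F t)\<^sup>2 * (wt (\<alpha> + 1) t * g t)" for t
  define s where "s t = (f t)\<^sup>2 * wt (\<alpha> + 1) t - real n * ((F t)\<^sup>2 * wt \<alpha> t)" for t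
  have s_int: "s absolutely_integrable_on halfline"
    unfolding s_def[abs_def] by (intro set_integral_diff(1) L2_integrable(1) f F(2) set_integrable_mult_right)
  have s_Icc: "s absolutely_integrable_on {a..b}" if "0 < a" for a b
    by (rule absolutely_integrable_on_subinterval[OF s_int]) (use that in auto)
  have s_Icc': "s integrable_on {a..b}" if "0 < a" for a b
    using s_Icc[OF that] by (simp add: absolutely_integrable_on_def)
  have F2: "ac_deriv (\<lambda>t. F t * F t) (\<lambda>t. f t * F t + F t * f t)"
    by (rule ac_deriv_mult[OF F(1) F(1)])
  have local: "B b - B a \<le> integral {a..b} s" if ab: "0 < a" "a \<le> b" "Z \<inter> {a..b} = {}" for a b
  proof -
    let ?h = "\<lambda>t. wt (\<alpha> + 1) t * g t"
    let ?h' = "\<lambda>t. - real n * wt \<alpha> t - wt (\<alpha> + 1) t * (g t)\<^sup>2"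
    have dh: "(?h has_real_derivative ?h' t) (at t)" if "t \<in> {a..b}" for t
      unfolding g_def[abs_def] Z_def
      by (rule Lag_riccati[OF \<alpha>]) (use that ab in \<open>auto simp: Z_def\<close>)
    have cg: "continuous_on {a..b} g"
      unfolding g_def[abs_def] by (intro continuous_intros) (use ab in auto)
    have cw: "continuous_on {a..b} (wt \<beta>)" for \<beta>
      by (rule continuous_on_subset[OF continuous_on_wt]) (use ab in auto)
    have ch: "?h' absolutely_integrable_on {a..b}"
      by (intro absolutely_integrable_continuous_real continuous_intros cg cw)
    have h: "?h t - ?h a = integral {a..t} ?h'" if "t \<in> {a..b}" for t
      by (rule integral_unique[symmetric], rule fundamental_theorem_of_calculus)
        (use that dh in \<open>auto simp: has_real_derivative_iff_has_vector_derivative[symmetric] intro: has_field_derivative_at_within\<close>)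
    have FF: "F t * F t - F a * F a = integral {a..t} (\<lambda>t. f t * F t + F t * f t)" if "t \<in> {a..b}" for t
      by (rule ac_derivD(2)[OF F2 ab(1)]) (use that in auto)
    note P = product_rule_absolutely_integrable[OF ac_derivD(1)[OF F2 ab(1,2)] ch FF h ab(2)]
    have "B b - B a = integral {a..b} (\<lambda>t. (f t * F t + F t * f t) * ?h t + F t * F t * ?h' t)"
      using P(2) by (simp add: B_def power2_eq_square)
    also have "\<dots> \<le> integral {a..b} s"
    proof (rule integral_le)
      show "(\<lambda>t. (f t * F t + F t * f t) * ?h t + F t * F t * ?h' t) integrable_on {a..b}"
        using P(1) by (simp add: absolutely_integrable_on_def)
      show "s integrable_on {a..b}" by (rule s_Icc'[OF ab(1)])
      fix t assume t: "t \<in> {a..b}"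
      have "s t - ((f t * F t + F t * f t) * ?h t + F t * F t * ?h' t)
          = wt (\<alpha> + 1) t * (f t - F t * g t)\<^sup>2"
        by (simp add: s_def power2_eq_square algebra_simps)
      moreover have "0 \<le> wt (\<alpha> + 1) t * (f t - F t * g t)\<^sup>2" by simp
      ultimately show "(f t * F t + F t * f t) * ?h t + F t * F t * ?h' t \<le> s t" by linarith
    qed
    finally show ?thesis .
  qed
  have cB: "continuous_on halfline B"
  proof -
    have "continuous_on halfline (\<lambda>t. wt (\<alpha> + 1) t * (\<Sum>z\<in>Z. (F t)\<^sup>2 / (t - z)))"
      by (intro continuous_intros continuous_on_wt continuous_on_square_divide[OF F(1) f])
        (use Zpos Fz in \<open>auto simp: Z_def\<close>)
    then show ?thesis by (simp add: B_def[abs_def] g_def sum_distrib_left mult.commute)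
  qed
  have mono: "B b - B a \<le> integral {a..b} s" if ab: "0 < a" "a \<le> b" for a b
  proof -
    obtain S where S: "ac_deriv S s"
      by (rule ex_ac_deriv) (rule s_Icc)
    have "S a - B a \<le> S b - B b"
    proof (rule mono_off_finite_set[OF Z _ _ ab])
      show "continuous_on halfline (\<lambda>t. S t - B t)"
        by (intro continuous_intros cB ac_deriv_continuous[OF S])
      fix a b :: real assume "0 < a" "a \<le> b" "Z \<inter> {a..b} = {}"
      then show "S a - B a \<le> S b - B b" using local[of a b] ac_derivD(2)[OF S, of a b] by simp
    qed
    then show ?thesis using ac_derivD(2)[OF S ab] by simp
  qed
  \<comment> \<open>Away from the zeros the sum is bounded: at distance at least z / 2 from z the
    term 1 / (t - z) is at most 2 / z in absolute value. This covers all t close enough to 0 and all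
    t large enough.\<close>
  define C where "C = (\<Sum>z\<in>Z. 2 / z)"
  have g_le: "\<bar>g t\<bar> \<le> C" if "\<And>z. z \<in> Z \<Longrightarrow> z / 2 \<le> \<bar>t - z\<bar>" for t
    unfolding g_def C_def
  proof (rule order_trans[OF sum_abs], rule sum_mono)
    fix z assume z: "z \<in> Z"
    have "1 / \<bar>t - z\<bar> \<le> 1 / (z / 2)"
      by (rule frac_le) (use that[OF z] Zpos[OF z] in auto)
    then show "\<bar>1 / (t - z)\<bar> \<le> 2 / z" by (simp add: abs_div)
  qed
  define E where "E t = C * ((F t)\<^sup>2 * wt (\<alpha> + 1) t)" for t
  have BE: "norm (B t) \<le> E t" if "\<And>z. z \<in> Z \<Longrightarrow> z / 2 \<le> \<bar>t - z\<bar>" for t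
  proof -
    have "\<bar>g t\<bar> * ((F t)\<^sup>2 * wt (\<alpha> + 1) t) \<le> C * ((F t)\<^sup>2 * wt (\<alpha> + 1) t)"
      by (rule mult_right_mono[OF g_le[OF that]]) auto
    then show ?thesis by (simp add: B_def E_def abs_mult mult.commute mult.left_commute)
  qed
  have "(\<lambda>t. C * ((F t)\<^sup>2 * wt \<alpha> t)) absolutely_integrable_on halfline"
    by (intro set_integrable_mult_right L2_integrable(1) F(2))
  then have "(\<lambda>t. E t / t) absolutely_integrable_on halfline"
    by (rule absolutely_integrable_spike[OF _ negligible_empty]) (simp add: E_def wt_Suc)
  then obtain p q :: "nat \<Rightarrow> real" where pq: "\<And>n. 0 < p n" "\<And>n. p n \<le> 1 / Suc n" "\<And>n. Suc n \<le> q n"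
    "(\<lambda>n. E (p n)) \<longlonglongrightarrow> 0" "(\<lambda>n. E (q n)) \<longlonglongrightarrow> 0"
    by (rule vanishing_sequences) blast
  have lp: "(\<lambda>n. 1 / real (Suc n)) \<longlonglongrightarrow> 0"
    using LIMSEQ_inverse_real_of_nat by (simp add: inverse_eq_divide)
  have "eventually (\<lambda>n. norm (B (p n)) \<le> E (p n)) sequentially"
  proof -
    have "eventually (\<lambda>n. \<forall>z\<in>Z. 1 / real (Suc n) < z / 2) sequentially"
    proof (rule eventually_ball_finite[OF Z], rule ballI)
      fix z assume "z \<in> Z"
      then show "eventually (\<lambda>n. 1 / real (Suc n) < z / 2) sequentially"
        by (intro order_tendstoD(2)[OF lp]) (simp add: Zpos)
    qed
    then show ?thesis
    proof eventually_elim
      case (elim n)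
      show ?case
      proof (rule BE)
        fix z assume "z \<in> Z"
        then have "1 / real (Suc n) < z / 2" using elim by blast
        then show "z / 2 \<le> \<bar>p n - z\<bar>" using pq(2)[of n] by linarith
      qed
    qed
  qed
  then have Bp: "(\<lambda>n. B (p n)) \<longlonglongrightarrow> 0" using pq(4) by (rule Lim_null_comparison)
  have "eventually (\<lambda>n. norm (B (q n)) \<le> E (q n)) sequentially"
  proof -
    have "eventually (\<lambda>n. \<forall>z\<in>Z. 2 * z \<le> real (Suc n)) sequentially"
    proof (rule eventually_ball_finite[OF Z], rule ballI)
      fix z
      show "eventually (\<lambda>n. 2 * z \<le> real (Suc n)) sequentially"
        by (rule eventually_sequentiallyI[of "nat \<lceil>2 * z\<rceil>"]) linarith
    qed
    then show ?thesis
    proof eventually_elim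
      case (elim n)
      show ?case
      proof (rule BE)
        fix z assume z: "z \<in> Z"
        then have "2 * z \<le> real (Suc n)" using elim by blast
        then show "z / 2 \<le> \<bar>q n - z\<bar>" using pq(3)[of n] Zpos[OF z] by linarith
      qed
    qed
  qed
  then have Bq: "(\<lambda>n. B (q n)) \<longlonglongrightarrow> 0" using pq(5) by (rule Lim_null_comparison)
  have le: "p n \<le> q n" for n
  proof -
    have "1 / real (Suc n) \<le> 1" by (simp add: divide_simps)
    then show ?thesis using pq(2,3)[of n] by linarith
  qed
  have "0 - 0 \<le> integral halfline s"
  proof (rule LIMSEQ_le)
    show "(\<lambda>n. B (q n) - B (p n)) \<longlonglongrightarrow> 0 - 0" by (intro tendsto_diff Bp Bq)
    show "(\<lambda>n. integral {p n..q n} s) \<longlonglongrightarrow> integral halfline s"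
      by (rule integral_exhaust_halfline[OF s_int pq(1-3)])
    show "\<exists>N. \<forall>n\<ge>N. B (q n) - B (p n) \<le> integral {p n..q n} s"
      using mono[OF pq(1) le] by blast
  qed
  also have "integral halfline s = sq (\<alpha> + 1) f - real n * sq \<alpha> F"
    unfolding s_def[abs_def] sq_def
    by (subst Henstock_Kurzweil_Integration.integral_diff)
      (auto intro!: integrable_on_mult_right L2_integrable(2) f F)
  finally show ?thesis by simp
qed

section \<open>Errors of projection and interpolation\<close>

lemma ex_interpolation:
  fixes F :: "real \<Rightarrow> real"
  assumes "finite Z"
  shows "\<exists>q. deg_lt (card Z) q \<and> (\<forall>z\<in>Z. poly q z = F z)"
  using assms
proof (induction Z rule: finite_induct)
  case empty
  show ?case by (intro exI[of _ 0]) simp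
next
  case (insert z Z)
  then obtain q where q: "deg_lt (card Z) q" "\<forall>w\<in>Z. poly q w = F w" by blast
  let ?P = "\<Prod>w\<in>Z. [:- w, 1:]"
  define c where "c = (F z - poly q z) / poly ?P z"
  have "poly ?P z \<noteq> 0" using insert.hyps by (auto simp: poly_prod)
  then have z: "poly (q + smult c ?P) z = F z" by (simp add: c_def)
  have w: "poly (q + smult c ?P) w = F w" if "w \<in> Z" for w
    using that q(2) insert.hyps by (auto simp: poly_prod)
  have "degree ?P = card Z" by (subst degree_prod_eq_sum_degree) auto
  then have "deg_lt (Suc (card Z)) ?P" using deg_lt_degree[of ?P] by simp
  then have "deg_lt (card (insert z Z)) (q + smult c ?P)"
    using insert.hyps by (auto intro!: deg_lt_add deg_lt_smult deg_lt_mono[OF q(1)])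
  then show ?case using z w by blast
qed

lemma deg_lt_adjoint_deriv: "deg_lt n p \<Longrightarrow> deg_lt (Suc n) (adjoint_deriv \<alpha> p)"
  unfolding deg_lt_def
proof (intro allI impI)
  fix k assume "\<forall>k\<ge>n. coeff p k = 0" "Suc n \<le> k"
  then show "coeff (adjoint_deriv \<alpha> p) k = 0"
    by (cases k) (simp_all add: adjoint_deriv_def coeff_pderiv coeff_pCons)
qed

text \<open>The adjoint of the derivative raises the degree of a test polynomial by one, so one
  degree of orthogonality is lost while the exponent grows by one.\<close>

lemma orth_deriv:
  assumes \<alpha>: "-1 < \<alpha>" and F: "ac_deriv F f" "L2 \<alpha> F" and f: "L2 (\<alpha> + 1) f" and o: "orth \<alpha> (Suc n) F"
  shows "orth (\<alpha> + 1) n f"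
  unfolding orth_def
proof (intro allI impI)
  fix p assume "deg_lt n p"
  then show "ip (\<alpha> + 1) f (poly p) = 0"
    using ip_deriv[OF \<alpha> F f, of p] o deg_lt_adjoint_deriv by (simp add: orth_def)
qed

text \<open>With \<open>E(G) = \<parallel>G'\<parallel>\<^sup>2 - n \<parallel>G\<parallel>\<^sup>2\<close>, orthogonality splits \<open>E(F - q) = E(F) + E(q)\<close>. Here
  \<open>E(F - q) \<ge> 0\<close> because \<open>F - q\<close> vanishes at the zeros of the Laguerre polynomial, and
  \<open>E(q) \<le> - \<parallel>q\<parallel>\<^sup>2\<close> because \<open>q\<close> has degree at most \<open>n - 1\<close>.\<close>

lemma sq_interpolant_le:
  assumes \<alpha>: "-1 < \<alpha>" and F: "ac_deriv F f" "L2 \<alpha> F" and f: "L2 (\<alpha> + 1) f" and o: "orth \<alpha> n F"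
    and q: "deg_lt n q" "\<And>z. z \<in> lag_zeros n \<alpha> \<Longrightarrow> poly q z = F z"
  shows "sq \<alpha> (poly q) + real n * sq \<alpha> F \<le> sq (\<alpha> + 1) f"
proof (cases n)
  case 0
  then show ?thesis using q(1) sq_nonneg[of "\<alpha> + 1" f] by (simp add: deg_lt_0_iff sq_def)
next
  case (Suc k)
  have L2q: "L2 \<alpha> (poly q)" "L2 (\<alpha> + 1) (poly (pderiv q))" using \<alpha> by (auto intro: L2_poly)
  have "real n * sq \<alpha> (\<lambda>t. F t - poly q t) \<le> sq (\<alpha> + 1) (\<lambda>t. f t - poly (pderiv q) t)"
    by (rule sq_le_of_vanishing_at_zeros[OF \<alpha>])
      (use q(2) in \<open>auto intro!: ac_deriv_diff ac_deriv_poly L2_diff F f L2q\<close>)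
  moreover have "ip \<alpha> F (poly q) = 0" using o q(1) by (simp add: orth_def)
  \<comment> \<open>Moving the derivative off \<open>f\<close> turns this into the inner product of
    F with \<open>laguerre_op \<alpha> q\<close>, whose degree is no larger than that of q.\<close>
  moreover have "ip (\<alpha> + 1) f (poly (pderiv q)) = 0"
    using ip_laguerre_op[OF \<alpha> F f, of q] o deg_lt_laguerre_op[OF q(1)] by (simp add: orth_def)
  moreover have "sq (\<alpha> + 1) (poly (pderiv q)) \<le> real k * sq \<alpha> (poly q)"
    using q(1) by (intro sq_pderiv_le \<alpha>) (simp add: Suc)
  ultimately show ?thesis
    unfolding sq_diff[OF F(2) L2q(1)] sq_diff[OF f L2q(2)] by (simp add: Suc algebra_simps)
qed

text \<open>The gap on the orthogonal complement: F is interpolated at the Laguerre zeros and the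
  nonnegative term of the interpolant is dropped, in place of a Laguerre expansion of F.\<close>

lemma sq_le_of_orth:
  assumes \<alpha>: "-1 < \<alpha>" and F: "ac_deriv F f" "L2 \<alpha> F" and f: "L2 (\<alpha> + 1) f" and o: "orth \<alpha> n F"
  shows "real n * sq \<alpha> F \<le> sq (\<alpha> + 1) f"
proof -
  obtain q where "deg_lt n q" "\<forall>z\<in>lag_zeros n \<alpha>. poly q z = F z"
    using ex_interpolation[OF finite_lag_zeros, of n \<alpha> F] card_lag_zeros[OF \<alpha>, of n] by auto
  then have "sq \<alpha> (poly q) + real n * sq \<alpha> F \<le> sq (\<alpha> + 1) f"
    by (intro sq_interpolant_le assms) auto
  then show ?thesis using sq_nonneg[of \<alpha> "poly q"] by linarith
qed

text \<open>The derivative of the projection error is again a projection error, for exponent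
  \<alpha> + 1 and degree bound n - 1. The gaps n, n - 1, ..., n - m + 1 therefore multiply to n! /
  (n - m)!.\<close>

lemma projection_error_le:
  assumes "-1 < \<alpha>" and "\<And>r. r < m \<Longrightarrow> ac_deriv (c r) (c (Suc r))"
    and "\<And>r. r \<le> m \<Longrightarrow> L2 (\<alpha> + real r) (c r)"
    and "m \<le> n" "deg_lt n p" "orth \<alpha> n (\<lambda>t. c 0 t - poly p t)"
  shows "sq \<alpha> (\<lambda>t. c 0 t - poly p t) \<le> fact (n - m) / fact n * sq (\<alpha> + real m) (c m)"
  using assms
proof (induction m arbitrary: n \<alpha> c p)
  case 0
  then have "sq \<alpha> (\<lambda>t. c 0 t - poly p t) \<le> sq \<alpha> (\<lambda>t. c 0 t - poly 0 t)"
    by (intro sq_best_approximation) auto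
  then show ?case by simp
next
  case (Suc m)
  obtain k where n: "n = Suc k" "m \<le> k" using Suc.prems(4) by (cases n) auto
  have c0: "L2 \<alpha> (c 0)" "L2 (\<alpha> + 1) (c 1)" "ac_deriv (c 0) (c 1)"
    using Suc.prems(3)[of 0] Suc.prems(3)[of 1] Suc.prems(2)[of 0] by auto
  let ?F = "\<lambda>t. c 0 t - poly p t" and ?f = "\<lambda>t. c 1 t - poly (pderiv p) t"
  have F: "ac_deriv ?F ?f" "L2 \<alpha> ?F" "L2 (\<alpha> + 1) ?f"
    using c0 Suc.prems(1) by (auto intro!: ac_deriv_diff ac_deriv_poly L2_diff L2_poly)
  have "orth (\<alpha> + 1) k ?f"
    by (rule orth_deriv[OF Suc.prems(1) F]) (use Suc.prems(6) in \<open>simp add: n\<close>)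
  moreover have "L2 (\<alpha> + 1 + real r) (c (Suc r))" if "r \<le> m" for r
    using Suc.prems(3)[of "Suc r"] that by (simp add: add.assoc add.commute[of 1])
  moreover have "deg_lt k (pderiv p)" using Suc.prems(5) by (simp add: n(1) deg_lt_pderiv)
  ultimately have IH: "sq (\<alpha> + 1) ?f \<le> fact (k - m) / fact k * sq (\<alpha> + 1 + real m) (c (Suc m))"
    using Suc.IH[of "\<alpha> + 1" "\<lambda>r. c (Suc r)" k "pderiv p"] Suc.prems(1,2) n(2) by simp
  have "real n * sq \<alpha> ?F \<le> sq (\<alpha> + 1) ?f"
    by (rule sq_le_of_orth[OF Suc.prems(1) F Suc.prems(6)])
  then have "sq \<alpha> ?F \<le> sq (\<alpha> + 1) ?f / real n" by (simp add: n(1) field_simps)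
  also have "\<dots> \<le> fact (k - m) / fact k * sq (\<alpha> + 1 + real m) (c (Suc m)) / real n"
    by (rule divide_right_mono[OF IH]) simp
  finally show ?case by (simp add: n(1) field_simps add.commute add.left_commute)
qed

text \<open>Here n plays the role of M, with n + 1 nodes. The error is the interpolant of the
  projection error minus that error, two orthogonal pieces jointly bounded by the derivative of the
  projection error. The first bound then applies the remaining m - 1 gaps to this derivative; the
  second compares it with an arbitrary constant, which serves the case M = 1, m = 2.\<close>

lemma interpolation_error_le:
  assumes \<alpha>: "-1 < \<alpha>" and c: "\<And>r. r < m \<Longrightarrow> ac_deriv (c r) (c (Suc r))"
    "\<And>r. r \<le> m \<Longrightarrow> L2 (\<alpha> + real r) (c r)"
    and m: "1 \<le> m" "m \<le> Suc n"
    and I: "deg_lt (Suc n) I" "\<And>z. z \<in> lag_zeros (Suc n) \<alpha> \<Longrightarrow> poly I z = c 0 z"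
  shows "sq \<alpha> (\<lambda>t. poly I t - c 0 t) \<le> fact (Suc n - m) / fact n * sq (\<alpha> + real m) (c m)"
    and "1 \<le> n \<Longrightarrow> sq \<alpha> (\<lambda>t. poly I t - c 0 t) \<le> sq (\<alpha> + 1) (\<lambda>t. c 1 t - d)"
proof -
  have c0: "L2 \<alpha> (c 0)" "L2 (\<alpha> + 1) (c 1)" "ac_deriv (c 0) (c 1)"
    using c(2)[of 0] c(2)[of 1] c(1)[of 0] m by auto
  obtain p where p: "deg_lt (Suc n) p" "orth \<alpha> (Suc n) (\<lambda>t. c 0 t - poly p t)"
    using ex_orthogonal_projection[OF \<alpha> c0(1)] by blast
  let ?F = "\<lambda>t. c 0 t - poly p t" and ?f = "\<lambda>t. c 1 t - poly (pderiv p) t"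
  have F: "ac_deriv ?F ?f" "L2 \<alpha> ?F" "L2 (\<alpha> + 1) ?f"
    using c0 \<alpha> by (auto intro!: ac_deriv_diff ac_deriv_poly L2_diff L2_poly)
  have q: "deg_lt (Suc n) (I - p)" using I p by (intro deg_lt_diff)
  have "sq \<alpha> (poly (I - p)) + real (Suc n) * sq \<alpha> ?F \<le> sq (\<alpha> + 1) ?f"
    by (rule sq_interpolant_le[OF \<alpha> F p(2) q]) (use I(2) in simp)
  moreover have "sq \<alpha> ?F \<le> real (Suc n) * sq \<alpha> ?F"
    using sq_nonneg[of \<alpha> ?F] by (simp add: distrib_right)
  moreover have "sq \<alpha> (\<lambda>t. poly I t - c 0 t) = sq \<alpha> (poly (I - p)) + sq \<alpha> ?F"
  proof -
    have "(\<lambda>t. poly I t - c 0 t) = (\<lambda>t. poly (I - p) t - ?F t)" by (simp add: fun_eq_iff)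
    moreover have "ip \<alpha> (poly (I - p)) ?F = 0"
      using p(2) q by (simp add: orth_def ip_commute[of \<alpha> "poly (I - p)"])
    ultimately show ?thesis using sq_diff[OF L2_poly[OF \<alpha>] F(2), of "I - p"] by simp
  qed
  ultimately have main: "sq \<alpha> (\<lambda>t. poly I t - c 0 t) \<le> sq (\<alpha> + 1) ?f" by linarith
  have o1: "orth (\<alpha> + 1) n ?f" by (rule orth_deriv[OF \<alpha> F p(2)])
  have dp: "deg_lt n (pderiv p)" by (rule deg_lt_pderiv[OF p(1)])
  obtain k where k: "m = Suc k" using m by (cases m) auto
  have "sq (\<alpha> + 1) ?f \<le> fact (n - k) / fact n * sq (\<alpha> + 1 + real k) (c (Suc k))"
  proof -
    have "L2 (\<alpha> + 1 + real r) (c (Suc r))" if "r \<le> k" for r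
      using c(2)[of "Suc r"] that k by (simp add: add.assoc add.commute[of 1])
    then show ?thesis
      using projection_error_le[of "\<alpha> + 1" k "\<lambda>r. c (Suc r)" n "pderiv p"] \<alpha> c(1) k m o1 dp by simp
  qed
  then show "sq \<alpha> (\<lambda>t. poly I t - c 0 t) \<le> fact (Suc n - m) / fact n * sq (\<alpha> + real m) (c m)"
    using main by (simp add: k add.assoc add.commute[of 1])
  assume n: "1 \<le> n"
  have "sq (\<alpha> + 1) ?f \<le> sq (\<alpha> + 1) (\<lambda>t. c 1 t - poly [:d:] t)"
    by (rule sq_best_approximation[OF _ c0(2) dp o1])
      (use \<alpha> n in \<open>auto simp: deg_lt_def coeff_pCons split: nat.splits\<close>)
  then show "sq \<alpha> (\<lambda>t. poly I t - c 0 t) \<le> sq (\<alpha> + 1) (\<lambda>t. c 1 t - d)" using main by simp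
qed

section \<open>A Hardy inequality and interpolation at two nodes\<close>

lemma sq_Icc_le:
  assumes "L2 \<alpha> f" "0 < a"
  shows "integral {a..b} (\<lambda>t. (f t)\<^sup>2 * wt \<alpha> t) \<le> sq \<alpha> f" "(\<lambda>t. (f t)\<^sup>2 * wt \<alpha> t) integrable_on {a..b}"
proof -
  show i: "(\<lambda>t. (f t)\<^sup>2 * wt \<alpha> t) integrable_on {a..b}"
    by (rule integrable_on_subinterval[OF L2_integrable(2)[OF assms(1)]]) (use assms(2) in auto)
  show "integral {a..b} (\<lambda>t. (f t)\<^sup>2 * wt \<alpha> t) \<le> sq \<alpha> f"
    unfolding sq_def by (rule integral_subset_le) (use i L2_integrable(2) assms in auto)
qed

lemma square_integral_Icc_le:
  assumes a: "0 < a" "a \<le> b"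
  obtains K where "0 \<le> K" "\<And>f. L2 \<alpha> f \<Longrightarrow> integral {a..b} (\<lambda>t. (f t)\<^sup>2) \<le> K * sq \<alpha> f"
proof -
  have "continuous_on {a..b} (wt \<alpha>)" by (rule continuous_on_subset[OF continuous_on_wt]) (use a in auto)
  then obtain c where c: "c \<in> {a..b}" "\<And>t. t \<in> {a..b} \<Longrightarrow> wt \<alpha> c \<le> wt \<alpha> t"
    using continuous_attains_inf[of "{a..b}" "wt \<alpha>"] a(2) by auto
  define m where "m = wt \<alpha> c"
  have m: "0 < m" using wt_pos c(1) a(1) by (simp add: m_def)
  show ?thesis
  proof
    show "0 \<le> 1 / m" using m by simp
    fix f assume f: "L2 \<alpha> f"
    have "integral {a..b} (\<lambda>t. m * (f t)\<^sup>2) \<le> integral {a..b} (\<lambda>t. (f t)\<^sup>2 * wt \<alpha> t)"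
    proof (rule integral_le[OF _ sq_Icc_le(2)[OF f a(1)]])
      show "(\<lambda>t. m * (f t)\<^sup>2) integrable_on {a..b}"
        by (intro integrable_on_mult_right L2_square_integrable_on_Icc[OF f a(1)])
      show "m * (f t)\<^sup>2 \<le> (f t)\<^sup>2 * wt \<alpha> t" if "t \<in> {a..b}" for t
        using mult_left_mono[OF c(2)[OF that], of "(f t)\<^sup>2"] by (simp add: m_def mult.commute)
    qed
    also have "\<dots> \<le> sq \<alpha> f" by (rule sq_Icc_le(1)[OF f a(1)])
    finally show "integral {a..b} (\<lambda>t. (f t)\<^sup>2) \<le> 1 / m * sq \<alpha> f"
      using m by (simp add: field_simps)
  qed
qed

lemma ac_deriv_increment_square_le:
  assumes F: "ac_deriv F f" and f: "L2 \<alpha> f" and su: "0 < a" "a \<le> s" "s \<le> u" "u \<le> b"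
  shows "(F u - F s)\<^sup>2 \<le> (b - a) * integral {a..b} (\<lambda>t. (f t)\<^sup>2)"
proof -
  have s0: "0 < s" using su by simp
  have "(F u - F s)\<^sup>2 \<le> (u - s) * integral {s..u} (\<lambda>t. (f t)\<^sup>2)"
    unfolding ac_derivD(2)[OF F s0 su(3)]
    by (rule square_integral_le[OF ac_derivD(3)[OF F s0 su(3)] L2_square_integrable_on_Icc[OF f s0] su(3)])
  also have "\<dots> \<le> (b - a) * integral {a..b} (\<lambda>t. (f t)\<^sup>2)"
  proof (rule mult_mono)
    show "integral {s..u} (\<lambda>t. (f t)\<^sup>2) \<le> integral {a..b} (\<lambda>t. (f t)\<^sup>2)"
      by (rule integral_subset_le)
        (use su in \<open>auto intro!: L2_square_integrable_on_Icc[OF f]\<close>)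
    show "0 \<le> integral {s..u} (\<lambda>t. (f t)\<^sup>2)"
      by (rule integral_nonneg[OF L2_square_integrable_on_Icc[OF f s0]]) simp
  qed (use su in auto)
  finally show ?thesis .
qed

text \<open>Integrate the derivative of \<open>F\<^sup>2\<close> V. The term
  \<open>F\<^sup>2\<close> V' is at least \<open>F\<^sup>2\<close> \<open>wt \<alpha>\<close>, and
  the cross term 2 F f V costs at most half of that plus \<open>2 * k\<^sup>2\<close> times
  \<open>f\<^sup>2\<close> \<open>wt \<alpha>\<close>, so half of the weighted square of F
  survives.\<close>

lemma weighted_energy_step:
  assumes F: "ac_deriv F f" and L2: "L2 \<alpha> F" "L2 \<alpha> f" and pq: "0 < p" "p \<le> q"
    and V: "\<And>t. 0 < t \<Longrightarrow> (V has_real_derivative V' t) (at t)" "continuous_on halfline V'"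
    and V': "\<And>t. t \<in> {p..q} \<Longrightarrow> wt \<alpha> t \<le> V' t" and k: "\<And>t. t \<in> {p..q} \<Longrightarrow> \<bar>V t\<bar> \<le> k * wt \<alpha> t"
  shows "integral {p..q} (\<lambda>t. (F t)\<^sup>2 * wt \<alpha> t)
     \<le> 2 * ((F q)\<^sup>2 * V q - (F p)\<^sup>2 * V p) + 4 * k\<^sup>2 * sq \<alpha> f"
proof -
  have Va: "ac_deriv V V'" by (rule ac_deriv_of_has_derivative[OF V])
  let ?b = "\<lambda>t. (f t * F t + F t * f t) * V t + F t * F t * V' t"
  note b = ac_derivD[OF ac_deriv_mult[OF ac_deriv_mult[OF F F] Va] pq]
  note iF = sq_Icc_le(2)[OF L2(1) pq(1), of q] and i2 = sq_Icc_le(2)[OF L2(2) pq(1), of q]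
  have "integral {p..q} (\<lambda>t. (1/2) * ((F t)\<^sup>2 * wt \<alpha> t) - 2 * k\<^sup>2 * ((f t)\<^sup>2 * wt \<alpha> t)) \<le> integral {p..q} ?b"
  proof (rule integral_le[OF _ b(3)])
    show "(\<lambda>t. (1/2) * ((F t)\<^sup>2 * wt \<alpha> t) - 2 * k\<^sup>2 * ((f t)\<^sup>2 * wt \<alpha> t)) integrable_on {p..q}"
      by (intro integrable_diff integrable_on_mult_right iF i2)
    fix t assume t: "t \<in> {p..q}"
    have "\<bar>2 * (F t * f t) * V t\<bar> \<le> \<bar>2 * (F t * f t)\<bar> * (k * wt \<alpha> t)"
      unfolding abs_mult[of _ "V t"] by (rule mult_left_mono[OF k[OF t]]) simp
    also have "\<bar>2 * (F t * f t)\<bar> * (k * wt \<alpha> t) \<le> ((1/2) * (F t)\<^sup>2 + 2 * k\<^sup>2 * (f t)\<^sup>2) * wt \<alpha> t"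
    proof -
      have "2 * (\<bar>F t\<bar> * (2 * (k * \<bar>f t\<bar>))) \<le> \<bar>F t\<bar>\<^sup>2 + (2 * (k * \<bar>f t\<bar>))\<^sup>2"
        using sum_squares_bound[of "\<bar>F t\<bar>" "2 * (k * \<bar>f t\<bar>)"] by (simp add: mult.assoc)
      then have "\<bar>2 * (F t * f t)\<bar> * k \<le> (1/2) * (F t)\<^sup>2 + 2 * k\<^sup>2 * (f t)\<^sup>2"
        by (simp add: abs_mult power_mult_distrib mult.commute mult.left_commute)
      from mult_right_mono[OF this wt_nonneg[of \<alpha> t]] show ?thesis by (simp only: mult.assoc)
    qed
    finally have 1: "\<bar>2 * (F t * f t) * V t\<bar> \<le> ((1/2) * (F t)\<^sup>2 + 2 * k\<^sup>2 * (f t)\<^sup>2) * wt \<alpha> t" .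
    have 2: "(F t)\<^sup>2 * wt \<alpha> t \<le> F t * F t * V' t"
      unfolding power2_eq_square by (rule mult_left_mono[OF V'[OF t]]) simp
    have "?b t = 2 * (F t * f t) * V t + F t * F t * V' t" by (simp add: algebra_simps)
    then show "(1/2) * ((F t)\<^sup>2 * wt \<alpha> t) - 2 * k\<^sup>2 * ((f t)\<^sup>2 * wt \<alpha> t) \<le> ?b t"
      using 1 2 by (simp add: distrib_right)
  qed
  also have "\<dots> = (F q)\<^sup>2 * V q - (F p)\<^sup>2 * V p" using b(2) by (simp add: power2_eq_square)
  finally have "(1/2) * integral {p..q} (\<lambda>t. (F t)\<^sup>2 * wt \<alpha> t) - 2 * k\<^sup>2 * integral {p..q} (\<lambda>t. (f t)\<^sup>2 * wt \<alpha> t)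
     \<le> (F q)\<^sup>2 * V q - (F p)\<^sup>2 * V p"
    by (subst (asm) Henstock_Kurzweil_Integration.integral_diff) (auto intro!: integrable_on_mult_right iF i2)
  moreover have "2 * k\<^sup>2 * integral {p..q} (\<lambda>t. (f t)\<^sup>2 * wt \<alpha> t) \<le> 2 * k\<^sup>2 * sq \<alpha> f"
    by (rule mult_left_mono[OF sq_Icc_le(1)[OF L2(2) pq(1)]]) simp
  moreover have "4 * k\<^sup>2 * sq \<alpha> f = 2 * (2 * k\<^sup>2 * sq \<alpha> f)" by simp
  ultimately show ?thesis by argo
qed

text \<open>Far right the energy step uses
  \<open>V = - 2 w\<close>, near \<open>0\<close> it uses a multiple of \<open>t w\<close>; in between the weight is
  bounded below.\<close>

lemma hardy_same_weight:
  assumes \<alpha>: "-1 < \<alpha>" and a: "0 < a"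
  obtains C where "0 \<le> C"
    "\<And>F f. ac_deriv F f \<Longrightarrow> L2 \<alpha> F \<Longrightarrow> L2 \<alpha> f \<Longrightarrow> F a = 0 \<Longrightarrow> sq \<alpha> F \<le> C * sq \<alpha> f"
proof -
  \<comment> \<open>Left of (\<alpha> + 1) / 2 the factor \<alpha> + 1 - t is at least (\<alpha> +
    1) / 2, so \<kappa> = 2 / (\<alpha> + 1) makes the derivative of V = \<kappa>
    \<open>wt (\<alpha> + 1)\<close> at least \<open>wt \<alpha>\<close>. Right of 2 \<alpha> one
    has t \<le> - 2 (\<alpha> - t), which does the same for V = - 2
    \<open>wt \<alpha>\<close>.\<close>
  define l where "l = min a ((\<alpha> + 1) / 2)"
  define u where "u = max a (max 1 (2 * \<alpha>))"
  have lu: "0 < l" "l \<le> a" "a \<le> u" "1 \<le> u" "2 * \<alpha> \<le> u"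
    using a \<alpha> by (auto simp: l_def u_def)
  have l2: "l \<le> (\<alpha> + 1) / 2" unfolding l_def by (rule min.cobounded2)
  obtain K where K: "0 \<le> K" "\<And>f. L2 \<alpha> f \<Longrightarrow> integral {l..u} (\<lambda>t. (f t)\<^sup>2) \<le> K * sq \<alpha> f"
    by (rule square_integral_Icc_le[of l u \<alpha>]) (use lu in auto)
  define \<kappa> where "\<kappa> = 2 / (\<alpha> + 1)"
  \<comment> \<open>Since F vanishes at a, Cauchy-Schwarz from a bounds \<open>(F t)\<^sup>2\<close>
    by D times \<open>sq \<alpha> f\<close> throughout [l, u]; this also controls the boundary
    values at l and u.\<close>
  define D where "D = (u - l) * K"
  have D: "0 \<le> D" using K lu by (simp add: D_def)
  define w where "w = integral {l..u} (wt \<alpha>)"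
  have cw: "wt \<alpha> integrable_on {l..u}"
    by (intro integrable_continuous_real continuous_on_subset[OF continuous_on_wt]) (use lu in auto)
  have w: "0 \<le> w" unfolding w_def by (rule integral_nonneg[OF cw]) simp
  have \<kappa>: "0 < \<kappa>" using \<alpha> by (simp add: \<kappa>_def)
  \<comment> \<open>The three groups belong to the left, middle and right intervals. The energy step
    is used with k = \<kappa> l and with k = 2; its boundary terms at the outer endpoints p and q
    have the favourable sign.\<close>
  define C where "C = (2 * (D * (\<kappa> * wt (\<alpha> + 1) l)) + 4 * (\<kappa> * l)\<^sup>2) + D * w + (2 * (D * (2 * wt \<alpha> u)) + 4 * 2\<^sup>2)"
  show ?thesis
  proof
    show "0 \<le> C" using D w \<kappa> by (simp add: C_def)
    fix F f assume F: "ac_deriv F f" "L2 \<alpha> F" and f: "L2 \<alpha> f" and Fa: "F a = 0"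
    define N where "N = sq \<alpha> f"
    have N: "0 \<le> N" by (simp add: N_def sq_nonneg)
    have J: "(u - l) * integral {l..u} (\<lambda>t. (f t)\<^sup>2) \<le> D * N"
      unfolding D_def N_def mult.assoc by (rule mult_left_mono[OF K(2)[OF f]]) (use lu in simp)
    have F2: "(F t)\<^sup>2 \<le> D * N" if "t \<in> {l..u}" for t
    proof (cases "a \<le> t")
      case True
      then show ?thesis using ac_deriv_increment_square_le[OF F(1) f lu(1), of a t u] that lu Fa J by simp
    next
      case False
      then show ?thesis using ac_deriv_increment_square_le[OF F(1) f lu(1), of t a u] that lu Fa J by simp
    qed
    let ?G = "\<lambda>t. (F t)\<^sup>2 * wt \<alpha> t"
    have left: "integral {p..l} ?G \<le> (2 * (D * (\<kappa> * wt (\<alpha> + 1) l)) + 4 * (\<kappa> * l)\<^sup>2) * N" if p: "0 < p" "p \<le> l" for p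
    proof -
      have "integral {p..l} ?G \<le> 2 * ((F l)\<^sup>2 * (\<kappa> * wt (\<alpha> + 1) l) - (F p)\<^sup>2 * (\<kappa> * wt (\<alpha> + 1) p)) + 4 * (\<kappa> * l)\<^sup>2 * sq \<alpha> f"
      proof (rule weighted_energy_step[OF F f p])
        show "((\<lambda>t. \<kappa> * wt (\<alpha> + 1) t) has_real_derivative \<kappa> * ((\<alpha> + 1 - t) * wt \<alpha> t)) (at t)" if "0 < t" for t
          by (rule DERIV_cmult[OF has_derivative_wt[OF that]])
        show "continuous_on halfline (\<lambda>t. \<kappa> * ((\<alpha> + 1 - t) * wt \<alpha> t))"
          by (intro continuous_intros continuous_on_wt)
        fix t assume t: "t \<in> {p..l}"
        have "1 \<le> \<kappa> * (\<alpha> + 1 - t)" using t l2 \<alpha> by (simp add: \<kappa>_def field_simps)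
        from mult_right_mono[OF this wt_nonneg[of \<alpha> t]] show "wt \<alpha> t \<le> \<kappa> * ((\<alpha> + 1 - t) * wt \<alpha> t)" by (simp add: mult.assoc)
        have "\<kappa> * t * wt \<alpha> t \<le> \<kappa> * l * wt \<alpha> t"
          by (intro mult_right_mono mult_left_mono) (use t \<kappa> in auto)
        then show "\<bar>\<kappa> * wt (\<alpha> + 1) t\<bar> \<le> \<kappa> * l * wt \<alpha> t"
          using t p \<kappa> wt_Suc[of t \<alpha>] by (simp add: abs_mult mult.assoc)
      qed
      moreover have "0 \<le> (F p)\<^sup>2 * (\<kappa> * wt (\<alpha> + 1) p)" using \<kappa> by simp
      moreover have "(F l)\<^sup>2 * (\<kappa> * wt (\<alpha> + 1) l) \<le> D * N * (\<kappa> * wt (\<alpha> + 1) l)"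
        by (rule mult_right_mono[OF F2]) (use lu \<kappa> in auto)
      ultimately show ?thesis by (simp add: N_def algebra_simps)
    qed
    have mid: "integral {l..u} ?G \<le> D * w * N"
    proof -
      have "integral {l..u} ?G \<le> integral {l..u} (\<lambda>t. D * N * wt \<alpha> t)"
        by (rule integral_le[OF sq_Icc_le(2)[OF F(2) lu(1)] integrable_on_mult_right[OF cw]])
          (intro mult_right_mono F2, auto)
      then show ?thesis by (simp add: w_def mult.commute mult.left_commute)
    qed
    have right: "integral {u..q} ?G \<le> (2 * (D * (2 * wt \<alpha> u)) + 4 * 2\<^sup>2) * N" if q: "u \<le> q" for q
    proof -
      have u0: "0 < u" using lu by simp
      have "integral {u..q} ?G \<le> 2 * ((F q)\<^sup>2 * (- 2 * wt \<alpha> q) - (F u)\<^sup>2 * (- 2 * wt \<alpha> u)) + 4 * 2\<^sup>2 * sq \<alpha> f"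
      proof (rule weighted_energy_step[OF F f u0 q])
        show "((\<lambda>t. - 2 * wt \<alpha> t) has_real_derivative - 2 * ((\<alpha> - t) * wt (\<alpha> - 1) t)) (at t)" if "0 < t" for t
          using DERIV_cmult[OF has_derivative_wt[OF that, of "\<alpha> - 1"], of "-2"] by simp
        show "continuous_on halfline (\<lambda>t. - 2 * ((\<alpha> - t) * wt (\<alpha> - 1) t))"
          by (intro continuous_intros continuous_on_wt)
        fix t assume t: "t \<in> {u..q}"
        have "t \<le> - 2 * (\<alpha> - t)" using t lu by simp
        from mult_right_mono[OF this wt_nonneg[of "\<alpha> - 1" t]]
        show "wt \<alpha> t \<le> - 2 * ((\<alpha> - t) * wt (\<alpha> - 1) t)"
          using wt_Suc[of t "\<alpha> - 1"] t u0 by (simp add: algebra_simps)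
        show "\<bar>- 2 * wt \<alpha> t\<bar> \<le> 2 * wt \<alpha> t" by (simp add: abs_mult)
      qed
      moreover have "0 \<le> (F q)\<^sup>2 * wt \<alpha> q" by simp
      moreover have "(F u)\<^sup>2 * wt \<alpha> u \<le> D * N * wt \<alpha> u"
        by (rule mult_right_mono[OF F2]) (use lu in auto)
      moreover have "2 * ((F q)\<^sup>2 * (- 2 * wt \<alpha> q) - (F u)\<^sup>2 * (- 2 * wt \<alpha> u))
          = 4 * ((F u)\<^sup>2 * wt \<alpha> u) - 4 * ((F q)\<^sup>2 * wt \<alpha> q)" by simp
      moreover have "(2 * (D * (2 * wt \<alpha> u)) + 4 * 2\<^sup>2) * N = 4 * (D * N * wt \<alpha> u) + 4 * 2\<^sup>2 * sq \<alpha> f"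
        by (simp add: N_def algebra_simps)
      ultimately show ?thesis by linarith
    qed
    have total: "integral {p..q} ?G \<le> C * N" if "0 < p" "p \<le> l" "u \<le> q" for p q
    proof -
      note i = sq_Icc_le(2)[OF F(2)]
      have "integral {p..q} ?G = integral {p..l} ?G + integral {l..u} ?G + integral {u..q} ?G"
        using Henstock_Kurzweil_Integration.integral_combine[of p l q ?G]
          Henstock_Kurzweil_Integration.integral_combine[of l u q ?G] i that lu by simp
      then show ?thesis using left[of p] mid right[of q] that by (simp add: C_def distrib_right)
    qed
    have "(\<lambda>n. integral {min l (1 / Suc n)..max u (Suc n)} ?G) \<longlonglongrightarrow> sq \<alpha> F"
      unfolding sq_def
      by (rule integral_exhaust_halfline[OF L2_integrable(1)[OF F(2)]]) (use lu in auto)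
    then have "sq \<alpha> F \<le> C * N"
    proof (rule LIMSEQ_le_const2, intro exI allI impI)
      fix n :: nat
      show "integral {min l (1 / Suc n)..max u (Suc n)} ?G \<le> C * N"
        by (rule total) (use lu in auto)
    qed
    then show "sq \<alpha> F \<le> C * sq \<alpha> f" by (simp add: N_def)
  qed
qed

text \<open>The error vanishes at the smaller node y, so the Hardy inequality bounds it by its
  derivative s - f, where s is the slope of the linear interpolant. As a divided difference of F, s
  is controlled by the integral of \<open>f\<^sup>2\<close> between the nodes, where the weight is
  bounded below.\<close>

lemma interpolation_error_le_one:
  assumes \<alpha>: "-1 < \<alpha>"
  obtains C where "0 \<le> C"
    "\<And>F f I. ac_deriv F f \<Longrightarrow> L2 \<alpha> F \<Longrightarrow> L2 \<alpha> f \<Longrightarrow> deg_lt 2 I \<Longrightarrow>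
      (\<And>z. z \<in> lag_zeros 2 \<alpha> \<Longrightarrow> poly I z = F z) \<Longrightarrow> sq \<alpha> (\<lambda>t. poly I t - F t) \<le> C * sq \<alpha> f"
proof -
  have "card (lag_zeros 2 \<alpha>) = 2" by (rule card_lag_zeros[OF \<alpha>])
  then obtain y z where yz: "lag_zeros 2 \<alpha> = {y, z}" "y < z"
    by (metis card_2_iff insert_commute linorder_neqE_linordered_idom)
  then have y: "0 < y" by (auto simp: lag_zeros_def)
  obtain K where K: "0 \<le> K" "\<And>f. L2 \<alpha> f \<Longrightarrow> integral {y..z} (\<lambda>t. (f t)\<^sup>2) \<le> K * sq \<alpha> f"
    by (rule square_integral_Icc_le[of y z \<alpha>]) (use y yz in auto)
  obtain H where H: "0 \<le> H"
    "\<And>F f. ac_deriv F f \<Longrightarrow> L2 \<alpha> F \<Longrightarrow> L2 \<alpha> f \<Longrightarrow> F y = 0 \<Longrightarrow> sq \<alpha> F \<le> H * sq \<alpha> f"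
    by (rule hardy_same_weight[OF \<alpha> y]) blast
  define E where "E = sq \<alpha> (poly [:1:])"
  have E: "0 \<le> E" by (simp add: E_def sq_nonneg)
  show ?thesis
  proof
    show "0 \<le> H * (2 * (K / (z - y) * E) + 2)" using H K E yz by simp
    fix F f I assume F: "ac_deriv F f" "L2 \<alpha> F" and f: "L2 \<alpha> f" and I: "deg_lt 2 I"
      and Iz: "\<And>z. z \<in> lag_zeros 2 \<alpha> \<Longrightarrow> poly I z = F z"
    have "I = [:coeff I 0, coeff I 1:]"
      by (rule poly_eqI) (use I in \<open>auto simp: coeff_pCons deg_lt_def split: nat.splits\<close>)
    then obtain c s where I_eq: "I = [:c, s:]" by blast
    have "F z - F y = s * (z - y)" using Iz[of y] Iz[of z] yz by (simp add: I_eq algebra_simps)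
    then have "(s * (z - y))\<^sup>2 \<le> (z - y) * integral {y..z} (\<lambda>t. (f t)\<^sup>2)"
      using ac_deriv_increment_square_le[OF F(1) f y, of y z z] yz by simp
    also have "\<dots> \<le> (z - y) * (K * sq \<alpha> f)"
      by (rule mult_left_mono[OF K(2)[OF f]]) (use yz in simp)
    finally have "(z - y) * (s\<^sup>2 * (z - y)) \<le> (z - y) * (K * sq \<alpha> f)"
      by (simp add: power2_eq_square algebra_simps)
    then have "s\<^sup>2 * (z - y) \<le> K * sq \<alpha> f" using yz by (simp only: mult_le_cancel_left_pos diff_gt_0_iff_gt)
    then have s: "s\<^sup>2 \<le> K / (z - y) * sq \<alpha> f" using yz by (simp add: pos_le_divide_eq)
    have L: "L2 \<alpha> (poly [:s:])" "L2 \<alpha> (poly I)" "L2 \<alpha> (\<lambda>t. - 1 * f t)"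
      using \<alpha> f L2_poly L2_cmult by blast+
    have "sq \<alpha> (\<lambda>t. poly I t - F t) \<le> H * sq \<alpha> (\<lambda>t. poly (pderiv I) t - f t)"
      by (rule H(2)) (use F f L Iz yz in \<open>auto intro!: ac_deriv_diff ac_deriv_poly L2_diff L2_poly \<alpha>\<close>)
    also have "\<dots> \<le> H * (2 * (s\<^sup>2 * E) + 2 * sq \<alpha> f)"
    proof (rule mult_left_mono[OF _ H(1)])
      have "sq \<alpha> (poly [:s:]) = s\<^sup>2 * E"
        unfolding E_def sq_cmult[symmetric] by (rule arg_cong[where f = "sq \<alpha>"]) auto
      then show "sq \<alpha> (\<lambda>t. poly (pderiv I) t - f t) \<le> 2 * (s\<^sup>2 * E) + 2 * sq \<alpha> f"
        using sq_add_le[OF L(1,3)] sq_cmult[of \<alpha> "-1" f] by (simp add: I_eq pderiv_pCons)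
    qed
    also have "\<dots> \<le> H * (2 * (K / (z - y) * sq \<alpha> f * E) + 2 * sq \<alpha> f)"
      by (intro mult_left_mono add_right_mono mult_right_mono s E H(1)) simp
    finally show "sq \<alpha> (\<lambda>t. poly I t - F t) \<le> H * (2 * (K / (z - y) * E) + 2) * sq \<alpha> f"
      by (simp add: algebra_simps)
  qed
qed

subsection \<open>Weak derivatives on the half line\<close>

text \<open>The classical function exp (- 1 / u), flat at 0, with a polynomial factor in 1 / u so
  that the family is closed under differentiation.\<close>

definition flat :: "real poly \<Rightarrow> real \<Rightarrow> real" where
  "flat P u = (if 0 < u then poly P (1 / u) * exp (- 1 / u) else 0)"

lemma poly_div_exp_tendsto_0: "((\<lambda>z. poly P z / exp z) \<longlongrightarrow> 0) at_top" for P :: "real poly"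
proof -
  have "((\<lambda>z. \<Sum>k\<le>degree P. coeff P k * (z ^ k / exp z)) \<longlongrightarrow> (\<Sum>k\<le>degree P. coeff P k * 0)) at_top"
    by (intro tendsto_intros tendsto_power_div_exp_0)
  then show ?thesis by (simp add: poly_altdef sum_divide_distrib)
qed

lemma has_derivative_flat:
  "(flat P has_real_derivative flat ([:0, 0, 1:] * (P - pderiv P)) u) (at u)"
proof -
  consider "0 < u" | "u < 0" | "u = 0" by linarith
  then show ?thesis
  proof cases
    case 1
    have "((\<lambda>u. poly P (1 / u) * exp (- 1 / u)) has_real_derivative
        poly (pderiv P) (1 / u) * (- 1 / u\<^sup>2) * exp (- 1 / u) + exp (- 1 / u) * (1 / u\<^sup>2) * poly P (1 / u)) (at u)"
    proof (rule DERIV_mult)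
      have d: "((\<lambda>u. 1 / u) has_real_derivative - 1 / u\<^sup>2) (at u)"
        using 1 by (auto intro!: derivative_eq_intros simp: power2_eq_square)
      show "((\<lambda>u. poly P (1 / u)) has_real_derivative poly (pderiv P) (1 / u) * (- 1 / u\<^sup>2)) (at u)"
        by (rule DERIV_chain2[OF poly_DERIV d])
      show "((\<lambda>u. exp (- 1 / u)) has_real_derivative exp (- 1 / u) * (1 / u\<^sup>2)) (at u)"
        using 1 by (auto intro!: derivative_eq_intros simp: power2_eq_square)
    qed
    also have "poly (pderiv P) (1 / u) * (- 1 / u\<^sup>2) * exp (- 1 / u) + exp (- 1 / u) * (1 / u\<^sup>2) * poly P (1 / u)
        = flat ([:0, 0, 1:] * (P - pderiv P)) u"
      using 1 by (simp add: flat_def power2_eq_square field_simps)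
    finally show ?thesis
      by (rule has_field_derivative_transform_within_open[of _ _ _ "{0<..}"]) (use 1 in \<open>auto simp: flat_def\<close>)
  next
    case 2
    have "((\<lambda>u. 0) has_real_derivative 0) (at u)" by simp
    then have "(flat P has_real_derivative 0) (at u)"
      by (rule has_field_derivative_transform_within_open[of _ _ _ "{..<0}"]) (use 2 in \<open>auto simp: flat_def\<close>)
    then show ?thesis using 2 by (simp add: flat_def)
  next
    case 3
    have "((\<lambda>h. flat P h / h) \<longlongrightarrow> 0) (at 0)"
    proof (rule filterlim_split_at_real)
      have "((\<lambda>h::real. 0) \<longlongrightarrow> 0) (at_left (0::real))" by simp
      then show "((\<lambda>h. flat P h / h) \<longlongrightarrow> 0) (at_left 0)"
        by (rule Lim_transform_eventually)
          (auto simp: flat_def eventually_at_left_field intro!: exI[of _ "-1"])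
      \<comment> \<open>With z = 1 / h the difference quotient is z P(z) / exp z, and
        \<open>pCons 0 P\<close> is the polynomial z P(z).\<close>
      have "((\<lambda>h. poly (pCons 0 P) (inverse h) / exp (inverse h)) \<longlongrightarrow> 0) (at_right 0)"
        by (rule filterlim_compose[OF poly_div_exp_tendsto_0 filterlim_inverse_at_top_right])
      then show "((\<lambda>h. flat P h / h) \<longlongrightarrow> 0) (at_right 0)"
        by (rule Lim_transform_eventually)
          (auto simp: flat_def eventually_at_right_field divide_simps exp_minus intro!: exI[of _ 1])
    qed
    then show ?thesis using 3 by (simp add: DERIV_def flat_def)
  qed
qed

text \<open>\<open>test_function\<close> asks for differentiability of all iterates of
  \<open>deriv\<close>. A class closed under differentiation gives this by induction, without
  formulas for the higher derivatives of products.\<close>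

inductive_set bump_algebra :: "(real \<Rightarrow> real) set" where
  flat: "(\<lambda>x. flat P (c * x + d)) \<in> bump_algebra"
| const: "(\<lambda>x. c) \<in> bump_algebra"
| add: "f \<in> bump_algebra \<Longrightarrow> g \<in> bump_algebra \<Longrightarrow> (\<lambda>x. f x + g x) \<in> bump_algebra"
| mult: "f \<in> bump_algebra \<Longrightarrow> g \<in> bump_algebra \<Longrightarrow> (\<lambda>x. f x * g x) \<in> bump_algebra"

lemma bump_algebra_deriv:
  assumes "f \<in> bump_algebra"
  shows "\<exists>f'\<in>bump_algebra. \<forall>x. (f has_real_derivative f' x) (at x)"
  using assms
proof induction
  case (flat P c d)
  let ?f' = "\<lambda>x. flat ([:0, 0, 1:] * (P - pderiv P)) (c * x + d) * c"
  have "((\<lambda>x. flat P (c * x + d)) has_real_derivative ?f' x) (at x)" for x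
    by (rule DERIV_chain2[OF has_derivative_flat]) (auto intro!: derivative_eq_intros)
  moreover have "?f' \<in> bump_algebra" by (intro bump_algebra.intros)
  ultimately show ?case by (intro bexI[of _ ?f']) blast
next
  case (const c)
  have "((\<lambda>x. c) has_real_derivative 0) (at x)" for x by simp
  then show ?case by (intro bexI[of _ "\<lambda>x. 0"] allI bump_algebra.const)
next
  case (add f g)
  then obtain f' g' where "f' \<in> bump_algebra" "\<And>x. (f has_real_derivative f' x) (at x)"
    "g' \<in> bump_algebra" "\<And>x. (g has_real_derivative g' x) (at x)" by blast
  then show ?case by (intro bexI[of _ "\<lambda>x. f' x + g' x"]) (auto intro: DERIV_add bump_algebra.add)
next
  case (mult f g)
  then obtain f' g' where *: "f' \<in> bump_algebra" "\<And>x. (f has_real_derivative f' x) (at x)"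
    "g' \<in> bump_algebra" "\<And>x. (g has_real_derivative g' x) (at x)" by blast
  have "(\<lambda>x. f' x * g x + g' x * f x) \<in> bump_algebra"
    using mult.hyps * by (intro bump_algebra.add bump_algebra.mult)
  moreover have "((\<lambda>x. f x * g x) has_real_derivative f' x * g x + g' x * f x) (at x)" for x
    using * by (intro DERIV_mult)
  ultimately show ?case by (intro bexI[of _ "\<lambda>x. f' x * g x + g' x * f x"] allI)
qed

lemma bump_algebra_smooth:
  assumes "f \<in> bump_algebra" shows "(deriv ^^ n) f differentiable_on UNIV"
proof -
  have 1: "deriv f \<in> bump_algebra" if f: "f \<in> bump_algebra" for f
  proof -
    obtain f' where f': "f' \<in> bump_algebra" "\<And>x. (f has_real_derivative f' x) (at x)"
      using bump_algebra_deriv[OF f] by blast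
    have "deriv f = f'" using DERIV_imp_deriv[OF f'(2)] by blast
    then show ?thesis using f'(1) by simp
  qed
  have "(deriv ^^ n) f \<in> bump_algebra" by (induction n) (use assms 1 in auto)
  from bump_algebra_deriv[OF this] show ?thesis
    by (auto simp: differentiable_on_def real_differentiable_def)
qed

lemma bump_algebra_continuous:
  assumes "f \<in> bump_algebra" shows "continuous_on A f"
proof -
  obtain f' where "\<And>x. (f has_real_derivative f' x) (at x)" using bump_algebra_deriv[OF assms] by blast
  then show ?thesis by (meson DERIV_isCont continuous_at_imp_continuous_on)
qed

text \<open>Smooth approximations from below to the indicator of the open interval from a to b: the
  factor n + 1 steepens both edges without moving the support.\<close>

definition bump :: "real \<Rightarrow> real \<Rightarrow> nat \<Rightarrow> real \<Rightarrow> real" where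
  "bump a b n x = flat 1 (real (Suc n) * (x - a)) * flat 1 (real (Suc n) * (b - x))"

lemma bump_in_algebra: "bump a b n \<in> bump_algebra"
proof -
  have "(\<lambda>x. flat 1 (real (Suc n) * x + - real (Suc n) * a) * flat 1 (- real (Suc n) * x + real (Suc n) * b)) \<in> bump_algebra"
    by (intro bump_algebra.intros)
  also have "(\<lambda>x. flat 1 (real (Suc n) * x + - real (Suc n) * a) * flat 1 (- real (Suc n) * x + real (Suc n) * b)) = bump a b n"
    by (simp add: fun_eq_iff bump_def algebra_simps)
  finally show ?thesis .
qed

lemma flat_1_bounds: "0 \<le> flat 1 u" "flat 1 u \<le> 1" by (auto simp: flat_def)

lemma bump_bounds: "0 \<le> bump a b n x" "bump a b n x \<le> 1"
  by (auto simp: bump_def flat_1_bounds intro!: mult_nonneg_nonneg mult_le_one)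

lemma bump_outside: "x \<le> a \<or> b \<le> x \<Longrightarrow> bump a b n x = 0"
  by (auto simp: bump_def flat_def zero_less_mult_iff)

lemma bump_tendsto:
  assumes "x \<in> {a<..<b}" shows "(\<lambda>n. bump a b n x) \<longlonglongrightarrow> 1"
proof -
  have *: "(\<lambda>n. flat 1 (real (Suc n) * s)) \<longlonglongrightarrow> 1" if "0 < s" for s :: real
  proof -
    have "(\<lambda>n. exp (- (inverse (real (Suc n)) / s))) \<longlonglongrightarrow> exp (- (0 / s))"
      by (intro tendsto_intros LIMSEQ_inverse_real_of_nat) (use that in simp)
    then show ?thesis using that by (simp add: flat_def inverse_eq_divide)
  qed
  have "(\<lambda>n. bump a b n x) \<longlonglongrightarrow> 1 * 1"
    unfolding bump_def by (intro tendsto_mult * ) (use assms in auto)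
  then show ?thesis by simp
qed

lemma integral_mult_bump_tendsto:
  assumes u: "u absolutely_integrable_on {a..b}"
  shows "(\<lambda>n. integral {a..b} (\<lambda>x. u x * bump a b n x)) \<longlonglongrightarrow> integral {a..b} u"
proof -
  have i: "(\<lambda>x. u x * bump a b n x) absolutely_integrable_on {a..b}" for n
    by (rule absolutely_integrable_mult_continuous(1)[OF u bump_algebra_continuous[OF bump_in_algebra]])
  \<comment> \<open>At the endpoints every bump vanishes, so pointwise convergence to u holds on the
    open interval only.\<close>
  have "(\<lambda>n. integral {a<..<b} (\<lambda>x. u x * bump a b n x)) \<longlonglongrightarrow> integral {a<..<b} u"
  proof (rule dominated_convergence(2))
    show "(\<lambda>x. u x * bump a b n x) integrable_on {a<..<b}" for n
      using i[of n] by (simp add: absolutely_integrable_on_Icc_iff_Ioo) (simp add: absolutely_integrable_on_def)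
    show "(\<lambda>x. \<bar>u x\<bar>) integrable_on {a<..<b}"
      using u by (simp add: absolutely_integrable_on_Icc_iff_Ioo) (simp add: absolutely_integrable_on_def)
    show "norm (u x * bump a b n x) \<le> \<bar>u x\<bar>" for n x
      using bump_bounds[of a b n x] by (simp add: abs_mult mult_left_le)
    show "(\<lambda>n. u x * bump a b n x) \<longlonglongrightarrow> u x" if "x \<in> {a<..<b}" for x
      using tendsto_mult[OF tendsto_const bump_tendsto[OF that], of "u x"] by simp
  qed
  then show ?thesis by (simp add: integral_open_interval_real)
qed

lemma compactly_supported_primitive:
  assumes \<psi>: "\<psi> \<in> bump_algebra" and AB: "0 < A" "A \<le> B"
    and supp: "\<And>x. x \<le> A \<or> B \<le> x \<Longrightarrow> \<psi> x = 0" and zero: "integral {A..B} \<psi> = 0"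
  obtains \<phi> where "test_function \<phi>" "deriv \<phi> = \<psi>"
proof -
  \<comment> \<open>Starting at A - 1 makes each x \<ge> A an interior point of the interval used
    below, so a two-sided derivative results there.\<close>
  define \<phi> where "\<phi> x = integral {A-1..x} \<psi>" for x
  have c: "continuous_on S \<psi>" for S by (rule bump_algebra_continuous[OF \<psi>])
  have out: "\<phi> x = 0" if "x \<le> A \<or> B \<le> x" for x
  proof (cases "x \<le> A")
    case True
    then have "\<phi> x = integral {A-1..x} (\<lambda>x. 0)"
      unfolding \<phi>_def by (intro integral_cong supp) auto
    then show ?thesis by simp
  next
    case False
    then have x: "B \<le> x" using that by simp
    have "integral {A-1..A} \<psi> = integral {A-1..A} (\<lambda>x. 0)" by (intro integral_cong supp) auto
    moreover have "integral {B..x} \<psi> = integral {B..x} (\<lambda>x. 0)" by (intro integral_cong supp) auto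
    moreover have i: "\<psi> integrable_on {p..q}" for p q by (rule integrable_continuous_real[OF c])
    have "\<phi> x = integral {A-1..A} \<psi> + (integral {A..B} \<psi> + integral {B..x} \<psi>)"
      unfolding \<phi>_def using AB x
      by (simp add: Henstock_Kurzweil_Integration.integral_combine[OF _ _ i])
    ultimately show ?thesis using zero by simp
  qed
  have d: "(\<phi> has_real_derivative \<psi> x) (at x)" for x
  proof (cases "x < A")
    case True
    have "((\<lambda>x. 0) has_real_derivative 0) (at x)" by simp
    then have "(\<phi> has_real_derivative 0) (at x)"
      by (rule has_field_derivative_transform_within_open[of _ _ _ "{..<A}"]) (use True out in auto)
    then show ?thesis using supp[of x] True by simp
  next
    case False
    have "(\<phi> has_real_derivative \<psi> x) (at x within {A-1..x+1})"
      unfolding \<phi>_def[abs_def] by (rule integral_has_real_derivative[OF c]) (use False in auto)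
    then show ?thesis using False by (subst (asm) at_within_Icc_at) auto
  qed
  have dd: "deriv \<phi> = \<psi>" using DERIV_imp_deriv[OF d] by blast
  have "(deriv ^^ n) \<phi> differentiable_on UNIV" for n
  proof (cases n)
    case 0
    have "\<phi> differentiable at x" for x using d[of x] by (auto simp: real_differentiable_def)
    then show ?thesis using 0 by (simp add: differentiable_on_def)
  next
    case (Suc k)
    then show ?thesis using bump_algebra_smooth[OF \<psi>, of k] by (simp add: funpow_swap1 dd)
  qed
  then have "test_function \<phi>"
    unfolding test_function_def by (intro conjI allI exI[of _ "{A..B}"]) (use AB out in auto)
  then show ?thesis using dd by (rule that)
qed

lemma bump_integral_on:
  assumes "u absolutely_integrable_on {A..B}" "A \<le> a" "a \<le> b" "b \<le> B"
  shows "integral {A..B} (\<lambda>x. u x * bump a b n x) = integral {a..b} (\<lambda>x. u x * bump a b n x)"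
proof -
  have "integral {a..b} (\<lambda>x. u x * bump a b n x) = integral {A..B} (\<lambda>x. if x \<in> {a..b} then u x * bump a b n x else 0)"
    using assms by (subst integral_restrict_Int) (auto intro!: arg_cong2[where f = integral])
  also have "\<dots> = integral {A..B} (\<lambda>x. u x * bump a b n x)"
    by (rule integral_cong) (auto simp: bump_outside)
  finally show ?thesis by simp
qed

section \<open>Absolutely continuous representatives\<close>

text \<open>The conclusion says that the mean of u over any interval is its mean over [1, 2]. A
  combination of two bumps with total integral 0 is the derivative of a test function and so is
  annihilated by u; letting the bumps tend to indicators compares the two means.\<close>

lemma du_bois_reymond:
  fixes u :: "real \<Rightarrow> real"
  assumes u: "\<And>a b. 0 < a \<Longrightarrow> a \<le> b \<Longrightarrow> u absolutely_integrable_on {a..b}"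
    and orth: "\<And>\<phi> a b. test_function \<phi> \<Longrightarrow> 0 < a \<Longrightarrow> (\<And>x. x \<le> a \<or> b \<le> x \<Longrightarrow> deriv \<phi> x = 0)
       \<Longrightarrow> integral {a..b} (\<lambda>x. u x * deriv \<phi> x) = 0"
    and ab: "0 < a" "a \<le> b"
  shows "integral {a..b} u = (b - a) * integral {1..2} u"
proof -
  define A B where "A = min a 1" and "B = max b 2"
  have AB: "0 < A" "A \<le> a" "A \<le> 1" "b \<le> B" "2 \<le> B" using ab by (auto simp: A_def B_def)
  have eq: "integral {1..2} (\<lambda>x. 1 * bump 1 2 n x) * integral {a..b} (\<lambda>x. u x * bump a b n x)
     = integral {a..b} (\<lambda>x. 1 * bump a b n x) * integral {1..2} (\<lambda>x. u x * bump 1 2 n x)" for n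
  proof -
    define J J0 where "J = integral {a..b} (\<lambda>x. 1 * bump a b n x)" and "J0 = integral {1..2} (\<lambda>x. 1 * bump 1 2 n x)"
    \<comment> \<open>Each bump is weighted by the integral of the other, which makes the total
      integral 0 without normalizing either one.\<close>
    define \<psi> where "\<psi> x = J0 * bump a b n x + (- J) * bump 1 2 n x" for x
    have \<psi>: "\<psi> \<in> bump_algebra"
      unfolding \<psi>_def[abs_def] by (intro bump_algebra.intros bump_in_algebra)
    have supp: "\<psi> x = 0" if "x \<le> A \<or> B \<le> x" for x
      using that AB by (auto simp: \<psi>_def bump_outside)
    have split: "integral {A..B} (\<lambda>x. w x * \<psi> x) = J0 * integral {a..b} (\<lambda>x. w x * bump a b n x)
        - J * integral {1..2} (\<lambda>x. w x * bump 1 2 n x)" if w: "w absolutely_integrable_on {A..B}" for w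
    proof -
      have i: "(\<lambda>x. w x * bump p q n x) integrable_on {A..B}" for p q
        using absolutely_integrable_mult_continuous(1)[OF w bump_algebra_continuous[OF bump_in_algebra]]
        by (auto simp: absolutely_integrable_on_def)
      have "integral {A..B} (\<lambda>x. w x * \<psi> x) = integral {A..B} (\<lambda>x. J0 * (w x * bump a b n x) - J * (w x * bump 1 2 n x))"
        by (simp add: \<psi>_def algebra_simps)
      also have "\<dots> = integral {A..B} (\<lambda>x. J0 * (w x * bump a b n x)) - integral {A..B} (\<lambda>x. J * (w x * bump 1 2 n x))"
        by (intro Henstock_Kurzweil_Integration.integral_diff integrable_on_mult_right i)
      finally show ?thesis
        using bump_integral_on[OF w AB(2) ab(2) AB(4)] bump_integral_on[OF w AB(3) _ AB(5)] by simp
    qed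
    have zero: "integral {A..B} \<psi> = 0"
      using split[of "\<lambda>_. 1"] by (simp add: J_def J0_def)
    have "A \<le> B" using AB by simp
    obtain \<phi> where \<phi>: "test_function \<phi>" "deriv \<phi> = \<psi>"
      by (rule compactly_supported_primitive[OF \<psi> AB(1) \<open>A \<le> B\<close> supp zero])
    have "integral {A..B} (\<lambda>x. u x * \<psi> x) = 0"
      using orth[OF \<phi>(1) AB(1), of B] supp by (simp add: \<phi>(2))
    then show ?thesis using split[OF u] AB ab by (simp add: J_def J0_def)
  qed
  have one: "(\<lambda>_. 1 :: real) absolutely_integrable_on {p..q::real}" for p q
    by (rule absolutely_integrable_continuous_real) simp
  have "(\<lambda>n. integral {1..2} (\<lambda>x. 1 * bump 1 2 n x) * integral {a..b} (\<lambda>x. u x * bump a b n x)) \<longlonglongrightarrow> integral {1..2::real} (\<lambda>_. 1) * integral {a..b} u"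
    by (intro tendsto_mult integral_mult_bump_tendsto u one ab)
  moreover have "(\<lambda>n. integral {a..b} (\<lambda>x. 1 * bump a b n x) * integral {1..2} (\<lambda>x. u x * bump 1 2 n x)) \<longlonglongrightarrow> integral {a..b} (\<lambda>_. 1) * integral {1..2} u"
    by (intro tendsto_mult integral_mult_bump_tendsto u one) auto
  ultimately have "integral {1..2::real} (\<lambda>_. 1) * integral {a..b} u = integral {a..b} (\<lambda>_. 1) * integral {1..2} u"
    unfolding eq by (rule LIMSEQ_unique)
  then show ?thesis using ab by simp
qed

text \<open>The positive and negative parts of d are densities of finite measures. Vanishing tail
  integrals make these measures agree on all rays, hence everywhere, so the two parts agree almost
  everywhere and both must be 0.\<close>

lemma negligible_of_zero_integrals_Icc:
  fixes d :: "real \<Rightarrow> real"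
  assumes d: "d absolutely_integrable_on {a..b}"
    and zero: "\<And>s. s \<in> {a..b} \<Longrightarrow> integral {s..b} d = 0"
  shows "negligible {x \<in> {a..b}. d x \<noteq> 0}"
proof (cases "a \<le> b")
  case True
  obtain f N where f: "integrable lborel f" "negligible N"
    "\<And>x. x \<notin> N \<Longrightarrow> f x = indicator {a..b} x * d x"
    by (rule absolutely_integrable_borel_representative[OF d]) blast
  have [measurable]: "f \<in> borel_measurable borel" using f(1) by auto
  have tail: "(\<integral>x. indicator {s<..} x * f x \<partial>lborel) = 0" for s
  proof -
    have "integrable lborel (\<lambda>x. indicator {s<..} x * f x)"
      by (rule Bochner_Integration.integrable_bound[OF f(1)]) (auto simp: indicator_def)
    then have "(\<integral>x. indicator {s<..} x * f x \<partial>lborel) = integral UNIV (\<lambda>x. indicator {s<..} x * f x)"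
      by (simp add: integral_lborel)
    also have "\<dots> = integral UNIV (\<lambda>x. if x \<in> {max s a..b} then d x else 0)"
      by (rule integral_spike[of "insert s N"]) (use f(2) in \<open>auto simp: f(3) indicator_def\<close>)
    also have "\<dots> = integral {max s a..b} d" by (simp only: integral_restrict_UNIV)
    also have "\<dots> = 0" using zero[of "max s a"] by (cases "s \<le> b") (use True in auto)
    finally show ?thesis .
  qed
  let ?p = "\<lambda>x. max 0 (f x)" and ?m = "\<lambda>x. max 0 (- f x)"
  have ip: "integrable lborel ?p" and im: "integrable lborel ?m" using f(1) by auto
  have fin: "(\<integral>\<^sup>+x. ennreal (g x) * indicator A x \<partial>lborel) = ennreal (\<integral>x. indicator A x * g x \<partial>lborel)"
    if "integrable lborel g" "\<And>x. 0 \<le> g x" "A \<in> sets borel" for g :: "real \<Rightarrow> real" and A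
  proof -
    have [measurable]: "g \<in> borel_measurable borel" "A \<in> sets borel" using that by auto
    have i: "integrable lborel (\<lambda>x. indicator A x * g x)"
      by (rule Bochner_Integration.integrable_bound[OF that(1)]) (auto simp: indicator_def)
    have "(\<integral>\<^sup>+x. ennreal (g x) * indicator A x \<partial>lborel) = (\<integral>\<^sup>+x. ennreal (indicator A x * g x) \<partial>lborel)"
      by (intro nn_integral_cong) (auto simp: indicator_def)
    also have "\<dots> = ennreal (\<integral>x. indicator A x * g x \<partial>lborel)"
      by (rule nn_integral_eq_integral[OF i]) (use that(2) in \<open>auto simp: indicator_def\<close>)
    finally show ?thesis .
  qed
  have "density lborel (\<lambda>x. ennreal (?p x)) = density lborel (\<lambda>x. ennreal (?m x))"
  proof (rule measure_eqI_lessThan)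
    fix s :: real
    have e: "emeasure (density lborel (\<lambda>x. ennreal (g x))) {s<..} = ennreal (\<integral>x. indicator {s<..} x * g x \<partial>lborel)"
      if "integrable lborel g" "\<And>x. 0 \<le> g x" for g
      using fin[OF that, of "{s<..}"] that(1) by (subst emeasure_density) auto
    show "emeasure (density lborel (\<lambda>x. ennreal (?p x))) {s<..} < \<infinity>"
      unfolding e[OF ip, simplified] by simp
    have i: "integrable lborel (\<lambda>x. indicator {s<..} x * g x)" if "integrable lborel g" for g :: "real \<Rightarrow> real"
      by (rule Bochner_Integration.integrable_bound[OF that]) (use that in \<open>auto simp: indicator_def\<close>)
    have "(\<integral>x. indicator {s<..} x * ?p x \<partial>lborel) - (\<integral>x. indicator {s<..} x * ?m x \<partial>lborel)
       = (\<integral>x. indicator {s<..} x * ?p x - indicator {s<..} x * ?m x \<partial>lborel)"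
      by (rule Bochner_Integration.integral_diff[OF i[OF ip] i[OF im], symmetric])
    also have "\<dots> = (\<integral>x. indicator {s<..} x * f x \<partial>lborel)"
      by (rule Bochner_Integration.integral_cong) (auto simp: indicator_def)
    finally have "(\<integral>x. indicator {s<..} x * ?p x \<partial>lborel) = (\<integral>x. indicator {s<..} x * ?m x \<partial>lborel)"
      using tail by simp
    then show "emeasure (density lborel (\<lambda>x. ennreal (?p x))) {s<..} = emeasure (density lborel (\<lambda>x. ennreal (?m x))) {s<..}"
      using e[OF ip] e[OF im] by simp
  qed simp_all
  moreover have "(\<integral>\<^sup>+x. ennreal (?p x) \<partial>lborel) \<noteq> \<infinity>"
    using nn_integral_eq_integral[OF ip] by simp
  ultimately have "AE x in lborel. ennreal (?p x) = ennreal (?m x)"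
    by (subst finite_density_unique[symmetric]) auto
  then have "AE x in lborel. f x = 0"
    by eventually_elim (auto simp: max_def split: if_splits)
  then have "AE x in lebesgue. f x = 0" by (rule AE_completion)
  then obtain N' where N': "N' \<in> null_sets lebesgue" "{x \<in> space lebesgue. \<not> f x = 0} \<subseteq> N'"
    unfolding eventually_ae_filter by blast
  have "negligible (N \<union> N')"
    by (rule negligible_Un[OF f(2)]) (use N'(1) in \<open>simp add: negligible_iff_null_sets\<close>)
  then show ?thesis
  proof (rule negligible_subset)
    show "{x \<in> {a..b}. d x \<noteq> 0} \<subseteq> N \<union> N'"
    proof
      fix x assume x: "x \<in> {x \<in> {a..b}. d x \<noteq> 0}"
      show "x \<in> N \<union> N'"
      proof (cases "x \<in> N")
        case False
        then have "f x \<noteq> 0" using f(3)[OF False] x by simp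
        then show ?thesis using N'(2) by auto
      qed simp
    qed
  qed
qed simp

lemma negligible_of_zero_integrals:
  fixes d :: "real \<Rightarrow> real"
  assumes d: "\<And>a b. 0 < a \<Longrightarrow> a \<le> b \<Longrightarrow> d absolutely_integrable_on {a..b}"
    and zero: "\<And>a b. 0 < a \<Longrightarrow> a \<le> b \<Longrightarrow> integral {a..b} d = 0"
  shows "negligible {x \<in> halfline. d x \<noteq> 0}"
proof -
  have "negligible {x \<in> {1 / real (Suc n)..real (Suc n)}. d x \<noteq> 0}" for n
  proof -
    have p: "0 < 1 / real (Suc n)" "1 / real (Suc n) \<le> real (Suc n)"
      by (simp, rule order_trans[of _ 1]) auto
    show ?thesis
      by (rule negligible_of_zero_integrals_Icc[OF d[OF p]])
        (rule zero; use p in \<open>simp add: less_le_trans[OF p(1)]\<close>)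
  qed
  then have "negligible (\<Union>n. {x \<in> {1 / real (Suc n)..real (Suc n)}. d x \<noteq> 0})"
    by (intro negligible_countable_Union) auto
  then show ?thesis
  proof (rule negligible_subset, intro subsetI)
    fix x assume x: "x \<in> {x \<in> halfline. d x \<noteq> 0}"
    obtain n :: nat where n: "max x (1 / x) \<le> real n" using real_arch_simple by blast
    then have "1 / x \<le> real (Suc n)" "x \<le> real (Suc n)" by auto
    then have "1 / real (Suc n) \<le> x" using x by (simp add: field_simps)
    then show "x \<in> (\<Union>n. {x \<in> {1 / real (Suc n)..real (Suc n)}. d x \<noteq> 0})"
      using x \<open>x \<le> real (Suc n)\<close> by (intro UN_I[of n]) auto
  qed
qed

lemma locally_integrable_Icc:
  "locally_integrable f \<Longrightarrow> 0 < a \<Longrightarrow> f absolutely_integrable_on {a..b}"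
  unfolding locally_integrable_def by (auto simp: subset_eq)

lemma test_function_deriv:
  assumes "test_function \<phi>"
  shows "\<And>x. (\<phi> has_real_derivative deriv \<phi> x) (at x)" "continuous_on S (deriv \<phi>)" "continuous_on S \<phi>"
proof -
  have "(deriv ^^ 0) \<phi> differentiable_on UNIV" "(deriv ^^ 1) \<phi> differentiable_on UNIV"
    using assms unfolding test_function_def by blast+
  then have d: "\<phi> differentiable_on UNIV" "deriv \<phi> differentiable_on UNIV" by simp_all
  show "(\<phi> has_real_derivative deriv \<phi> x) (at x)" for x
    using d(1) by (auto simp: differentiable_on_def DERIV_deriv_iff_real_differentiable)
  show "continuous_on S (deriv \<phi>)" "continuous_on S \<phi>"
    using d differentiable_imp_continuous_on continuous_on_subset by blast+
qed

lemma LINT_halfline_Icc: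
  fixes h :: "real \<Rightarrow> real"
  assumes h: "h absolutely_integrable_on {a..b}" and a: "0 < a" and z: "\<And>x. x \<notin> {a..b} \<Longrightarrow> h x = 0"
  shows "(LINT x|lebesgue_on halfline. h x) = integral {a..b} h"
proof -
  have "h absolutely_integrable_on halfline"
  proof (rule absolutely_integrable_spike_set[OF h])
    show "negligible {x \<in> {a..b} - halfline. h x \<noteq> 0}" "negligible {x \<in> halfline - {a..b}. h x \<noteq> 0}"
      by (rule negligible_subset[OF negligible_empty]; use z a in auto)+
  qed
  then have "integrable (lebesgue_on halfline) h"
    by (simp add: absolutely_integrable_imp_integrable)
  then have "(LINT x|lebesgue_on halfline. h x) = integral halfline h"
    by (simp add: lebesgue_integral_eq_integral)
  also have "\<dots> = integral {a..b} h"
  proof (rule integral_spike_set)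
    show "negligible {x \<in> halfline - {a..b}. h x \<noteq> 0}" "negligible {x \<in> {a..b} - halfline. h x \<noteq> 0}"
      by (rule negligible_subset[OF negligible_empty]; use z a in auto)+
  qed
  finally show ?thesis .
qed

text \<open>If G is a primitive of g, then u = f - G has weak derivative 0. By the du Bois-Reymond
  argument u is almost everywhere a constant k, and G + k is the required representative.\<close>

lemma has_weak_deriv_imp_ac_deriv:
  assumes w: "has_weak_deriv f g"
  obtains F where "ac_deriv F g" "negligible {x \<in> halfline. f x \<noteq> F x}"
proof -
  have f: "f absolutely_integrable_on {a..b}" and g: "g absolutely_integrable_on {a..b}" if "0 < a" for a b
    using w that locally_integrable_Icc unfolding has_weak_deriv_def by blast+
  obtain G where G: "ac_deriv G g" by (rule ex_ac_deriv) (rule g)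
  have Gi: "G absolutely_integrable_on {a..b}" if "0 < a" for a b
    by (rule absolutely_integrable_continuous_real[OF ac_deriv_continuous_on_Icc[OF G that]])
  define u where "u x = f x - G x" for x
  have u: "u absolutely_integrable_on {a..b}" if "0 < a" for a b
    unfolding u_def[abs_def] by (rule set_integral_diff(1)[OF f[OF that] Gi[OF that]])
  have orth: "integral {a..b} (\<lambda>x. u x * deriv \<phi> x) = 0"
    if \<phi>: "test_function \<phi>" and a: "0 < a" and out: "\<And>x. x \<le> a \<or> b \<le> x \<Longrightarrow> deriv \<phi> x = 0" for \<phi> a b
  proof -
    obtain K where K: "compact K" "K \<subseteq> halfline" "\<And>x. x \<notin> K \<Longrightarrow> \<phi> x = 0"
      using \<phi> unfolding test_function_def by blast
    \<comment> \<open>An interval [c, d] containing both [a, b] and the support of \<phi>: integrals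
      over the half line reduce to it, and the boundary terms at c and d vanish.\<close>
    have "\<exists>c d. 0 < c \<and> c \<le> a \<and> b \<le> d \<and> c \<le> d \<and> (\<forall>x. x \<le> c \<or> d \<le> x \<longrightarrow> \<phi> x = 0)"
    proof (cases "K = {}")
      case True
      then show ?thesis using K(3) a by (intro exI[of _ a] exI[of _ "max a b"]) auto
    next
      case False
      obtain l where l: "l \<in> K" "\<And>x. x \<in> K \<Longrightarrow> l \<le> x" using compact_attains_inf[OF K(1) False] by blast
      obtain r where r: "r \<in> K" "\<And>x. x \<in> K \<Longrightarrow> x \<le> r" using compact_attains_sup[OF K(1) False] by blast
      have "0 < l" using l(1) K(2) by auto
      have z: "\<phi> x = 0" if "x \<le> min a (l / 2) \<or> max (max a b) (r + 1) \<le> x" for x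
      proof (rule K(3))
        show "x \<notin> K" using that l(2)[of x] r(2)[of x] \<open>0 < l\<close> by auto
      qed
      show ?thesis
      proof (intro exI conjI)
        show "\<forall>x. x \<le> min a (l / 2) \<or> max (max a b) (r + 1) \<le> x \<longrightarrow> \<phi> x = 0" using z by blast
      qed (use a \<open>0 < l\<close> in auto)
    qed
    then obtain c d where cd: "0 < c" "c \<le> a" "b \<le> d" "c \<le> d" "\<And>x. x \<le> c \<or> d \<le> x \<Longrightarrow> \<phi> x = 0" by blast
    note D = test_function_deriv[OF \<phi>]
    have out': "deriv \<phi> x = 0" if "x \<notin> {c..d}" for x
      using out[of x] that cd by auto
    have \<phi>a: "ac_deriv \<phi> (deriv \<phi>)" by (rule ac_deriv_of_has_derivative[OF D(1,2)])
    have fi: "(\<lambda>x. f x * deriv \<phi> x) absolutely_integrable_on {c..d}"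
      by (rule absolutely_integrable_mult_continuous(1)[OF f[OF cd(1)] D(2)])
    have gi: "(\<lambda>x. g x * \<phi> x) absolutely_integrable_on {c..d}"
      by (rule absolutely_integrable_mult_continuous(1)[OF g[OF cd(1)] D(3)])
    have Gd: "(\<lambda>x. G x * deriv \<phi> x) absolutely_integrable_on {c..d}"
      by (rule absolutely_integrable_mult_continuous(1)[OF Gi[OF cd(1)] D(2)])
    have "integral {c..d} (\<lambda>x. f x * deriv \<phi> x) = - integral {c..d} (\<lambda>x. g x * \<phi> x)"
    proof -
      have "(LINT x|lebesgue_on halfline. f x * deriv \<phi> x) = - (LINT x|lebesgue_on halfline. g x * \<phi> x)"
        using w \<phi> by (simp add: has_weak_deriv_def)
      moreover have "(LINT x|lebesgue_on halfline. f x * deriv \<phi> x) = integral {c..d} (\<lambda>x. f x * deriv \<phi> x)"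
        by (rule LINT_halfline_Icc[OF fi cd(1)]) (simp add: out')
      moreover have "(LINT x|lebesgue_on halfline. g x * \<phi> x) = integral {c..d} (\<lambda>x. g x * \<phi> x)"
        by (rule LINT_halfline_Icc[OF gi cd(1)]) (use cd in auto)
      ultimately show ?thesis by simp
    qed
    moreover have "integral {c..d} (\<lambda>x. g x * \<phi> x) + integral {c..d} (\<lambda>x. G x * deriv \<phi> x) = 0"
    proof -
      have "integral {c..d} (\<lambda>x. g x * \<phi> x + G x * deriv \<phi> x) = G d * \<phi> d - G c * \<phi> c"
        using ac_derivD(2)[OF ac_deriv_mult[OF G \<phi>a] cd(1,4)] by simp
      then show ?thesis
        using gi Gd cd(5) by (subst Henstock_Kurzweil_Integration.integral_add[symmetric])
          (auto simp: absolutely_integrable_on_def)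
    qed
    moreover have "integral {c..d} (\<lambda>x. u x * deriv \<phi> x)
        = integral {c..d} (\<lambda>x. f x * deriv \<phi> x) - integral {c..d} (\<lambda>x. G x * deriv \<phi> x)"
      unfolding u_def left_diff_distrib
      by (rule Henstock_Kurzweil_Integration.integral_diff) (use fi Gd in \<open>auto simp: absolutely_integrable_on_def\<close>)
    ultimately have "integral {c..d} (\<lambda>x. u x * deriv \<phi> x) = 0" by simp
    moreover have "integral {a..b} (\<lambda>x. u x * deriv \<phi> x) = integral {c..d} (\<lambda>x. u x * deriv \<phi> x)"
    proof (rule integral_spike_set)
      show "negligible {x \<in> {a..b} - {c..d}. u x * deriv \<phi> x \<noteq> 0}"
        by (rule negligible_subset[OF negligible_empty]) (use cd in auto)
      show "negligible {x \<in> {c..d} - {a..b}. u x * deriv \<phi> x \<noteq> 0}"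
      proof (rule negligible_subset[OF negligible_empty])
        show "{x \<in> {c..d} - {a..b}. u x * deriv \<phi> x \<noteq> 0} \<subseteq> {}"
        proof
          fix x assume x: "x \<in> {x \<in> {c..d} - {a..b}. u x * deriv \<phi> x \<noteq> 0}"
          then have "x \<le> a \<or> b \<le> x" by auto
          from out[OF this] x show "x \<in> {}" by simp
        qed
      qed
    qed
    ultimately show ?thesis by simp
  qed
  define k where "k = integral {1..2} u"
  have "negligible {x \<in> halfline. u x - k \<noteq> 0}"
  proof (rule negligible_of_zero_integrals)
    fix a b :: real assume ab: "0 < a" "a \<le> b"
    show "(\<lambda>x. u x - k) absolutely_integrable_on {a..b}"
      by (intro set_integral_diff(1) u ab) simp
    have "integral {a..b} (\<lambda>x. u x - k) = integral {a..b} u - integral {a..b} (\<lambda>x. k)"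
      using u[OF ab(1), of b] by (intro Henstock_Kurzweil_Integration.integral_diff) (auto simp: absolutely_integrable_on_def)
    also have "integral {a..b} u = (b - a) * k"
      unfolding k_def by (rule du_bois_reymond[OF _ _ ab]) (rule u, assumption, rule orth)
    also have "(b - a) * k - integral {a..b} (\<lambda>x. k) = 0" using ab by simp
    finally show "integral {a..b} (\<lambda>x. u x - k) = 0" .
  qed
  moreover have "ac_deriv (\<lambda>x. G x + k) g"
    using G by (simp add: ac_deriv_def)
  ultimately show ?thesis
    by (intro that[of "\<lambda>x. G x + k"]) (simp_all add: u_def diff_eq_eq add.commute)
qed

text \<open>The disagreement set is open, and a nonempty open set is not negligible. This ties the
  representative to the actual values of \<open>v\<close> at the nodes, on which interpolation
  depends.\<close>

lemma continuous_eq_of_ae_eq: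
  fixes f F :: "real \<Rightarrow> real"
  assumes "continuous_on halfline f" "continuous_on halfline F" "negligible {x \<in> halfline. f x \<noteq> F x}" and x: "0 < x"
  shows "f x = F x"
proof (rule ccontr)
  assume ne: "f x \<noteq> F x"
  have "open (halfline \<inter> (\<lambda>x. f x - F x) -` (- {0}))"
    by (rule continuous_open_preimage) (use assms in \<open>auto intro!: continuous_intros\<close>)
  moreover have "halfline \<inter> (\<lambda>x. f x - F x) -` (- {0}) = {x \<in> halfline. f x \<noteq> F x}" by auto
  ultimately show False using open_not_negligible[of "{x \<in> halfline. f x \<noteq> F x}"] assms(3) ne x by auto
qed

subsection \<open>The change of variables\<close>

locale laguerre_map =
  fixes \<beta> \<gamma> :: real
  assumes \<beta>: "-1 < \<beta>" and \<gamma>: "0 < \<gamma>"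
begin

definition X :: "real \<Rightarrow> real" where "X t = (t / (\<beta> + 1)) powr (1 / \<gamma>)"
text \<open>The derivative of \<open>X\<close>, written as the factor of \<open>mapped_deriv\<close>
  at \<open>X t\<close>: the chain rule along \<open>X\<close> then produces the mapped
  derivative.\<close>

definition X' :: "real \<Rightarrow> real" where "X' t = X t powr (1 - \<gamma>) / (\<gamma> * (\<beta> + 1))"
definition Y :: "real \<Rightarrow> real" where "Y x = (\<beta> + 1) * x powr \<gamma>"

lemma X_pos: "0 < t \<Longrightarrow> 0 < X t" using \<beta> by (simp add: X_def)
lemma Y_pos: "0 < x \<Longrightarrow> 0 < Y x" using \<beta> by (simp add: Y_def)
lemma X'_pos: "0 < t \<Longrightarrow> 0 < X' t" using X_pos[of t] \<beta> \<gamma> by (simp add: X'_def)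

lemma X_powr: "0 < t \<Longrightarrow> X t powr a = (t / (\<beta> + 1)) powr (a / \<gamma>)"
  by (simp add: X_def powr_powr)

lemma X_powr_gamma: "0 < t \<Longrightarrow> X t powr \<gamma> = t / (\<beta> + 1)"
  using \<beta> \<gamma> by (simp add: X_powr)

lemma Y_X: "0 < t \<Longrightarrow> Y (X t) = t" using \<beta> by (simp add: Y_def X_powr_gamma)
lemma X_Y: "0 < x \<Longrightarrow> X (Y x) = x" using \<beta> \<gamma> by (simp add: X_def Y_def powr_powr)

lemma X_mono: "0 \<le> s \<Longrightarrow> s \<le> t \<Longrightarrow> X s \<le> X t"
  unfolding X_def using \<beta> \<gamma> by (intro powr_mono2 divide_right_mono) auto

lemma Y_mono: "0 \<le> s \<Longrightarrow> s \<le> t \<Longrightarrow> Y s \<le> Y t"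
  unfolding Y_def using \<beta> \<gamma> by (intro mult_left_mono powr_mono2) auto

lemma inj_on_X: "inj_on X halfline"
  by (rule inj_on_inverseI[of _ Y]) (simp add: Y_X)

lemma X_halfline: "X ` halfline = halfline"
proof
  show "X ` halfline \<subseteq> halfline" using X_pos by auto
  show "halfline \<subseteq> X ` halfline"
  proof
    fix x :: real assume "x \<in> halfline"
    then show "x \<in> X ` halfline" using X_Y[of x] Y_pos[of x] by (intro image_eqI[of _ _ "Y x"]) auto
  qed
qed

lemma X_Icc:
  assumes "0 < a" "a \<le> b" shows "X ` {a..b} = {X a..X b}"
proof
  show "X ` {a..b} \<subseteq> {X a..X b}" using X_mono assms by auto
  show "{X a..X b} \<subseteq> X ` {a..b}"
  proof
    fix x assume x: "x \<in> {X a..X b}"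
    then have x0: "0 < x" using X_pos[OF assms(1)] by auto
    have "a \<le> Y x" "Y x \<le> b"
      using Y_mono[of "X a" x] Y_mono[of x "X b"] x x0 X_pos[OF assms(1)] Y_X[of a] Y_X[of b] assms by auto
    then show "x \<in> X ` {a..b}" using X_Y[OF x0] by (intro image_eqI[of _ _ "Y x"]) auto
  qed
qed

lemma has_derivative_X:
  assumes t: "0 < t" shows "(X has_real_derivative X' t) (at t)"
proof -
  have b: "0 < t / (\<beta> + 1)" using t \<beta> by simp
  have "(X has_real_derivative (1 / \<gamma>) * (t / (\<beta> + 1)) powr (1 / \<gamma> - 1) * (1 / (\<beta> + 1))) (at t)"
    unfolding X_def[abs_def]
    by (rule DERIV_chain2[where f = "\<lambda>z. z powr (1 / \<gamma>)" and g = "\<lambda>t. t / (\<beta> + 1)", OF has_real_derivative_powr[OF b] DERIV_cdivide[OF DERIV_ident]])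
  also have "(1 / \<gamma>) * (t / (\<beta> + 1)) powr (1 / \<gamma> - 1) * (1 / (\<beta> + 1)) = X' t"
  proof -
    have "\<beta> + 1 \<noteq> 0" using \<beta> by simp
    then show ?thesis using \<gamma> by (simp add: X'_def X_powr[OF t] diff_divide_distrib)
  qed
  finally show ?thesis .
qed

lemma change_of_variables:
  assumes S: "S \<subseteq> halfline" "S \<in> sets lebesgue"
  shows "(\<lambda>t. X' t * h (X t)) absolutely_integrable_on S \<longleftrightarrow> h absolutely_integrable_on X ` S"
    and "h absolutely_integrable_on X ` S \<Longrightarrow> integral S (\<lambda>t. X' t * h (X t)) = integral (X ` S) h"
proof -
  have *: "(\<lambda>t. \<bar>X' t\<bar> * h (X t)) absolutely_integrable_on S \<and> integral S (\<lambda>t. \<bar>X' t\<bar> * h (X t)) = b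
     \<longleftrightarrow> h absolutely_integrable_on X ` S \<and> integral (X ` S) h = b" for b
  proof (rule has_absolute_integral_change_of_variables_1'[OF S(2)])
    show "(X has_real_derivative X' t) (at t within S)" if "t \<in> S" for t
      by (rule has_field_derivative_at_within, rule has_derivative_X) (use that S(1) in auto)
    show "inj_on X S" by (rule inj_on_subset[OF inj_on_X S(1)])
  qed
  have abs: "\<bar>X' t\<bar> * h (X t) = X' t * h (X t)" if "t \<in> S" for t
    using X'_pos[of t] S(1) that by auto
  have i: "integral S (\<lambda>t. \<bar>X' t\<bar> * h (X t)) = integral S (\<lambda>t. X' t * h (X t))"
    by (rule integral_cong) (rule abs)
  have a: "(\<lambda>t. \<bar>X' t\<bar> * h (X t)) absolutely_integrable_on S \<longleftrightarrow> (\<lambda>t. X' t * h (X t)) absolutely_integrable_on S"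
    by (rule absolutely_integrable_spike_eq[OF negligible_empty]) (simp add: abs)
  show "(\<lambda>t. X' t * h (X t)) absolutely_integrable_on S \<longleftrightarrow> h absolutely_integrable_on X ` S"
    using *[of "integral S (\<lambda>t. \<bar>X' t\<bar> * h (X t))"] *[of "integral (X ` S) h"] a by auto
  show "integral S (\<lambda>t. X' t * h (X t)) = integral (X ` S) h" if "h absolutely_integrable_on X ` S"
    using *[of "integral (X ` S) h"] that i by simp
qed

lemma ac_deriv_X:
  assumes F: "ac_deriv F g" shows "ac_deriv (\<lambda>t. F (X t)) (\<lambda>t. X' t * g (X t))"
  unfolding ac_deriv_def
proof (intro allI impI)
  fix a b :: real assume ab: "0 < a" "a \<le> b"
  have S: "{a..b} \<subseteq> halfline" "{a..b} \<in> sets lebesgue" using ab by auto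
  note g = ac_derivD[OF F X_pos[OF ab(1)] X_mono[OF less_imp_le[OF ab(1)] ab(2)]]
  show "(\<lambda>t. X' t * g (X t)) absolutely_integrable_on {a..b} \<and> F (X b) - F (X a) = integral {a..b} (\<lambda>t. X' t * g (X t))"
    using change_of_variables(1)[OF S, of g] change_of_variables(2)[OF S, of g] g(1)
    unfolding X_Icc[OF ab] g(2) by simp
qed

lemma negligible_X_vimage:
  assumes N: "negligible N" "N \<subseteq> halfline" shows "negligible {t \<in> halfline. X t \<in> N}"
proof (rule negligible_subset)
  have "Y differentiable (at x within N)" if "x \<in> N" for x
  proof -
    have "0 < x" using that N(2) by auto
    then have "((\<lambda>x. (\<beta> + 1) * x powr \<gamma>) has_real_derivative (\<beta> + 1) * (\<gamma> * x powr (\<gamma> - 1))) (at x within N)"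
      by (intro has_field_derivative_at_within[OF DERIV_cmult] has_real_derivative_powr)
    then show ?thesis
      unfolding Y_def[abs_def] has_field_derivative_def by (rule differentiableI)
  qed
  then show "negligible (Y ` N)"
    by (intro negligible_differentiable_image_negligible N) (auto simp: differentiable_on_def)
  show "{t \<in> halfline. X t \<in> N} \<subseteq> Y ` N"
  proof
    fix t assume "t \<in> {t \<in> halfline. X t \<in> N}"
    then show "t \<in> Y ` N" by (intro image_eqI[of _ _ "X t"]) (simp_all add: Y_X)
  qed
qed

text \<open>Shifting both parameters by the same amount keeps their difference, so the single factor
  \<open>X t powr (- \<eta>)\<close> turns all the shifted weights into Laguerre weights and removes
  \<sigma>.\<close>

lemma weight_X:
  assumes t: "0 < t" and d: "\<theta>' - \<sigma>' = 2 * \<eta> / \<gamma>"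
  shows "X' t * ((v (X t))\<^sup>2 * weight \<theta>' \<sigma>' \<gamma> \<beta> (X t)) = (X t powr (- \<eta>) * v (X t))\<^sup>2 * wt \<theta>' t"
proof -
  let ?x = "X t" and ?B = "\<beta> + 1"
  have x: "0 < ?x" and B: "0 < ?B" using X_pos[OF t] \<beta> by auto
  have tB: "?B * ?x powr \<gamma> = t" using Y_X[OF t] by (simp only: Y_def)
  then have e: "exp (- ?B * ?x powr \<gamma>) = exp (- t)" by (simp only: mult_minus_left)
  have "wt \<theta>' t = (?B * ?x powr \<gamma>) powr \<theta>' * exp (- t)" by (simp only: wt_def tB)
  also have "\<dots> = ?B powr \<theta>' * ?x powr (\<gamma> * \<theta>') * exp (- t)"
    using B x by (simp add: powr_mult powr_powr)
  finally have r: "wt \<theta>' t = ?B powr \<theta>' * ?x powr (\<gamma> * \<theta>') * exp (- t)" .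
  have "X' t * weight \<theta>' \<sigma>' \<gamma> \<beta> ?x = ?B powr \<theta>' * (?x powr (1 - \<gamma>) * ?x powr (\<gamma> * (\<sigma>' + 1) - 1)) * exp (- t)"
    unfolding X'_def weight_def e using B \<gamma> by (simp add: powr_add[of ?B \<theta>' 1])
  also have "?x powr (1 - \<gamma>) * ?x powr (\<gamma> * (\<sigma>' + 1) - 1) = ?x powr (\<gamma> * \<sigma>')"
    by (simp add: powr_add[symmetric] algebra_simps)
  also have "\<gamma> * \<sigma>' = \<gamma> * \<theta>' - 2 * \<eta>" using d \<gamma> by (simp add: field_simps)
  also have "?x powr (\<gamma> * \<theta>' - 2 * \<eta>) = ?x powr (- \<eta>) * ?x powr (- \<eta>) * ?x powr (\<gamma> * \<theta>')"
    by (simp add: powr_add[symmetric])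
  finally have "X' t * weight \<theta>' \<sigma>' \<gamma> \<beta> ?x = (?x powr (- \<eta>))\<^sup>2 * wt \<theta>' t"
    unfolding r by (simp add: power2_eq_square)
  then show ?thesis by (simp add: power_mult_distrib mult.assoc mult.left_commute)
qed

lemma weighted_L2_iff:
  assumes d: "\<theta>' - \<sigma>' = 2 * \<eta> / \<gamma>"
  shows "integrable (lebesgue_on halfline) (\<lambda>x. (v x)\<^sup>2 * weight \<theta>' \<sigma>' \<gamma> \<beta> x) \<longleftrightarrow>
     (\<lambda>t. (X t powr (- \<eta>) * v (X t))\<^sup>2 * wt \<theta>' t) absolutely_integrable_on halfline"
proof -
  let ?h = "\<lambda>x. (v x)\<^sup>2 * weight \<theta>' \<sigma>' \<gamma> \<beta> x"
  have "integrable (lebesgue_on halfline) ?h \<longleftrightarrow> ?h absolutely_integrable_on X ` halfline"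
    unfolding X_halfline set_integrable_def by (subst integrable_restrict_space) auto
  also have "\<dots> \<longleftrightarrow> (\<lambda>t. X' t * ?h (X t)) absolutely_integrable_on halfline"
    by (rule change_of_variables(1)[symmetric]) auto
  also have "\<dots> \<longleftrightarrow> (\<lambda>t. (X t powr (- \<eta>) * v (X t))\<^sup>2 * wt \<theta>' t) absolutely_integrable_on halfline"
    by (rule absolutely_integrable_spike_eq[OF negligible_empty]) (simp add: weight_X[OF _ d])
  finally show ?thesis .
qed

lemma weighted_norm_eq:
  assumes d: "\<theta>' - \<sigma>' = 2 * \<eta> / \<gamma>"
    and i: "(\<lambda>t. (X t powr (- \<eta>) * v (X t))\<^sup>2 * wt \<theta>' t) absolutely_integrable_on halfline"
  shows "weighted_norm (weight \<theta>' \<sigma>' \<gamma> \<beta>) v = sqrt (sq \<theta>' (\<lambda>t. X t powr (- \<eta>) * v (X t)))"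
proof -
  let ?h = "\<lambda>x. (v x)\<^sup>2 * weight \<theta>' \<sigma>' \<gamma> \<beta> x"
  have int: "integrable (lebesgue_on halfline) ?h" using weighted_L2_iff[OF d] i by blast
  then have h: "?h absolutely_integrable_on X ` halfline"
    unfolding X_halfline set_integrable_def by (subst (asm) integrable_restrict_space) auto
  have "(LINT x|lebesgue_on halfline. ?h x) = integral (X ` halfline) ?h"
    unfolding X_halfline by (rule lebesgue_integral_eq_integral[OF int]) simp
  also have "\<dots> = integral halfline (\<lambda>t. X' t * ?h (X t))"
    by (rule change_of_variables(2)[OF _ _ h, symmetric]) auto
  also have "\<dots> = sq \<theta>' (\<lambda>t. X t powr (- \<eta>) * v (X t))"
    unfolding sq_def by (rule integral_cong) (simp add: weight_X[OF _ d])
  finally show ?thesis by (simp add: weighted_norm_def)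
qed

lemma L2_ae_eq:
  assumes G: "G \<in> borel_measurable (lebesgue_on halfline)"
    and i: "(\<lambda>t. (F t)\<^sup>2 * wt \<alpha> t) absolutely_integrable_on halfline"
    and N: "negligible N" "\<And>t. 0 < t \<Longrightarrow> t \<notin> N \<Longrightarrow> G t = F t"
  shows "L2 \<alpha> G"
  unfolding L2_def
  by (intro conjI G absolutely_integrable_spike[OF i N(1)]) (simp add: N(2))

text \<open>The continuous representatives of \<open>x\<^sup>-\<^sup>\<eta> D\<^sup>r v\<close> in the variable \<open>t = (\<beta> + 1) x\<^sup>\<gamma>\<close>, in which
  \<open>D\<close> becomes \<open>d/dt\<close>.\<close>

lemma scaled_deriv_chain:
  assumes \<eta>: "\<eta> = \<gamma> * (\<theta> - \<sigma>) / 2" and m: "1 \<le> m"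
    and v: "continuous_on halfline v" "v \<in> weighted_L2 (weight \<theta> \<sigma> \<gamma> \<beta>)"
    and diff: "\<And>r. r < m \<Longrightarrow> scaled_differentiable \<theta> \<sigma> \<gamma> ((scaled_deriv \<theta> \<sigma> \<gamma> \<beta> ^^ r) v)"
    and L2: "\<And>r. 1 \<le> r \<Longrightarrow> r \<le> m \<Longrightarrow>
      (scaled_deriv \<theta> \<sigma> \<gamma> \<beta> ^^ r) v \<in> weighted_L2 (weight (\<theta> + real r) (\<sigma> + real r) \<gamma> \<beta>)"
  obtains c :: "nat \<Rightarrow> real \<Rightarrow> real"
  where "\<And>r. r < m \<Longrightarrow> ac_deriv (c r) (c (Suc r))" "\<And>r. r \<le> m \<Longrightarrow> L2 (\<theta> + real r) (c r)"
    "\<And>t. 0 < t \<Longrightarrow> c 0 t = X t powr (- \<eta>) * v (X t)"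
    "c m = (\<lambda>t. X t powr (- \<eta>) * (scaled_deriv \<theta> \<sigma> \<gamma> \<beta> ^^ m) v (X t))"
proof -
  define u where "u r = (scaled_deriv \<theta> \<sigma> \<gamma> \<beta> ^^ r) v" for r
  define f where "f r x = x powr (- \<eta>) * u r x" for r x
  have "\<forall>r. \<exists>F. r < m \<longrightarrow> ac_deriv F (weak_deriv (f r)) \<and> negligible {x \<in> halfline. f r x \<noteq> F x}"
  proof
    fix r
    show "\<exists>F. r < m \<longrightarrow> ac_deriv F (weak_deriv (f r)) \<and> negligible {x \<in> halfline. f r x \<noteq> F x}"
    proof (cases "r < m")
      case True
      have "weakly_differentiable (f r)"
        using diff[OF True] unfolding scaled_differentiable_def f_def[abs_def] u_def \<eta> .
      then have "has_weak_deriv (f r) (weak_deriv (f r))"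
        unfolding weakly_differentiable_def weak_deriv_def by (rule someI_ex)
      then show ?thesis by (rule has_weak_deriv_imp_ac_deriv) blast
    qed simp
  qed
  then obtain F where F: "\<And>r. r < m \<Longrightarrow> ac_deriv (F r) (weak_deriv (f r))"
    "\<And>r. r < m \<Longrightarrow> negligible {x \<in> halfline. f r x \<noteq> F r x}" by metis
  \<comment> \<open>Below order m the continuous representative is taken; at order m the given
    function is kept, since it is the one whose norms occur in the theorem.\<close>
  define c where "c r t = (if r < m then F r (X t) else f r (X t))" for r t
  \<comment> \<open>This holds at every t > 0: both sides contain the same chosen weak
    derivative.\<close>
  have step: "X' t * weak_deriv (f r) (X t) = f (Suc r) (X t)" if "0 < t" for r t
  proof -
    have "f (Suc r) (X t) = X t powr (- \<eta>) * (X t powr \<eta> * (X t powr (1 - \<gamma>) / (\<gamma> * (\<beta> + 1)) * weak_deriv (f r) (X t)))"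
      unfolding f_def[of "Suc r"] u_def by (simp add: scaled_deriv_def mapped_deriv_def \<eta>[symmetric] f_def[abs_def] u_def)
    also have "\<dots> = X t powr (- \<eta>) * X t powr \<eta> * (X' t * weak_deriv (f r) (X t))"
      by (simp add: X'_def)
    also have "X t powr (- \<eta>) * X t powr \<eta> = 1" using X_pos[OF that] by (simp add: powr_minus)
    finally show ?thesis by simp
  qed
  have neg: "\<exists>N. negligible N \<and> (\<forall>t. 0 < t \<longrightarrow> t \<notin> N \<longrightarrow> c r t = f r (X t))" for r
  proof (cases "r < m")
    case True
    let ?N = "{t \<in> halfline. X t \<in> {x \<in> halfline. f r x \<noteq> F r x}}"
    have "negligible ?N" by (rule negligible_X_vimage[OF F(2)[OF True]]) auto
    then show ?thesis using True X_pos by (intro exI[of _ ?N]) (auto simp: c_def)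
  next
    case False
    then show ?thesis by (intro exI[of _ "{}"]) (simp add: c_def)
  qed
  have ac: "ac_deriv (c r) (c (Suc r))" if "r < m" for r
  proof -
    obtain N where N: "negligible N" "\<And>t. 0 < t \<Longrightarrow> t \<notin> N \<Longrightarrow> c (Suc r) t = f (Suc r) (X t)"
      using neg by blast
    have "ac_deriv (c r) (\<lambda>t. X' t * weak_deriv (f r) (X t))"
      using ac_deriv_X[OF F(1)[OF that]] that by (simp add: c_def[abs_def])
    then show ?thesis by (rule ac_deriv_spike[OF _ N(1)]) (simp add: N(2) step)
  qed
  have L: "L2 (\<theta> + real r) (c r)" if r: "r \<le> m" for r
  proof -
    obtain N where N: "negligible N" "\<And>t. 0 < t \<Longrightarrow> t \<notin> N \<Longrightarrow> c r t = f r (X t)" using neg by blast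
    have "c r \<in> borel_measurable (lebesgue_on halfline)"
    proof (cases "r < m")
      case True
      then show ?thesis using ac_deriv_measurable_fun[OF ac] by blast
    next
      case False
      then have "r = Suc (m - 1)" "m - 1 < m" using r m by auto
      then show ?thesis using ac_deriv_measurable[OF ac[of "m - 1"]] by metis
    qed
    moreover have "u r \<in> weighted_L2 (weight (\<theta> + real r) (\<sigma> + real r) \<gamma> \<beta>)"
      using L2[of r] v(2) r by (cases "r = 0") (auto simp: u_def)
    then have "(\<lambda>t. (f r (X t))\<^sup>2 * wt (\<theta> + real r) t) absolutely_integrable_on halfline"
      unfolding f_def using weighted_L2_iff[of "\<theta> + real r" "\<sigma> + real r" \<eta> "u r"] \<gamma>
      by (simp add: weighted_L2_def \<eta>)
    ultimately show ?thesis by (rule L2_ae_eq[OF _ _ N])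
  qed
  have "f 0 x = F 0 x" if "0 < x" for x
  proof (rule continuous_eq_of_ae_eq[OF _ _ F(2) that])
    show "0 < m" using m by simp
    show "continuous_on halfline (F 0)" by (rule ac_deriv_continuous[OF F(1)]) (use m in simp)
    show "continuous_on halfline (f 0)"
      unfolding f_def[abs_def] u_def by (simp, intro continuous_intros v(1)) auto
  qed
  then have "c 0 t = X t powr (- \<eta>) * v (X t)" if "0 < t" for t
    using m X_pos[OF that] by (simp add: c_def f_def u_def)
  then show ?thesis
    by (intro that[of c] ac L) (simp_all add: c_def[abs_def] f_def u_def)
qed

text \<open>Since \<open>X t powr \<gamma>\<close> is t / (\<beta> + 1), the scaling cancels in
  every quotient of the Lagrange basis, and what remains is ordinary Lagrange interpolation at the
  Laguerre zeros.\<close>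

lemma interp_X:
  assumes \<theta>: "-1 < \<theta>" and \<eta>: "\<eta> = \<gamma> * (\<theta> - \<sigma>) / 2"
  obtains I where "deg_lt (Suc M) I"
    "\<And>z. z \<in> lag_zeros (Suc M) \<theta> \<Longrightarrow> poly I z = X z powr (- \<eta>) * v (X z)"
    "\<And>t. 0 < t \<Longrightarrow> X t powr (- \<eta>) * interp \<theta> \<sigma> \<gamma> \<beta> M v (X t) = poly I t"
proof -
  define y where "y = laguerre_zero \<theta> M"
  let ?Z = "lag_zeros (Suc M) \<theta>"
  have y_eq: "y i = sorted_list_of_set ?Z ! i" for i
    by (simp add: y_def laguerre_zero_def lag_zeros_def)
  have len: "length (sorted_list_of_set ?Z) = Suc M" by (simp add: card_lag_zeros[OF \<theta>])
  have inj: "inj_on y {..M}"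
    unfolding y_eq[abs_def] by (rule inj_onI) (use len in \<open>auto simp: nth_eq_iff_index_eq\<close>)
  have img: "y ` {..M} = ?Z"
  proof -
    have "y ` {..M} = set (sorted_list_of_set ?Z)"
      unfolding set_conv_nth len y_eq[abs_def] by (auto simp: less_Suc_eq_le)
    then show ?thesis using finite_lag_zeros by simp
  qed
  have ypos: "0 < y i" if "i \<le> M" for i using img that by (auto simp: lag_zeros_def)
  have node: "interp_node \<theta> \<gamma> \<beta> M i = X (y i)" for i
    by (simp add: interp_node_def X_def y_def)
  define w where "w i = X (y i) powr (- \<eta>) * v (X (y i))" for i
  define P where "P i = (\<Prod>r\<in>{..M} - {i}. smult (1 / (y i - y r)) [:- y r, 1:])" for i
  define I where "I = (\<Sum>i\<le>M. smult (w i) (P i))"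
  have PP: "poly (P i) t = (\<Prod>r\<in>{..M} - {i}. (t - y r) / (y i - y r))" for i t
    unfolding P_def by (simp add: poly_prod diff_divide_distrib)
  have dP: "deg_lt (Suc M) (P i)" if "i \<le> M" for i
  proof -
    have "degree (P i) \<le> (\<Sum>r\<in>{..M} - {i}. degree (smult (1 / (y i - y r)) [:- y r, 1:]))"
      unfolding P_def using degree_prod_sum_le[of "{..M} - {i}" "\<lambda>r. smult (1 / (y i - y r)) [:- y r, 1:]"]
      by (simp add: o_def)
    also have "\<dots> \<le> (\<Sum>r\<in>{..M} - {i}. 1)" by (rule sum_mono) (auto intro: order_trans[OF degree_smult_le])
    also have "\<dots> = M" using that by simp
    finally show ?thesis using deg_lt_mono[OF deg_lt_degree] by simp
  qed
  have dI: "deg_lt (Suc M) I"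
    unfolding I_def deg_lt_def coeff_sum using dP by (auto simp: deg_lt_def)
  have Iz: "poly I z = X z powr (- \<eta>) * v (X z)" if z: "z \<in> ?Z" for z
  proof -
    obtain j where j: "j \<le> M" "z = y j" using z img by auto
    have "poly (P i) (y j) = (if i = j then 1 else 0)" if "i \<le> M" for i
    proof (cases "i = j")
      case True
      have "(y j - y r) / (y i - y r) = 1" if "r \<in> {..M} - {i}" for r
      proof -
        have "y r \<noteq> y j" using inj_onD[OF inj, of r j] that j(1) True by auto
        then show ?thesis using True by simp
      qed
      then show ?thesis unfolding PP using True by (simp add: prod.neutral)
    next
      case False
      then show ?thesis unfolding PP using j(1) by (auto intro!: prod_zero)
    qed
    then have "poly I (y j) = (\<Sum>i\<le>M. if i = j then w i else 0)"
      unfolding I_def poly_sum by (intro sum.cong) auto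
    also have "\<dots> = w j" using j(1) by simp
    finally show ?thesis using j(2) by (simp add: w_def)
  qed
  have It: "X t powr (- \<eta>) * interp \<theta> \<sigma> \<gamma> \<beta> M v (X t) = poly I t" if t: "0 < t" for t
  proof -
    have q: "(X t powr \<gamma> - X (y r) powr \<gamma>) / (X (y i) powr \<gamma> - X (y r) powr \<gamma>) = (t - y r) / (y i - y r)"
      if "i \<le> M" "r \<le> M" for i r
      using \<beta> t ypos[OF that(1)] ypos[OF that(2)]
      by (simp add: X_powr_gamma diff_divide_distrib[symmetric])
    have "interp \<theta> \<sigma> \<gamma> \<beta> M v (X t) = (\<Sum>i\<le>M. v (X (y i)) * (X t powr \<eta> / X (y i) powr \<eta>) *
        (\<Prod>r\<in>{..M} - {i}. (X t powr \<gamma> - X (y r) powr \<gamma>) / (X (y i) powr \<gamma> - X (y r) powr \<gamma>)))"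
      unfolding interp_def Let_def node \<eta> ..
    also have "\<dots> = (\<Sum>i\<le>M. X t powr \<eta> * (w i * poly (P i) t))"
    proof (rule sum.cong[OF refl])
      fix i assume i: "i \<in> {..M}"
      have "(\<Prod>r\<in>{..M} - {i}. (X t powr \<gamma> - X (y r) powr \<gamma>) / (X (y i) powr \<gamma> - X (y r) powr \<gamma>)) = poly (P i) t"
        unfolding PP by (rule prod.cong[OF refl]) (use q i in auto)
      then show "v (X (y i)) * (X t powr \<eta> / X (y i) powr \<eta>) *
        (\<Prod>r\<in>{..M} - {i}. (X t powr \<gamma> - X (y r) powr \<gamma>) / (X (y i) powr \<gamma> - X (y r) powr \<gamma>)) = X t powr \<eta> * (w i * poly (P i) t)"
        by (simp add: w_def powr_minus divide_inverse)
    qed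
    also have "\<dots> = X t powr \<eta> * poly I t" by (simp add: I_def poly_sum sum_distrib_left)
    finally show ?thesis using X_pos[OF t] by (simp add: powr_minus)
  qed
  show ?thesis by (rule that[OF dI Iz It])
qed

end

section \<open>Assembly of the estimate\<close>

theorem theorem3p2:
  fixes \<mu> :: nat and \<theta> \<sigma> \<beta> \<gamma> :: real
  assumes "\<mu> \<ge> 1" and "\<theta> > -1" and "\<beta> > -1" and "0 < \<gamma>" and "\<gamma> < 1"
  shows "\<exists>C>0. \<forall>M::nat. \<forall>v :: real \<Rightarrow> real. \<forall>m::nat.
    M \<ge> 1 \<longrightarrow> m = min \<mu> (M + 1) \<longrightarrow>
    continuous_on halfline v \<longrightarrow>
    v \<in> space_A \<theta> \<sigma> \<gamma> \<beta> \<mu> \<longrightarrow>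
    scaled_deriv \<theta> \<sigma> \<gamma> \<beta> v \<in> space_A \<theta> \<sigma> \<gamma> \<beta> (\<mu> - 1) \<longrightarrow>
    weighted_norm (weight \<theta> \<sigma> \<gamma> \<beta>) (\<lambda>x. interp \<theta> \<sigma> \<gamma> \<beta> M v x - v x)
      \<le> C * sqrt (fact (M + 1 - m) / fact M) *
        (weighted_norm (weight (\<theta> + real m - 1) (\<sigma> + real m - 1) \<gamma> \<beta>)
           ((scaled_deriv \<theta> \<sigma> \<gamma> \<beta> ^^ m) v)
         + 2 * sqrt (ln (real M)) *
           weighted_norm (weight (\<theta> + real m) (\<sigma> + real m) \<gamma> \<beta>)
             ((scaled_deriv \<theta> \<sigma> \<gamma> \<beta> ^^ m) v))"
proof -
  interpret laguerre_map \<beta> \<gamma> by unfold_locales (use assms in auto)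
  have \<theta>: "-1 < \<theta>" "-1 < \<theta> + 1" using assms by auto
  obtain C1 where C1: "0 \<le> C1"
    "\<And>F f I. ac_deriv F f \<Longrightarrow> L2 \<theta> F \<Longrightarrow> L2 \<theta> f \<Longrightarrow> deg_lt 2 I \<Longrightarrow>
      (\<And>z. z \<in> lag_zeros 2 \<theta> \<Longrightarrow> poly I z = F z) \<Longrightarrow> sq \<theta> (\<lambda>t. poly I t - F t) \<le> C1 * sq \<theta> f"
    by (rule interpolation_error_le_one[OF \<theta>(1)]) blast
  obtain C2 where C2: "0 \<le> C2"
    "\<And>F f. ac_deriv F f \<Longrightarrow> L2 (\<theta> + 1) F \<Longrightarrow> L2 (\<theta> + 1) f \<Longrightarrow> F 1 = 0 \<Longrightarrow> sq (\<theta> + 1) F \<le> C2 * sq (\<theta> + 1) f"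
    by (rule hardy_same_weight[OF \<theta>(2) zero_less_one]) blast
  \<comment> \<open>One summand for each case: M \<ge> 2, then M = 1 with m = 1, and M = 1 with m =
    2.\<close>
  define C where "C = 1 / (2 * sqrt (ln 2)) + sqrt C1 + sqrt C2"
  have ln2: "0 < sqrt (ln (2 :: real))" by simp
  have C: "0 < C" "1 / (2 * sqrt (ln 2)) \<le> C" "sqrt C1 \<le> C" "sqrt C2 \<le> C"
    using C1(1) C2(1) ln2 by (auto simp: C_def add_pos_nonneg)
  define \<eta> where "\<eta> = \<gamma> * (\<theta> - \<sigma>) / 2"
  have shift: "(\<theta> + k) - (\<sigma> + k) = 2 * \<eta> / \<gamma>" for k using \<gamma> by (simp add: \<eta>_def)
  let ?D = "scaled_deriv \<theta> \<sigma> \<gamma> \<beta>"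
  show ?thesis
  proof (intro exI[of _ C] conjI allI impI C(1))
    fix M m :: nat and v :: "real \<Rightarrow> real"
    assume M: "1 \<le> M" and m_def: "m = min \<mu> (M + 1)" and v: "continuous_on halfline v"
      and vA: "v \<in> space_A \<theta> \<sigma> \<gamma> \<beta> \<mu>" and DA: "?D v \<in> space_A \<theta> \<sigma> \<gamma> \<beta> (\<mu> - 1)"
    have m: "1 \<le> m" "m \<le> Suc M" "m \<le> \<mu>" using assms(1) M by (auto simp: m_def)
    have vL2: "v \<in> weighted_L2 (weight \<theta> \<sigma> \<gamma> \<beta>)" using vA by (simp add: space_A_def)
    have diff: "scaled_differentiable \<theta> \<sigma> \<gamma> ((?D ^^ r) v)" if "r < m" for r
    proof -
      have "Suc r \<in> {1..\<mu>}" using that m by auto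
      then show ?thesis using vA by (auto simp: space_A_def dest: bspec[of _ _ "Suc r"])
    qed
    have DL2: "(?D ^^ r) v \<in> weighted_L2 (weight (\<theta> + real r) (\<sigma> + real r) \<gamma> \<beta>)" if "1 \<le> r" "r \<le> m" for r
      using vA that m by (simp add: space_A_def)
    obtain c where c: "\<And>r. r < m \<Longrightarrow> ac_deriv (c r) (c (Suc r))" "\<And>r. r \<le> m \<Longrightarrow> L2 (\<theta> + real r) (c r)"
      "\<And>t. 0 < t \<Longrightarrow> c 0 t = X t powr (- \<eta>) * v (X t)"
      "c m = (\<lambda>t. X t powr (- \<eta>) * (?D ^^ m) v (X t))"
      using scaled_deriv_chain[OF \<eta>_def m(1) v vL2 diff DL2] by blast
    obtain I where I: "deg_lt (Suc M) I"
      "\<And>z. z \<in> lag_zeros (Suc M) \<theta> \<Longrightarrow> poly I z = X z powr (- \<eta>) * v (X z)"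
      "\<And>t. 0 < t \<Longrightarrow> X t powr (- \<eta>) * interp \<theta> \<sigma> \<gamma> \<beta> M v (X t) = poly I t"
      using interp_X[OF \<theta>(1) \<eta>_def] by blast
    have Iz: "poly I z = c 0 z" if "z \<in> lag_zeros (Suc M) \<theta>" for z
      using I(2)[OF that] c(3)[of z] that by (simp add: lag_zeros_def)
    let ?e = "\<lambda>t. poly I t - c 0 t" and ?err = "\<lambda>x. interp \<theta> \<sigma> \<gamma> \<beta> M v x - v x"
    have c0: "L2 \<theta> (c 0)" using c(2)[of 0] by simp
    have eL2: "L2 \<theta> ?e" by (intro L2_diff L2_poly \<theta>(1) c0)
    have e_eq: "X t powr (- \<eta>) * ?err (X t) = ?e t" if "0 < t" for t
      using I(3)[OF that] c(3)[OF that] by (simp add: right_diff_distrib)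
    have "(\<lambda>t. (X t powr (- \<eta>) * ?err (X t))\<^sup>2 * wt \<theta> t) absolutely_integrable_on halfline"
      by (rule absolutely_integrable_spike[OF L2_integrable(1)[OF eL2] negligible_empty]) (simp add: e_eq)
    then have "weighted_norm (weight \<theta> \<sigma> \<gamma> \<beta>) ?err = sqrt (sq \<theta> (\<lambda>t. X t powr (- \<eta>) * ?err (X t)))"
      using weighted_norm_eq[of \<theta> \<sigma> \<eta> ?err] shift[of 0] by simp
    also have "sq \<theta> (\<lambda>t. X t powr (- \<eta>) * ?err (X t)) = sq \<theta> ?e"
      unfolding sq_def by (rule integral_cong) (simp add: e_eq)
    finally have err: "weighted_norm (weight \<theta> \<sigma> \<gamma> \<beta>) ?err = sqrt (sq \<theta> ?e)" .
    define N1 where "N1 = weighted_norm (weight (\<theta> + real m - 1) (\<sigma> + real m - 1) \<gamma> \<beta>) ((?D ^^ m) v)"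
    define N2 where "N2 = weighted_norm (weight (\<theta> + real m) (\<sigma> + real m) \<gamma> \<beta>) ((?D ^^ m) v)"
    have N2: "N2 = sqrt (sq (\<theta> + real m) (c m))"
      unfolding N2_def c(4)
      by (rule weighted_norm_eq[OF shift]) (use L2_integrable(1)[OF c(2)[of m]] c(4) in simp)
    obtain k where k: "m = Suc k" using m(1) by (cases m) auto
    \<comment> \<open>The hypothesis on the derivative of \<open>v\<close> makes the first norm a
      genuine integral with exponent \<theta> + m - 1; for a non-integrable square it would take the
      default value 0.\<close>
    have "(?D ^^ k) (?D v) \<in> weighted_L2 (weight (\<theta> + real k) (\<sigma> + real k) \<gamma> \<beta>)"
      using DA m(3) k by (cases "k = 0") (auto simp: space_A_def)
    then have "(?D ^^ m) v \<in> weighted_L2 (weight (\<theta> + real k) (\<sigma> + real k) \<gamma> \<beta>)"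
      by (simp add: k funpow_swap1)
    then have i1: "(\<lambda>t. (c m t)\<^sup>2 * wt (\<theta> + real k) t) absolutely_integrable_on halfline"
      using weighted_L2_iff[OF shift] unfolding c(4) weighted_L2_def by blast
    have N1: "N1 = sqrt (sq (\<theta> + real k) (c m))"
      using weighted_norm_eq[OF shift[of "real k"], of "(?D ^^ m) v"] i1 by (simp add: N1_def k c(4)[unfolded k])
    have cm1: "L2 (\<theta> + real k) (c m)"
      using L2_measurable[OF c(2)[of m]] i1 by (simp add: L2_def)
    have N_nonneg: "0 \<le> N1" "0 \<le> N2" by (simp_all add: N1 N2 sq_nonneg)
    have sq_e: "sq \<theta> ?e \<le> fact (Suc M - m) / fact M * sq (\<theta> + real m) (c m)"
      by (rule interpolation_error_le(1)[OF \<theta>(1) c(1,2) m(1,2) I(1) Iz])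
    have "sqrt (sq \<theta> ?e) \<le> C * sqrt (fact (M + 1 - m) / fact M) * (N1 + 2 * sqrt (ln (real M)) * N2)"
    proof (cases "M = 1")
      case False
      then have "ln 2 \<le> ln (real M)" using M by simp
      then have "sqrt (ln 2) \<le> sqrt (ln (real M))" by simp
      then have "1 / (2 * sqrt (ln 2)) * (2 * sqrt (ln 2)) \<le> C * (2 * sqrt (ln (real M)))"
        by (intro mult_mono C(2)) (use C(1) ln2 in auto)
      \<comment> \<open>For M \<ge> 2 the logarithmic factor is bounded below by its value at 2, so
        the second norm alone carries the estimate.\<close>
      then have 1: "1 \<le> C * (2 * sqrt (ln (real M)))" using ln2 by simp
      let ?q = "sqrt (fact (M + 1 - m) / fact M)"
      have "sqrt (sq \<theta> ?e) \<le> ?q * N2"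
        using real_sqrt_le_mono[OF sq_e] unfolding N2 real_sqrt_mult by simp
      also have "\<dots> \<le> C * (2 * sqrt (ln (real M))) * (?q * N2)"
        using mult_right_mono[OF 1, of "?q * N2"] N_nonneg by simp
      also have "\<dots> \<le> C * ?q * (N1 + 2 * sqrt (ln (real M)) * N2)"
        using N_nonneg C(1) by (simp add: algebra_simps)
      finally show ?thesis .
    next
      case True
      \<comment> \<open>For M = 1 the logarithm is 0 and m is 1 or 2, so the whole error has to be
        bounded by the first norm.\<close>
      have L: "ac_deriv (c 0) (c 1)" using c(1)[of 0] m by simp
      have "sqrt (sq \<theta> ?e) \<le> C * N1"
      proof (cases "k = 0")
        case k0: True
        have "sq \<theta> ?e \<le> C1 * sq \<theta> (c 1)"
          by (rule C1(2)[OF L c0]) (use cm1 I(1) Iz k k0 \<open>M = 1\<close> in \<open>simp_all add: numeral_2_eq_2\<close>)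
        from real_sqrt_le_mono[OF this] have "sqrt (sq \<theta> ?e) \<le> sqrt C1 * N1"
          by (simp add: real_sqrt_mult N1 k k0)
        also have "\<dots> \<le> C * N1" by (rule mult_right_mono[OF C(3) N_nonneg(1)])
        finally show ?thesis .
      next
        case False
        then have k1: "k = 1" using k m(2) True by simp
        \<comment> \<open>Subtracting the value at 1 produces the zero that the Hardy inequality
          with base point 1 requires.\<close>
        have "sq \<theta> ?e \<le> sq (\<theta> + 1) (\<lambda>t. c 1 t - c 1 1)"
          by (rule interpolation_error_le(2)[OF \<theta>(1) c(1,2) m(1,2) I(1) Iz M])
        also have "\<dots> \<le> C2 * sq (\<theta> + 1) (c m)"
        proof (rule C2(2))
          have "ac_deriv (c 1) (c m)" using c(1)[of 1] k k1 by (simp add: numeral_2_eq_2)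
          then show "ac_deriv (\<lambda>t. c 1 t - c 1 1) (c m)" by (simp add: ac_deriv_def)
          have "L2 (\<theta> + 1) (\<lambda>t. c 1 t - poly [:c 1 1:] t)"
            by (intro L2_diff L2_poly \<theta>(2)) (use c(2)[of 1] k k1 in simp)
          then show "L2 (\<theta> + 1) (\<lambda>t. c 1 t - c 1 1)" by simp
          show "L2 (\<theta> + 1) (c m)" using cm1 k1 by simp
        qed simp
        finally have "sqrt (sq \<theta> ?e) \<le> sqrt (C2 * sq (\<theta> + 1) (c m))" by (rule real_sqrt_le_mono)
        also have "\<dots> = sqrt C2 * N1" by (simp add: real_sqrt_mult N1 k1)
        also have "\<dots> \<le> C * N1" by (rule mult_right_mono[OF C(4) N_nonneg(1)])
        finally show ?thesis .
      qed
      moreover have "fact (M + 1 - m) = (1 :: real)" using True m(1) by (cases "m = 1") auto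
      ultimately show ?thesis using True by simp
    qed
    then show "weighted_norm (weight \<theta> \<sigma> \<gamma> \<beta>) ?err
      \<le> C * sqrt (fact (M + 1 - m) / fact M) *
        (weighted_norm (weight (\<theta> + real m - 1) (\<sigma> + real m - 1) \<gamma> \<beta>) ((?D ^^ m) v)
         + 2 * sqrt (ln (real M)) * weighted_norm (weight (\<theta> + real m) (\<sigma> + real m) \<gamma> \<beta>) ((?D ^^ m) v))"
      unfolding err N1_def N2_def .
  qed
qed

end
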